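(* Let $\mathfrak{g}$ be a complex simple Lie algebra and $\mathfrak{q}=\mathfrak{m}+\mathfrak{n}\neq\mathfrak{g}$ a proper standard parabolic subalgebra with standard Levi factor $\mathfrak{m}$ and nilradical $\mathfrak{n}$. Let $\mathfrak{t}=\mathrm{cent}\,\mathfrak{m}$, and let $\beta_1,\ldots,\beta_{\ell(\mathfrak{t})}$, $\mathfrak{n}(k)$, $\nu(\mathrm{cent})$ and $k(\mathrm{cent})$ be as defined in the context. If $1\le i<k(\mathrm{cent})$ and $\nu\in R$ is such that $\mathfrak{g}_\nu\subset\mathfrak{n}(i)$, then there exists $j\in\{1,\ldots,\ell(\mathfrak{t})\}$ such that $\nu+\beta_j\in R$ with $\mathfrak{g}_{\nu+\beta_j}\subset\mathfrak{n}(i+1)$, so that $$[\mathfrak{g}_\nu,\mathfrak{g}_{\beta_j}]=\mathfrak{g}_{\nu+\beta_j}.$$ In particular $[\mathfrak{g}_\nu,\mathfrak{g}_{\beta_j}]\neq 0$. Furthermore $$\mathfrak{g}_{\nu(\mathrm{cent})}=\mathrm{cent}\,\mathfrak{n},$$ and the upper central series $\mathfrak{n}_i$ of $\mathfrak{n}$ is given by $$\mathfrak{n}_i=\sum_{j=1}^{i}\mathfrak{n}(k(\mathrm{cent})-j+1),\qquad i=1,\ldots,k(\mathrm{cent}),$$ and $k(\mathrm{cent})$ is the length of the upper central series.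
   Context: Fix a Cartan subalgebra $\mathfrak{h}$ of $\mathfrak{g}$, with roots $\Delta$, positive roots $\Delta_+$, simple roots $\Pi$, highest root $\psi$, and corresponding Borel subalgebra $\mathfrak{b}$. A standard parabolic subalgebra is a Lie subalgebra $\mathfrak{q}\supset\mathfrak{b}$; $\mathfrak{m}$ is its unique Levi factor containing $\mathfrak{h}$. For $\varphi\in\Delta$ write $\varphi=\sum_{\alpha\in\Pi}n_\alpha(\varphi)\alpha$. For $\nu\in\mathfrak{t}^*$ put $\mathfrak{g}_\nu=\{z\in\mathfrak{g}\mid [x,z]=\nu(x)z\ \text{for all }x\in\mathfrak{t}\}$; a $\mathfrak{t}$-root is a nonzero $\nu\in\mathfrak{t}^*$ with $\mathfrak{g}_\nu\neq0$, and $R$ is the set of $\mathfrak{t}$-roots. Let $\ell(\mathfrak{t})=\dim\mathfrak{t}$, let $\alpha_1,\ldots,\alpha_{\ell(\mathfrak{t})}$ be the simple roots of $\mathfrak{g}$ that are not roots of $\mathfrak{m}$, and let $\beta_j=\alpha_j|_{\mathfrak{t}}\in R$. For $\nu\in R$ put $n_j(\nu)=n_{\alpha_j}(\varphi)$, where $\varphi\in\Delta$ is any root with $\varphi|_{\mathfrak{t}}=\nu$ (independent of the choice of $\varphi$), and $o(\nu)=\sum_{j=1}^{\ell(\mathfrak{t})}n_j(\nu)$. For a nonnegative integer $k$ put $\mathfrak{n}(k)=\sum_{\nu\in R,\ o(\nu)=k}\mathfrak{g}_\nu$. Put $\nu(\mathrm{cent})=\psi|_{\mathfrak{t}}\in R$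 and $k(\mathrm{cent})=o(\nu(\mathrm{cent}))=\sum_{i=1}^{\ell(\mathfrak{t})}n_{\alpha_i}(\psi)$. The upper central series of $\mathfrak{n}$ is the sequence of distinct ideals $\mathfrak{n}_1\subset\mathfrak{n}_2\subset\cdots\subset\mathfrak{n}_d=\mathfrak{n}$ with $\mathfrak{n}_1=\mathrm{cent}\,\mathfrak{n}$ the center and $\mathfrak{n}_i/\mathfrak{n}_{i-1}=\mathrm{cent}(\mathfrak{n}/\mathfrak{n}_{i-1})$ for $i\ge2$; $d$ is its length. *)

theory Defs
  imports Complex_Main "HOL-Library.Function_Algebras"
begin

section \<open>Complex Lie algebras\<close>

class complex_lie_algebra = ab_group_add +
  fixes scaleC :: "complex \<Rightarrow> 'a \<Rightarrow> 'a"  (infixr "*\<^sub>C" 75)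
    and bracket :: "'a \<Rightarrow> 'a \<Rightarrow> 'a"
  assumes scaleC_add_right: "c *\<^sub>C (x + y) = c *\<^sub>C x + c *\<^sub>C y"
    and scaleC_add_left: "(c + d) *\<^sub>C x = c *\<^sub>C x + d *\<^sub>C x"
    and scaleC_scaleC: "c *\<^sub>C d *\<^sub>C x = (c * d) *\<^sub>C x"
    and scaleC_one: "1 *\<^sub>C x = x"
    and bracket_add_left: "bracket (x + y) z = bracket x z + bracket y z"
    and bracket_add_right: "bracket x (y + z) = bracket x y + bracket x z"
    and bracket_scaleC_left: "bracket (c *\<^sub>C x) y = c *\<^sub>C bracket x y"
    and bracket_scaleC_right: "bracket x (c *\<^sub>C y) = c *\<^sub>C bracket x y"
    and bracket_self: "bracket x x = 0"
    and jacobi: "bracket x (bracket y z) + bracket y (bracket z x) + bracket z (bracket x y) = 0"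

global_interpretation complex_lie: vector_space "scaleC :: complex \<Rightarrow> 'a \<Rightarrow> 'a::complex_lie_algebra"
  defines csubspace = complex_lie.subspace
    and cspan = complex_lie.span
    and cdim = complex_lie.dim
  by unfold_locales
    (simp_all add: scaleC_add_right scaleC_add_left scaleC_scaleC scaleC_one)

text \<open>
  Subalgebras, ideals etc. are subsets of the ambient type. The bracket of two subsets is the
  linear span of the brackets of their elements.
\<close>

definition lie_prod :: "'a set \<Rightarrow> 'a set \<Rightarrow> 'a::complex_lie_algebra set" where
  "lie_prod A B = cspan {bracket a b | a b. a \<in> A \<and> b \<in> B}"

definition lie_subalgebra :: "'a::complex_lie_algebra set \<Rightarrow> bool" where
  "lie_subalgebra A \<longleftrightarrow> csubspace A \<and> (\<forall>x\<in>A. \<forall>y\<in>A. bracket x y \<in> A)"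

definition lie_ideal :: "'a::complex_lie_algebra set \<Rightarrow> 'a set \<Rightarrow> bool" where
  "lie_ideal I A \<longleftrightarrow> csubspace I \<and> I \<subseteq> A \<and> (\<forall>x\<in>A. \<forall>y\<in>I. bracket x y \<in> I)"

definition lie_center :: "'a::complex_lie_algebra set \<Rightarrow> 'a set" where
  "lie_center A = {x\<in>A. \<forall>y\<in>A. bracket x y = 0}"

definition lie_normalizer :: "'a::complex_lie_algebra set \<Rightarrow> 'a set" where
  "lie_normalizer A = {x. \<forall>y\<in>A. bracket x y \<in> A}"

primrec lower_central :: "'a::complex_lie_algebra set \<Rightarrow> nat \<Rightarrow> 'a set" where
  "lower_central A 0 = A"
| "lower_central A (Suc n) = lie_prod A (lower_central A n)"

primrec derived_series :: "'a::complex_lie_algebra set \<Rightarrow> nat \<Rightarrow> 'a set" where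
  "derived_series A 0 = A"
| "derived_series A (Suc n) = lie_prod (derived_series A n) (derived_series A n)"

definition lie_nilpotent :: "'a::complex_lie_algebra set \<Rightarrow> bool" where
  "lie_nilpotent A \<longleftrightarrow> (\<exists>n. lower_central A n = {0})"

definition lie_solvable :: "'a::complex_lie_algebra set \<Rightarrow> bool" where
  "lie_solvable A \<longleftrightarrow> (\<exists>n. derived_series A n = {0})"

text \<open>The sum of all nilpotent (respectively solvable) ideals.\<close>

definition nilradical :: "'a::complex_lie_algebra set \<Rightarrow> 'a set" where
  "nilradical A = cspan (\<Union>{I. lie_ideal I A \<and> lie_nilpotent I})"

definition lie_radical :: "'a::complex_lie_algebra set \<Rightarrow> 'a set" where
  "lie_radical A = cspan (\<Union>{I. lie_ideal I A \<and> lie_solvable I})"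

definition lie_reductive :: "'a::complex_lie_algebra set \<Rightarrow> bool" where
  "lie_reductive A \<longleftrightarrow> lie_radical A = lie_center A"

definition finite_dimensional :: "'a::complex_lie_algebra set \<Rightarrow> bool" where
  "finite_dimensional A \<longleftrightarrow> (\<exists>B. finite B \<and> B \<subseteq> A \<and> A \<subseteq> cspan B)"

definition lie_simple :: "'a::complex_lie_algebra set \<Rightarrow> bool" where
  "lie_simple A \<longleftrightarrow> lie_subalgebra A \<and> (\<exists>x\<in>A. \<exists>y\<in>A. bracket x y \<noteq> 0) \<and>
     (\<forall>I. lie_ideal I A \<longrightarrow> I = {0} \<or> I = A)"

text \<open>Elements of the quotient \<open>A/I\<close> by an ideal are the cosets of \<open>I\<close>.\<close>

definition lie_quotient :: "'a::complex_lie_algebra set \<Rightarrow> 'a set \<Rightarrow> 'a set set" where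
  "lie_quotient A I = (\<lambda>x. {x + y | y. y \<in> I}) ` A"

definition coset_bracket :: "'a::complex_lie_algebra set \<Rightarrow> 'a set \<Rightarrow> 'a set \<Rightarrow> 'a set" where
  "coset_bracket I C D = {bracket c d + y | c d y. c \<in> C \<and> d \<in> D \<and> y \<in> I}"

definition lie_quotient_center :: "'a::complex_lie_algebra set \<Rightarrow> 'a set \<Rightarrow> 'a set set" where
  "lie_quotient_center A I =
     {C \<in> lie_quotient A I. \<forall>D\<in>lie_quotient A I. coset_bracket I C D = I}"

text \<open>
  \<open>Z 1, \<dots>, Z d\<close> is the upper central series of \<open>A\<close>, of length \<open>d\<close>: the first term is the
  centre (not zero), the terms are distinct, and the last one is \<open>A\<close>. These conditions
  determine \<open>d\<close> and \<open>Z 1, \<dots>, Z d\<close>; values of \<open>Z\<close> at other indices are irrelevant.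
\<close>

definition upper_central_series ::
    "'a::complex_lie_algebra set \<Rightarrow> nat \<Rightarrow> (nat \<Rightarrow> 'a set) \<Rightarrow> bool" where
  "upper_central_series A d Z \<longleftrightarrow>
     1 \<le> d \<and>
     (\<forall>i\<in>{1..d}. lie_ideal (Z i) A) \<and>
     Z 1 = lie_center A \<and>
     (\<forall>i\<in>{2..d}. Z (i - 1) \<subset> Z i \<and>
        lie_quotient (Z i) (Z (i - 1)) = lie_quotient_center A (Z (i - 1))) \<and>
     Z d = A"


section \<open>Roots\<close>

text \<open>
  A linear functional on a subspace \<open>T\<close> is represented by the function on the whole type that
  vanishes off \<open>T\<close>. Functionals on \<open>T\<close> then correspond to unique functions, closed under the
  pointwise operations.
\<close>

definition dual_space :: "'a::complex_lie_algebra set \<Rightarrow> ('a \<Rightarrow> complex) set" where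
  "dual_space T = {\<nu>. (\<forall>x\<in>T. \<forall>y\<in>T. \<nu> (x + y) = \<nu> x + \<nu> y) \<and>
                      (\<forall>c. \<forall>x\<in>T. \<nu> (c *\<^sub>C x) = c * \<nu> x) \<and> (\<forall>x. x \<notin> T \<longrightarrow> \<nu> x = 0)}"

definition restrict_functional :: "'a set \<Rightarrow> ('a \<Rightarrow> complex) \<Rightarrow> 'a \<Rightarrow> complex" where
  "restrict_functional T \<phi> = (\<lambda>x. if x \<in> T then \<phi> x else 0)"

definition functional_scale :: "complex \<Rightarrow> ('a \<Rightarrow> complex) \<Rightarrow> 'a \<Rightarrow> complex" where
  "functional_scale c \<phi> = (\<lambda>x. c * \<phi> x)"

global_interpretation functional: vector_space functional_scale
  defines functional_dependent = functional.dependent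
  by unfold_locales (auto simp: functional_scale_def fun_eq_iff algebra_simps)

definition root_space :: "'a set \<Rightarrow> ('a \<Rightarrow> complex) \<Rightarrow> 'a::complex_lie_algebra set" where
  "root_space T \<nu> = {z. \<forall>x\<in>T. bracket x z = \<nu> x *\<^sub>C z}"

text \<open>Used both for a Cartan subalgebra and for the centre of a Levi factor.\<close>

definition roots :: "'a::complex_lie_algebra set \<Rightarrow> ('a \<Rightarrow> complex) set" where
  "roots T = {\<nu>\<in>dual_space T. \<nu> \<noteq> 0 \<and> root_space T \<nu> \<noteq> {0}}"

definition cartan_subalgebra :: "'a::complex_lie_algebra set \<Rightarrow> bool" where
  "cartan_subalgebra H \<longleftrightarrow> lie_subalgebra H \<and> lie_nilpotent H \<and> lie_normalizer H = H"

text \<open>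
  A choice of positive roots is given by the corresponding system \<open>S\<close> of simple roots.
\<close>

definition simple_root_system ::
    "'a::complex_lie_algebra set \<Rightarrow> ('a \<Rightarrow> complex) set \<Rightarrow> bool" where
  "simple_root_system H S \<longleftrightarrow>
     finite S \<and> S \<subseteq> roots H \<and> \<not> functional_dependent S \<and>
     (\<forall>\<phi>\<in>roots H. \<exists>n :: ('a \<Rightarrow> complex) \<Rightarrow> int.
        \<phi> = (\<Sum>\<alpha>\<in>S. functional_scale (of_int (n \<alpha>)) \<alpha>) \<and>
        ((\<forall>\<alpha>\<in>S. 0 \<le> n \<alpha>) \<or> (\<forall>\<alpha>\<in>S. n \<alpha> \<le> 0)))"

text \<open>\<open>root_coeff S \<phi> \<alpha>\<close> is the integer $n_\alpha(\varphi)$.\<close>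

definition root_coeff ::
    "('a \<Rightarrow> complex) set \<Rightarrow> ('a \<Rightarrow> complex) \<Rightarrow> ('a \<Rightarrow> complex) \<Rightarrow> int" where
  "root_coeff S \<phi> = (THE n. \<phi> = (\<Sum>\<alpha>\<in>S. functional_scale (of_int (n \<alpha>)) \<alpha>) \<and>
                            (\<forall>\<alpha>. \<alpha> \<notin> S \<longrightarrow> n \<alpha> = 0))"

definition positive_roots ::
    "'a::complex_lie_algebra set \<Rightarrow> ('a \<Rightarrow> complex) set \<Rightarrow> ('a \<Rightarrow> complex) set" where
  "positive_roots H S = {\<phi>\<in>roots H. \<forall>\<alpha>\<in>S. 0 \<le> root_coeff S \<phi> \<alpha>}"

definition highest_root ::
    "'a::complex_lie_algebra set \<Rightarrow> ('a \<Rightarrow> complex) set \<Rightarrow> 'a \<Rightarrow> complex" where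
  "highest_root H S = (THE \<psi>. \<psi> \<in> roots H \<and>
     (\<forall>\<phi>\<in>roots H. \<forall>\<alpha>\<in>S. root_coeff S \<phi> \<alpha> \<le> root_coeff S \<psi> \<alpha>))"


section \<open>Standard parabolic subalgebras\<close>

definition borel ::
    "'a::complex_lie_algebra set \<Rightarrow> ('a \<Rightarrow> complex) set \<Rightarrow> 'a set" where
  "borel H S = cspan (H \<union> (\<Union>\<phi>\<in>positive_roots H S. root_space H \<phi>))"

definition standard_parabolic ::
    "'a::complex_lie_algebra set \<Rightarrow> ('a \<Rightarrow> complex) set \<Rightarrow> 'a set \<Rightarrow> bool" where
  "standard_parabolic H S Q \<longleftrightarrow> lie_subalgebra Q \<and> borel H S \<subseteq> Q"

text \<open>
  A Levi factor of a parabolic subalgebra is a reductive subalgebra complementary to the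
  nilradical (not a semisimple subalgebra complementary to the radical).
\<close>

definition levi_factor :: "'a::complex_lie_algebra set \<Rightarrow> 'a set \<Rightarrow> bool" where
  "levi_factor Q M \<longleftrightarrow> lie_subalgebra M \<and> lie_reductive M \<and>
     M \<inter> nilradical Q = {0} \<and> Q = {x + y | x y. x \<in> M \<and> y \<in> nilradical Q}"

text \<open>The simple roots of the ambient algebra that are not roots of \<open>M\<close>.\<close>

definition simple_roots_outside ::
    "'a::complex_lie_algebra set \<Rightarrow> ('a \<Rightarrow> complex) set \<Rightarrow> 'a set \<Rightarrow> ('a \<Rightarrow> complex) set" where
  "simple_roots_outside H S M = {\<alpha>\<in>S. root_space H \<alpha> \<inter> M = {0}}"

text \<open>
  In the following, \<open>\<alpha> 1, \<dots>, \<alpha> (cdim T)\<close> enumerates \<^term>\<open>simple_roots_outside H S M\<close>, where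
  \<open>T\<close> is the centre of \<open>M\<close>; \<open>t_coeff\<close> is $n_j(\nu)$, \<open>t_order\<close> is $o(\nu)$ and
  \<open>graded_part\<close> is $\mathfrak{n}(k)$. The value of \<open>t_coeff\<close> does not depend on the choice of the
  root restricting to $\nu$.
\<close>

definition t_coeff ::
    "'a::complex_lie_algebra set \<Rightarrow> ('a \<Rightarrow> complex) set \<Rightarrow> 'a set \<Rightarrow> (nat \<Rightarrow> 'a \<Rightarrow> complex) \<Rightarrow>
     nat \<Rightarrow> ('a \<Rightarrow> complex) \<Rightarrow> int" where
  "t_coeff H S T \<alpha> j \<nu> =
     root_coeff S (SOME \<phi>. \<phi> \<in> roots H \<and> restrict_functional T \<phi> = \<nu>) (\<alpha> j)"

definition t_order ::
    "'a::complex_lie_algebra set \<Rightarrow> ('a \<Rightarrow> complex) set \<Rightarrow> 'a set \<Rightarrow> (nat \<Rightarrow> 'a \<Rightarrow> complex) \<Rightarrow>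
     ('a \<Rightarrow> complex) \<Rightarrow> int" where
  "t_order H S T \<alpha> \<nu> = (\<Sum>j = 1..cdim T. t_coeff H S T \<alpha> j \<nu>)"

definition graded_part ::
    "'a::complex_lie_algebra set \<Rightarrow> ('a \<Rightarrow> complex) set \<Rightarrow> 'a set \<Rightarrow> (nat \<Rightarrow> 'a \<Rightarrow> complex) \<Rightarrow>
     nat \<Rightarrow> 'a set" where
  "graded_part H S T \<alpha> k =
     cspan (\<Union>\<nu>\<in>{\<nu>\<in>roots T. t_order H S T \<alpha> \<nu> = int k}. root_space T \<nu>)"

end

theory Submission
  imports Defs "HOL-Computational_Algebra.Fundamental_Theorem_Algebra"
begin

text \<open>
  A basis of the algebra adapted to the generalized weight spaces of \<open>H\<close>, on which \<open>ad H\<close> is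
  triangular, reduces the structure theory to traces: an element \<open>[e, f]\<close> of \<open>H\<close> has trace 0 on
  every sum of weight spaces stable under \<open>e\<close> and \<open>f\<close>. Applied to strings and half strings of
  weights, this gives the nondegeneracy of the Killing form, one-dimensional root spaces and the
  positivity of the inner product on roots.

  The root spaces of \<open>T\<close> are irreducible under \<open>M\<close>: inside one of them, the sums of the roots of
  a proper submodule and of the remaining weights would have positive inner product, so two of these
  roots would differ by a root of \<open>M\<close>. If \<open>E \<alpha>\<close> kills the root space of \<open>\<nu>\<close> for every simple
  \<open>\<alpha>\<close> outside \<open>M\<close>, a root of maximal height in it is singular, hence the highest root, by
  simplicity. So below the top degree some \<open>\<beta> j\<close> raises \<open>\<nu>\<close>, and irreducibility turns a nonzero
  bracket into an equality. The upper central series is read off from this.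
\<close>

section \<open>Elementary bracket calculus\<close>

text \<open>A Cartan subalgebra comes as nilpotent and self-normalizing, so at the outset
  \<open>ad H\<close> is not known to be commutative or diagonalizable, and weights are mere
  functions on \<open>H\<close>. The basis is therefore built so that the products
  \<open>ad h ad h'\<close> have readable diagonals: the Killing form on \<open>H\<close> becomes a
  sum of products of weights before anything else is known. Characteristic zero enters twice: in
  \<open>[X^k, y] = k s X^(k-1)\<close>, which makes scalar commutators vanish, and in dividing a
  trace relation by the number of weights, which makes the weights on \<open>[e, f]\<close> real
  multiples of one another. Sums of real squares then give nonvanishing and positivity.

  \<open>Q\<close>, \<open>M\<close>, \<open>N\<close> and \<open>T\<close> are given intrinsically.
  Each is stable under \<open>H\<close>, and a stable subspace contains the root vectors occurring
  in its elements; so questions about them become questions about sets of roots. Root vectors carry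
  no normalization: what matters is whether a bracket vanishes, and invariance of the Killing form
  moves nonvanishing around a triple of roots with sum zero.\<close>

lemma bracket_zero_left [simp]: "bracket 0 x = 0"
  using bracket_add_left[of 0 0 x] by simp

lemma bracket_zero_right [simp]: "bracket x 0 = 0"
  using bracket_add_right[of x 0 0] by simp

lemma bracket_minus_left: "bracket (- x) y = - bracket x y"
  using bracket_add_left[of x "- x" y] by (simp add: eq_neg_iff_add_eq_0 add.commute)

lemma bracket_minus_right: "bracket x (- y) = - bracket x y"
  using bracket_add_right[of x y "- y"] by (simp add: eq_neg_iff_add_eq_0 add.commute)

lemma bracket_diff_left: "bracket (x - y) z = bracket x z - bracket y z"
  by (metis add_uminus_conv_diff bracket_add_left bracket_minus_left)

lemma bracket_diff_right: "bracket x (y - z) = bracket x y - bracket x z"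
  by (metis add_uminus_conv_diff bracket_add_right bracket_minus_right)

lemma bracket_antisym: "bracket x y = - bracket y x"
proof -
  have "bracket x y + bracket y x = 0"
    using bracket_self[of "x + y"] bracket_self[of x] bracket_self[of y]
    by (simp only: bracket_add_left bracket_add_right) (simp add: add.commute)
  then show ?thesis by (simp add: eq_neg_iff_add_eq_0)
qed

lemma bracket_derivation:
  "bracket x (bracket y z) = bracket (bracket x y) z + bracket y (bracket x z)"
  using jacobi[of x y z] bracket_antisym[of z "bracket x y"] bracket_antisym[of z x]
  by (simp add: bracket_minus_right algebra_simps)

lemma bracket_sum_left: "bracket (sum f A) x = (\<Sum>a\<in>A. bracket (f a) x)"
  by (induction A rule: infinite_finite_induct) (simp_all add: bracket_add_left)

lemma bracket_bracket_left:
  "bracket (bracket x y) z = bracket x (bracket y z) - bracket y (bracket x z)"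
  using bracket_derivation[of x y z] by simp

section \<open>Linear operators and subspaces stable under brackets\<close>

abbreviation clinear :: "('a::complex_lie_algebra \<Rightarrow> 'a) \<Rightarrow> bool"
  where "clinear \<equiv> Vector_Spaces.linear scaleC scaleC"

lemma clinearI:
  assumes "\<And>x y. f (x + y) = f x + f y" "\<And>c x. f (c *\<^sub>C x) = c *\<^sub>C f x"
  shows "clinear f"
  by (simp add: Vector_Spaces.linear_iff assms complex_lie.vector_space_axioms)

lemma clinear_add: "clinear f \<Longrightarrow> f (x + y) = f x + f y"
  and clinear_scale: "clinear f \<Longrightarrow> f (c *\<^sub>C x) = c *\<^sub>C f x"
  by (simp_all add: Vector_Spaces.linear_iff)

lemma clinear_zero: "clinear f \<Longrightarrow> f 0 = 0"
  using clinear_add[of f 0 0] by simp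

lemma clinear_sum:
  assumes "clinear f"
  shows "f (sum g A) = (\<Sum>a\<in>A. f (g a))"
  using assms by (induction A rule: infinite_finite_induct) (simp_all add: clinear_add clinear_zero)

lemma clinear_diff: "clinear f \<Longrightarrow> f (x - y) = f x - f y"
  by (metis add_diff_cancel_right' clinear_add diff_add_cancel)

lemma clinear_ad: "clinear (bracket x)"
  by (rule clinearI) (simp_all add: bracket_add_right bracket_scaleC_right)

text \<open>\<open>A\<close> is an arbitrary set, so that one notion covers a single operator
  \<open>{h}\<close>, modules over \<open>H\<close> or \<open>M\<close>, and ideals, which are the
  stable subspaces for \<open>A = UNIV\<close>.\<close>

definition ad_stable :: "'a::complex_lie_algebra set \<Rightarrow> 'a set \<Rightarrow> bool" where
  "ad_stable A W \<longleftrightarrow> (\<forall>x\<in>A. \<forall>w\<in>W. bracket x w \<in> W)"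

lemma ad_stableD: "ad_stable A W \<Longrightarrow> x \<in> A \<Longrightarrow> w \<in> W \<Longrightarrow> bracket x w \<in> W"
  by (simp add: ad_stable_def)

lemma ad_stable_Int: "ad_stable A V \<Longrightarrow> ad_stable A W \<Longrightarrow> ad_stable A (V \<inter> W)"
  by (simp add: ad_stable_def)

lemma bracket_in_span:
  assumes "v \<in> cspan X" "\<And>b. b \<in> X \<Longrightarrow> bracket x b \<in> W" "csubspace W"
  shows "bracket x v \<in> W"
proof -
  have "csubspace {v. bracket x v \<in> W}"
    using assms(3) by (auto simp: complex_lie.subspace_def bracket_add_right bracket_scaleC_right)
  then have "cspan X \<subseteq> {v. bracket x v \<in> W}"
    using assms(2) by (intro complex_lie.span_minimal) auto
  with assms(1) show ?thesis by auto
qed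

lemma bracket_in_span2:
  assumes "v \<in> cspan X" "w \<in> cspan Y" "\<And>a b. a \<in> X \<Longrightarrow> b \<in> Y \<Longrightarrow> bracket a b \<in> W" "csubspace W"
  shows "bracket v w \<in> W"
proof (rule bracket_in_span[OF assms(2) _ assms(4)])
  fix b assume b: "b \<in> Y"
  have "bracket b v \<in> W"
  proof (rule bracket_in_span[OF assms(1) _ assms(4)])
    fix a assume "a \<in> X"
    then show "bracket b a \<in> W"
      using assms(3)[OF _ b] bracket_antisym[of b a] complex_lie.subspace_neg[OF assms(4)] by metis
  qed
  then show "bracket v b \<in> W"
    using bracket_antisym[of v b] complex_lie.subspace_neg[OF assms(4)] by metis
qed

lemma ad_stable_span:
  assumes "\<And>x b. x \<in> A \<Longrightarrow> b \<in> X \<Longrightarrow> bracket x b \<in> cspan X"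
  shows "ad_stable A (cspan X)"
  unfolding ad_stable_def
  by (intro ballI, rule bracket_in_span) (auto intro: assms complex_lie.subspace_span)

section \<open>Finite dimension\<close>

lemma finite_dimensional_basis:
  assumes "finite_dimensional (UNIV :: 'a::complex_lie_algebra set)"
  obtains E :: "'a::complex_lie_algebra set" where "finite_dimensional_vector_space scaleC E"
proof -
  obtain F :: "'a set" where F: "finite F" "cspan F = UNIV"
    using assms by (auto simp: finite_dimensional_def)
  obtain E :: "'a set" where E: "complex_lie.independent E" "cspan E = UNIV"
    using complex_lie.basis_exists[of UNIV] by (metis top.extremum_uniqueI)
  have "finite E"
    using complex_lie.independent_span_bound[OF F(1) E(1)] F(2) by auto
  with E have "finite_dimensional_vector_space scaleC E"
    by (unfold_locales) (auto simp: cspan_def)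
  then show thesis by (rule that)
qed

lemma cdim_strict_mono:
  fixes U W :: "'a::complex_lie_algebra set"
  assumes fd: "finite_dimensional (UNIV :: 'a set)"
    and U: "csubspace U" and W: "csubspace W" and "U \<subset> W"
  shows "cdim U < cdim W"
proof -
  obtain E :: "'a set" where "finite_dimensional_vector_space scaleC E"
    using finite_dimensional_basis[OF fd] .
  then interpret fd: finite_dimensional_vector_space "scaleC :: complex \<Rightarrow> 'a \<Rightarrow> 'a" E .
  have "cspan U \<subset> cspan W"
    using assms complex_lie.span_eq_iff by metis
  then show ?thesis
    using fd.dim_psubset[of U W] by (simp add: cspan_def cdim_def)
qed

lemma independent_bound:
  assumes fd: "finite_dimensional (UNIV :: 'a::complex_lie_algebra set)"
  obtains d where "\<And>B :: 'a::complex_lie_algebra set. complex_lie.independent B \<Longrightarrow> finite B \<and> card B \<le> d"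
proof -
  obtain F :: "'a set" where F: "finite F" "cspan F = UNIV"
    using assms by (auto simp: finite_dimensional_def)
  show thesis
    by (rule that[of "card F"]) (use complex_lie.independent_span_bound[OF F(1)] F(2) in auto)
qed

text \<open>Least dimension decides. This supplies minimal submodules strictly above a given
  one.\<close>

lemma minimal_subspace:
  fixes W :: "'a::complex_lie_algebra set"
  assumes fd: "finite_dimensional (UNIV :: 'a set)" and "P W" and sub: "\<And>V. P V \<Longrightarrow> csubspace V"
  obtains V where "P V" "\<And>V'. P V' \<Longrightarrow> V' \<subseteq> V \<Longrightarrow> V' = V"
proof -
  obtain V where V: "P V" "\<And>V'. P V' \<Longrightarrow> cdim V \<le> cdim V'"
    using exists_least_iff[of "\<lambda>d. \<exists>V. P V \<and> cdim V = d"] assms(2) by (metis not_le)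
  have "V' = V" if "P V'" "V' \<subseteq> V" for V'
    using cdim_strict_mono[OF fd sub[OF that(1)] sub[OF V(1)]] V(2)[OF that(1)] that(2) by force
  with V(1) show thesis by (rule that)
qed

section \<open>Generalized eigenspaces\<close>

text \<open>The product of the operators \<open>f - c\<close> over the list, kept in factored form:
  the primary decomposition peels off one factor per induction step.\<close>

primrec poly_map :: "complex list \<Rightarrow> ('a \<Rightarrow> 'a) \<Rightarrow> 'a::complex_lie_algebra \<Rightarrow> 'a" where
  "poly_map [] f v = v"
| "poly_map (c # cs) f v = f (poly_map cs f v) - c *\<^sub>C poly_map cs f v"

text \<open>Horner's scheme for \<open>p(f) v\<close>; it carries a factorization of
  \<open>p\<close> over to a product of operators.\<close>

definition poly_act :: "('a \<Rightarrow> 'a) \<Rightarrow> complex poly \<Rightarrow> 'a::complex_lie_algebra \<Rightarrow> 'a" where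
  "poly_act f p v = fold_coeffs (\<lambda>a w. a *\<^sub>C v + f w) p 0"

lemma poly_act_0 [simp]: "poly_act f 0 v = 0"
  by (simp add: poly_act_def)

lemma poly_act_pCons:
  assumes "clinear f"
  shows "poly_act f (pCons a p) v = a *\<^sub>C v + f (poly_act f p v)"
  using clinear_zero[OF assms]
  by (cases "a = 0 \<and> p = 0") (auto simp: poly_act_def)

lemma poly_act_add:
  assumes "clinear f"
  shows "poly_act f (p + q) v = poly_act f p v + poly_act f q v"
  by (induction p q rule: poly_induct2)
    (simp_all add: poly_act_pCons assms scaleC_add_left clinear_add algebra_simps)

lemma poly_act_smult:
  assumes "clinear f"
  shows "poly_act f (smult c p) v = c *\<^sub>C poly_act f p v"
  by (induction p) (simp_all add: poly_act_pCons assms scaleC_add_right scaleC_scaleC clinear_scale)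

lemma poly_act_linear_factor:
  assumes "clinear f"
  shows "poly_act f ([:- c, 1:] * p) v = f (poly_act f p v) - c *\<^sub>C poly_act f p v"
proof -
  have "[:- c, 1:] * p = pCons 0 p + smult (- c) p"
    by simp
  then show ?thesis
    by (simp only: poly_act_add[OF assms] poly_act_smult[OF assms] poly_act_pCons[OF assms]) simp
qed

lemma poly_act_prod:
  assumes "clinear f"
  shows "poly_act f (\<Prod>c\<leftarrow>cs. [:- c, 1:]) v = poly_map cs f v"
proof (induction cs)
  case Nil
  show ?case by (simp add: one_pCons poly_act_pCons[OF assms] clinear_zero[OF assms] scaleC_one)
next
  case (Cons c cs)
  then show ?case by (simp only: list.map prod_list.Cons poly_act_linear_factor[OF assms] poly_map.simps)
qed

lemma poly_act_monom:
  assumes "clinear f"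
  shows "poly_act f (monom a i) v = a *\<^sub>C (f ^^ i) v"
  by (induction i) (simp_all add: monom_0 monom_Suc poly_act_pCons assms clinear_zero clinear_scale)

text \<open>If no iterate of \<open>v\<close> lay in the span of its predecessors, there would be
  independent sets of every size.\<close>

lemma krylov_relation:
  fixes f :: "'a::complex_lie_algebra \<Rightarrow> 'a"
  assumes fd: "finite_dimensional (UNIV :: 'a set)"
  obtains k where "(f ^^ k) v \<in> cspan ((\<lambda>i. (f ^^ i) v) ` {..<k})"
proof (rule ccontr)
  assume no: "\<not> thesis"
  obtain d where d: "\<And>B :: 'a set. complex_lie.independent B \<Longrightarrow> finite B \<and> card B \<le> d"
    using independent_bound[OF fd] by metis
  let ?A = "\<lambda>k. (\<lambda>i. (f ^^ i) v) ` {..<k}"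
  have "complex_lie.independent (?A k) \<and> card (?A k) = k" (is "?I k") for k
  proof (induction k)
    case 0
    show ?case by (simp add: complex_lie.independent_empty)
  next
    case (Suc k)
    have n: "(f ^^ k) v \<notin> cspan (?A k)"
      using no that by blast
    then have "(f ^^ k) v \<notin> ?A k"
      by (metis complex_lie.span_base)
    then show ?case
      using complex_lie.independent_insertI[OF n] Suc by (simp add: lessThan_Suc)
  qed
  then have "?I (Suc d)" .
  then have "Suc d \<le> d" using d[of "(\<lambda>i. (f ^^ i) v) ` {..<Suc d}"] by simp
  then show False by simp
qed

text \<open>A linear relation among the iterates of \<open>v\<close> is a nonzero polynomial
  \<open>p\<close> with \<open>p(f) v = 0\<close>. Over the complex numbers it splits into linear
  factors, and its leading coefficient can be divided out.\<close>

lemma annihilating_list: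
  fixes v :: "'a::complex_lie_algebra"
  assumes fd: "finite_dimensional (UNIV :: 'a set)" and f: "clinear f"
  obtains cs where "poly_map cs f v = 0"
proof -
  obtain k where k: "(f ^^ k) v \<in> cspan ((\<lambda>i. (f ^^ i) v) ` {..<k})"
    using krylov_relation[OF fd] .
  let ?X = "{x. \<exists>q. (\<forall>i\<ge>k. coeff q i = 0) \<and> poly_act f q v = x}"
  have "csubspace ?X"
    unfolding complex_lie.subspace_def
  proof (safe, goal_cases)
    case 1
    show ?case by (rule exI[of _ 0]) simp
  next
    case (2 x y q q')
    then show ?case by (intro exI[of _ "q + q'"]) (simp add: poly_act_add f)
  next
    case (3 c x q)
    then show ?case by (intro exI[of _ "smult c q"]) (simp add: poly_act_smult f)
  qed
  moreover have "(\<lambda>i. (f ^^ i) v) ` {..<k} \<subseteq> ?X"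
  proof clarify
    fix i assume "i < k"
    then show "\<exists>q. (\<forall>i\<ge>k. coeff q i = 0) \<and> poly_act f q v = (f ^^ i) v"
      by (intro exI[of _ "monom 1 i"]) (simp add: poly_act_monom f scaleC_one)
  qed
  ultimately have "(f ^^ k) v \<in> ?X"
    using k complex_lie.span_minimal by blast
  then obtain q where q: "\<And>i. i \<ge> k \<Longrightarrow> coeff q i = 0" "poly_act f q v = (f ^^ k) v"
    by auto
  \<comment> \<open>The coefficients of \<open>q\<close> vanish from \<open>k\<close> on, so
    \<open>p\<close> has coefficient 1 at \<open>k\<close> and is not zero.\<close>
  define p where "p = monom 1 k + smult (- 1) q"
  have "coeff p k = 1"
    using q(1)[of k] by (simp add: p_def)
  then have p0: "p \<noteq> 0" by auto
  have pv: "poly_act f p v = 0"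
    by (simp only: p_def poly_act_add[OF f] poly_act_smult[OF f] poly_act_monom[OF f] q(2))
      (simp add: scaleC_one)
  obtain A where A: "size A = degree p" "p = smult (lead_coeff p) (\<Prod>x\<in>#A. [:- x, 1:])"
    using alg_closed_imp_factorization[OF p0] by metis
  obtain cs where cs: "A = mset cs" by (metis ex_mset)
  have pr: "p = smult (lead_coeff p) (\<Prod>x\<leftarrow>cs. [:- x, 1:])"
    using A(2) unfolding cs by (metis mset_map prod_mset_prod_list)
  have "lead_coeff p *\<^sub>C poly_map cs f v = poly_act f (smult (lead_coeff p) (\<Prod>x\<leftarrow>cs. [:- x, 1:])) v"
    by (simp only: poly_act_smult[OF f] poly_act_prod[OF f])
  also have "\<dots> = 0" using pv pr by simp
  finally have "poly_map cs f v = 0" using p0 by simp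
  then show thesis by (rule that)
qed

section \<open>Leibniz rule and primary decomposition\<close>

definition shift :: "'a::complex_lie_algebra \<Rightarrow> complex \<Rightarrow> 'a \<Rightarrow> 'a" where
  "shift h c v = bracket h v - c *\<^sub>C v"

definition geig :: "'a::complex_lie_algebra \<Rightarrow> complex \<Rightarrow> 'a set" where
  "geig h c = {v. \<exists>n. (shift h c ^^ n) v = 0}"

text \<open>Generalized simultaneous eigenvectors; the exponent may depend on \<open>h\<close>.
  \<open>\<theta>\<close> is any function, of which only the values on \<open>H\<close> count.
  Requiring it to vanish off \<open>H\<close> later ensures that distinct weights differ at a point
  of \<open>H\<close>.\<close>

definition gws :: "'a set \<Rightarrow> ('a \<Rightarrow> complex) \<Rightarrow> 'a::complex_lie_algebra set" where
  "gws H \<theta> = {v. \<forall>h\<in>H. v \<in> geig h (\<theta> h)}"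

lemma clinear_shift: "clinear (shift h c)"
  by (rule clinearI)
    (simp_all add: shift_def bracket_add_right bracket_scaleC_right scaleC_add_right
      scaleC_scaleC complex_lie.scale_right_diff_distrib mult.commute)

lemma clinear_funpow: "clinear f \<Longrightarrow> clinear (f ^^ n)"
  by (induction n) (auto intro!: clinearI simp: clinear_add clinear_scale)

lemmas shift_pow_simps =
  clinear_zero[OF clinear_funpow[OF clinear_shift]]
  clinear_add[OF clinear_funpow[OF clinear_shift]]
  clinear_diff[OF clinear_funpow[OF clinear_shift]]
  clinear_scale[OF clinear_funpow[OF clinear_shift]]

lemmas shift_simps =
  clinear_zero[OF clinear_shift] clinear_add[OF clinear_shift]
  clinear_diff[OF clinear_shift] clinear_scale[OF clinear_shift]

lemma shift_commute: "shift h c (shift h d v) = shift h d (shift h c v)"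
  by (simp add: shift_def bracket_diff_right bracket_scaleC_right scaleC_scaleC
      complex_lie.scale_right_diff_distrib mult.commute algebra_simps)

lemma shift_pow_commute: "(shift h c ^^ n) (shift h d v) = shift h d ((shift h c ^^ n) v)"
  by (induction n) (simp_all add: shift_commute)

lemma shift_pow_mono:
  assumes "(shift h c ^^ n) v = 0" "n \<le> m"
  shows "(shift h c ^^ m) v = 0"
proof -
  have "(shift h c ^^ m) v = (shift h c ^^ (m - n)) ((shift h c ^^ n) v)"
    using assms(2) by (metis comp_apply funpow_add le_add_diff_inverse2)
  then show ?thesis using assms(1) by (simp add: shift_pow_simps)
qed

lemma subspace_geig: "csubspace (geig h c)"
  unfolding complex_lie.subspace_def
proof (intro conjI ballI allI)
  show "0 \<in> geig h c"
    unfolding geig_def by (intro CollectI exI[of _ 0]) simp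
next
  fix x y assume "x \<in> geig h c" "y \<in> geig h c"
  then obtain m n where mn: "(shift h c ^^ m) x = 0" "(shift h c ^^ n) y = 0"
    by (auto simp: geig_def)
  have "(shift h c ^^ (m + n)) (x + y) = 0"
    using shift_pow_mono[OF mn(1), of "m + n"] shift_pow_mono[OF mn(2), of "m + n"]
    by (simp add: shift_pow_simps)
  then show "x + y \<in> geig h c" by (auto simp: geig_def)
next
  fix a x assume "x \<in> geig h c"
  then show "a *\<^sub>C x \<in> geig h c"
    by (auto simp: geig_def shift_pow_simps)
qed

lemma subspace_gws: "csubspace (gws H \<theta>)"
proof -
  have "gws H \<theta> = (\<Inter>h\<in>H. geig h (\<theta> h))" by (auto simp: gws_def)
  then show ?thesis using complex_lie.subspace_Int[of H] subspace_geig by metis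
qed

lemma shift_in_geig: "v \<in> geig h c \<Longrightarrow> shift h d v \<in> geig h c"
proof -
  assume "v \<in> geig h c"
  then obtain n where "(shift h c ^^ n) v = 0" by (auto simp: geig_def)
  then have "(shift h c ^^ n) (shift h d v) = 0" by (simp add: shift_pow_commute shift_simps)
  then show ?thesis by (auto simp: geig_def)
qed

lemma shift_pow_in_geig: "v \<in> geig h c \<Longrightarrow> (shift h d ^^ n) v \<in> geig h c"
  by (induction n) (simp_all add: shift_in_geig)

lemma geig_of_shift: "shift h c v \<in> geig h c \<Longrightarrow> v \<in> geig h c"
proof -
  assume "shift h c v \<in> geig h c"
  then obtain n where "(shift h c ^^ n) (shift h c v) = 0" by (auto simp: geig_def)
  then have "(shift h c ^^ Suc n) v = 0" by (simp add: shift_pow_commute)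
  then show ?thesis unfolding geig_def by blast
qed

lemma shift_bracket:
  "shift h (c + d) (bracket y v) = bracket (shift h c y) v + bracket y (shift h d v)"
  by (simp add: shift_def bracket_derivation[of h y v] bracket_diff_left bracket_diff_right
      bracket_scaleC_left bracket_scaleC_right scaleC_add_left)

text \<open>By the Leibniz rule each factor passes to one of the two arguments, and after
  \<open>m + n\<close> factors one argument is exhausted. Induction on \<open>m + n\<close> takes
  the place of a binomial formula.\<close>

lemma shift_pow_bracket:
  "(shift h c ^^ m) y = 0 \<Longrightarrow> (shift h d ^^ n) v = 0 \<Longrightarrow>
     (shift h (c + d) ^^ (m + n)) (bracket y v) = 0"
proof (induction "m + n" arbitrary: m n y v)
  case 0
  then show ?case by simp
next
  case (Suc k)
  show ?case
  proof (cases "m = 0 \<or> n = 0")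
    case True
    then show ?thesis using Suc.prems by (auto simp: shift_pow_simps)
  next
    case False
    then obtain m' n' where mn: "m = Suc m'" "n = Suc n'"
      by (meson not0_implies_Suc)
    have "(shift h (c + d) ^^ (m' + n)) (bracket (shift h c y) v) = 0"
      by (rule Suc.hyps) (use Suc mn in \<open>auto simp: funpow_Suc_right simp del: funpow.simps(2)\<close>)
    moreover have "(shift h (c + d) ^^ (m + n')) (bracket y (shift h d v)) = 0"
      by (rule Suc.hyps) (use Suc mn in \<open>auto simp: funpow_Suc_right simp del: funpow.simps(2)\<close>)
    moreover have "m + n' = m' + n" using mn by simp
    ultimately have "(shift h (c + d) ^^ (m' + n)) (shift h (c + d) (bracket y v)) = 0"
      by (simp only: shift_bracket shift_pow_simps) simp
    then show ?thesis using mn(1) by (simp add: shift_pow_commute)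
  qed
qed

lemma geig_bracket:
  assumes "y \<in> geig h c" "v \<in> geig h d"
  shows "bracket y v \<in> geig h (c + d)"
  using assms shift_pow_bracket unfolding geig_def by blast

lemma gws_bracket:
  assumes "y \<in> gws H \<theta>" "v \<in> gws H \<mu>"
  shows "bracket y v \<in> gws H (\<theta> + \<mu>)"
  using assms geig_bracket unfolding gws_def plus_fun_def by blast

lemma shift_in_subspace:
  assumes "csubspace W" "ad_stable H W" "h \<in> H" "w \<in> W"
  shows "shift h c w \<in> W"
  using assms by (auto simp: shift_def intro!: complex_lie.subspace_diff complex_lie.subspace_scale dest: ad_stableD)

lemma shift_pow_in_subspace:
  assumes "csubspace W" "ad_stable H W" "h \<in> H" "w \<in> W"
  shows "(shift h c ^^ n) w \<in> W"
  by (induction n) (simp_all add: assms shift_in_subspace[OF assms(1-3)])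

text \<open>On \<open>geig h d\<close> the operator \<open>shift h c\<close> is the nonzero scalar
  \<open>d - c\<close> plus the nilpotent \<open>shift h d\<close>, hence invertible; induction on
  the nilpotency exponent builds the preimage.\<close>

lemma shift_solve:
  assumes W: "csubspace W" "ad_stable {h} W" and "w \<in> W" "w \<in> geig h d" "d \<noteq> c"
  shows "\<exists>u\<in>W \<inter> geig h d. shift h c u = w"
proof -
  obtain n where "(shift h d ^^ n) w = 0" using assms(4) by (auto simp: geig_def)
  then show ?thesis using \<open>w \<in> W\<close>
  proof (induction n arbitrary: w)
    case 0
    then show ?case
      by (intro bexI[of _ 0]) (auto simp: shift_simps complex_lie.subspace_0 W subspace_geig)
  next
    case (Suc n)
    have "w \<in> geig h d" using Suc.prems(1) unfolding geig_def by blast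
    have "(shift h d ^^ n) (shift h d w) = 0"
      using Suc.prems(1) by (simp add: shift_pow_commute)
    then obtain u where u: "u \<in> W \<inter> geig h d" "shift h c u = shift h d w"
      using Suc.IH[of "shift h d w"] shift_in_subspace[OF W _ Suc.prems(2), of h d] by auto
    have "shift h c w = shift h d w + (d - c) *\<^sub>C w"
      by (simp add: shift_def complex_lie.scale_left_diff_distrib)
    then have "shift h c (w - u) = (d - c) *\<^sub>C w"
      using u(2) by (simp add: shift_simps)
    then have "shift h c ((1 / (d - c)) *\<^sub>C (w - u)) = w"
      using assms(5) by (simp add: shift_simps scaleC_scaleC scaleC_one)
    moreover have "(1 / (d - c)) *\<^sub>C (w - u) \<in> W \<inter> geig h d"
      using u(1) Suc.prems(2) \<open>w \<in> geig h d\<close> W(1) subspace_geig[of h d]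
      by (auto intro!: complex_lie.subspace_scale complex_lie.subspace_diff)
    ultimately show ?case by blast
  qed
qed

lemma poly_map_commute:
  assumes "clinear f"
  shows "poly_map cs f (f v - c *\<^sub>C v) = f (poly_map cs f v) - c *\<^sub>C poly_map cs f v"
proof (induction cs)
  case (Cons a cs)
  show ?case
    by (simp only: poly_map.simps Cons.IH clinear_diff[OF assms] clinear_scale[OF assms])
      (simp add: scaleC_scaleC complex_lie.scale_right_diff_distrib mult.commute)
qed simp

text \<open>One step of the primary decomposition: some \<open>u\<close> in the span has the same
  image under \<open>shift h c\<close> as \<open>v\<close>, up to \<open>geig h c\<close>; then
  \<open>v - u\<close> itself lies in \<open>geig h c\<close>.\<close>

lemma geig_span_of_shift:
  assumes W: "csubspace W" "ad_stable {h} W" and v: "v \<in> W"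
    and s: "shift h c v \<in> cspan (\<Union>d. W \<inter> geig h d)"
  shows "v \<in> cspan (\<Union>d. W \<inter> geig h d)"
proof -
  let ?X = "cspan (\<Union>d. W \<inter> geig h d)"
  \<comment> \<open>The vectors reached by \<open>shift h c\<close> from the span, up to a remainder
    in \<open>geig h c\<close>. A component with \<open>d \<noteq> c\<close> has a preimage; one
    with \<open>d = c\<close> is its own remainder, with \<open>u = 0\<close>.\<close>
  let ?Y = "{w. \<exists>u\<in>?X. w - shift h c u \<in> W \<inter> geig h c}"
  have XW: "?X \<subseteq> W" by (rule complex_lie.span_minimal) (use W in auto)
  have WG: "csubspace (W \<inter> geig h c)"
    by (rule complex_lie.subspace_inter[OF W(1) subspace_geig])
  have "csubspace ?Y"
    unfolding complex_lie.subspace_def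
  proof (intro conjI ballI allI)
    show "0 \<in> ?Y"
      using complex_lie.subspace_0[OF WG] complex_lie.span_zero
      by (intro CollectI bexI[of _ 0]) (auto simp: shift_simps)
  next
    fix x y assume "x \<in> ?Y" "y \<in> ?Y"
    then obtain u u' where u: "u \<in> ?X" "x - shift h c u \<in> W \<inter> geig h c"
      "u' \<in> ?X" "y - shift h c u' \<in> W \<inter> geig h c" by blast
    have "x + y - shift h c (u + u') = (x - shift h c u) + (y - shift h c u')"
      by (simp only: shift_simps add_diff_add)
    then have "x + y - shift h c (u + u') \<in> W \<inter> geig h c"
      using complex_lie.subspace_add[OF WG u(2) u(4)] by metis
    with u(1,3) show "x + y \<in> ?Y" using complex_lie.span_add by blast
  next
    fix a x assume "x \<in> ?Y"
    then obtain u where u: "u \<in> ?X" "x - shift h c u \<in> W \<inter> geig h c" by blast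
    have "a *\<^sub>C x - shift h c (a *\<^sub>C u) = a *\<^sub>C (x - shift h c u)"
      by (simp add: shift_simps complex_lie.scale_right_diff_distrib)
    then have "a *\<^sub>C x - shift h c (a *\<^sub>C u) \<in> W \<inter> geig h c"
      using complex_lie.subspace_scale[OF WG u(2)] by metis
    with u(1) show "a *\<^sub>C x \<in> ?Y" using complex_lie.span_scale by blast
  qed
  moreover have "(\<Union>d. W \<inter> geig h d) \<subseteq> ?Y"
  proof clarify
    fix w d assume w: "w \<in> W" "w \<in> geig h d"
    show "\<exists>u\<in>?X. w - shift h c u \<in> W \<inter> geig h c"
    proof (cases "d = c")
      case True
      then show ?thesis using w complex_lie.span_zero
        by (intro bexI[of _ 0]) (auto simp: shift_simps)
    next
      case False
      then obtain u where "u \<in> W \<inter> geig h d" "shift h c u = w"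
        using shift_solve[OF W w] by blast
      then show ?thesis
        using complex_lie.subspace_0[OF WG]
        by (intro bexI[of _ u]) (auto intro: complex_lie.span_base)
    qed
  qed
  ultimately have "shift h c v \<in> ?Y"
    using s complex_lie.span_minimal by blast
  then obtain u where u: "u \<in> ?X" "shift h c v - shift h c u \<in> geig h c" by blast
  then have "v - u \<in> geig h c"
    using geig_of_shift[of h c "v - u"] by (simp add: shift_simps)
  moreover have "v - u \<in> W"
    using v u(1) XW W(1) complex_lie.subspace_diff by blast
  ultimately have "v - u \<in> ?X"
    by (intro complex_lie.span_base) blast
  then show ?thesis using u(1) complex_lie.span_add[of "v - u" _ u] by simp
qed

lemma primary_decomposition:
  assumes fd: "finite_dimensional (UNIV :: 'a::complex_lie_algebra set)"
    and W: "csubspace W" "ad_stable {h} W" and v: "(v :: 'a) \<in> W"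
  shows "v \<in> cspan (\<Union>c. W \<inter> geig h c)"
proof -
  obtain cs where "poly_map cs (bracket h) v = 0"
    using annihilating_list[OF fd clinear_ad] .
  then show ?thesis using v
  proof (induction cs arbitrary: v)
    case Nil
    then show ?case by (simp add: complex_lie.span_zero)
  next
    case (Cons c cs)
    have "poly_map cs (bracket h) (shift h c v) = 0"
      using Cons.prems(1) by (simp add: shift_def poly_map_commute[OF clinear_ad])
    then have "shift h c v \<in> cspan (\<Union>c. W \<inter> geig h c)"
      using Cons.IH shift_in_subspace[OF W _ Cons.prems(2), of h c] by simp
    then show ?case by (rule geig_span_of_shift[OF W Cons.prems(2)])
  qed
qed

text \<open>\<open>(d - c) w\<close> is the difference of \<open>shift h c w\<close> and
  \<open>shift h d w\<close>, and the latter has a smaller nilpotency exponent. So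
  \<open>shift h c\<close> is injective on \<open>geig h d\<close> modulo \<open>W\<close>.\<close>

lemma geig_in_subspace_step:
  assumes W: "csubspace W" "ad_stable H W" "h \<in> H" and "d \<noteq> c"
    and "w \<in> geig h d" "shift h c w \<in> W"
  shows "w \<in> W"
proof -
  obtain n where "(shift h d ^^ n) w = 0" using assms(5) by (auto simp: geig_def)
  then show ?thesis using \<open>shift h c w \<in> W\<close>
  proof (induction n arbitrary: w)
    case 0
    then show ?case by (simp add: complex_lie.subspace_0 W)
  next
    case (Suc n)
    have 1: "shift h c (shift h d w) \<in> W"
      using shift_in_subspace[OF W Suc.prems(2), of d] by (simp add: shift_commute)
    have 2: "(shift h d ^^ n) (shift h d w) = 0"
      using Suc.prems(1) by (simp add: shift_pow_commute)
    have "shift h d w \<in> W" by (rule Suc.IH[OF 2 1])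
    moreover have "w = (1 / (d - c)) *\<^sub>C (shift h c w - shift h d w)"
      using \<open>d \<noteq> c\<close>
      by (simp add: shift_def scaleC_scaleC scaleC_one flip: complex_lie.scale_left_diff_distrib)
    ultimately show ?case
      using Suc.prems(2) W(1) complex_lie.subspace_scale complex_lie.subspace_diff by metis
  qed
qed

lemma geig_in_subspace:
  assumes W: "csubspace W" "ad_stable H W" "h \<in> H" and "d \<noteq> c"
    and "w \<in> geig h d" "(shift h c ^^ n) w \<in> W"
  shows "w \<in> W"
  using assms(6)
proof (induction n)
  case (Suc n)
  then have "(shift h c ^^ n) w \<in> W"
    by (rule_tac geig_in_subspace_step[OF W \<open>d \<noteq> c\<close>])
      (simp_all add: shift_pow_in_geig assms)
  then show ?case by (rule Suc.IH)
qed simp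

section \<open>Weights of a nilpotent subalgebra\<close>

lemma lower_central_subspace: "csubspace H \<Longrightarrow> csubspace (lower_central H n)"
  by (cases n) (simp_all add: lie_prod_def complex_lie.subspace_span)

lemma lower_central_bracket:
  "x \<in> H \<Longrightarrow> y \<in> lower_central H n \<Longrightarrow> bracket x y \<in> lower_central H (Suc n)"
  by (auto simp: lie_prod_def intro: complex_lie.span_base)

lemma lower_central_subset:
  assumes "lie_subalgebra H"
  shows "lower_central H n \<subseteq> H"
proof (induction n)
  case (Suc n)
  then show ?case
    using assms unfolding lower_central.simps lie_prod_def lie_subalgebra_def
    by (intro complex_lie.span_minimal) auto
qed simp

locale nilpotent_subalgebra =
  fixes H :: "'a::complex_lie_algebra set"
  assumes fd: "finite_dimensional (UNIV :: 'a set)"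
    and subalg: "lie_subalgebra H" and nilp: "lie_nilpotent H"
begin

lemma subspace_H: "csubspace H" using subalg by (simp add: lie_subalgebra_def)

lemma finite_independent:
  assumes "complex_lie.independent (B :: 'a set)"
  shows "finite B"
  using assms independent_bound[OF fd] by blast

lemma stable_H: "ad_stable H H" using subalg by (simp add: lie_subalgebra_def ad_stable_def)

text \<open>\<open>lower_central\<close> brackets with the algebra on the left, so the powers of
  \<open>ad x\<close> run down the series to zero.\<close>

lemma in_geig_0:
  assumes "x \<in> H" "y \<in> H"
  shows "y \<in> geig x 0"
proof -
  obtain m where m: "lower_central H m = {0}" using nilp by (auto simp: lie_nilpotent_def)
  have "(shift x 0 ^^ n) y \<in> lower_central H n" for n
  proof (induction n)
    case (Suc n)
    then show ?case using lower_central_bracket[OF assms(1)] by (simp add: shift_def)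
  qed (use assms in simp)
  from this[of m] have "(shift x 0 ^^ m) y = 0" unfolding m by simp
  then show ?thesis by (auto simp: geig_def)
qed

text \<open>Elements of \<open>H\<close> may fail to commute, but by nilpotency \<open>H\<close>
  lies in \<open>geig h 0\<close>, and brackets add eigenvalues.\<close>

lemma stable_geig: "h \<in> H \<Longrightarrow> ad_stable H (geig h c)"
  using geig_bracket[of _ h 0 _ c] in_geig_0 by (auto simp: ad_stable_def)

lemma stable_gws: "ad_stable H (gws H \<theta>)"
  using stable_geig by (auto simp: ad_stable_def gws_def)

text \<open>Induction on the dimension. If some \<open>h\<close> has no single eigenvalue on
  \<open>W\<close>, the pieces \<open>W \<inter> geig h c\<close> are proper and stable under all of
  \<open>H\<close>; otherwise \<open>W\<close> lies in one weight space.\<close>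

lemma gws_decomposition:
  assumes "csubspace W" "ad_stable H W"
  shows "W \<subseteq> cspan (\<Union>\<theta>\<in>{\<theta>. \<forall>x. x \<notin> H \<longrightarrow> \<theta> x = 0}. W \<inter> gws H \<theta>)"
  using assms
proof (induction "cdim W" arbitrary: W rule: less_induct)
  case less
  let ?\<Lambda> = "{\<theta>. \<forall>x. x \<notin> H \<longrightarrow> \<theta> x = (0::complex)}"
  show ?case
  proof (cases "\<forall>h\<in>H. \<exists>c. W \<subseteq> geig h c")
    case True
    then obtain l where l: "\<And>h. h \<in> H \<Longrightarrow> W \<subseteq> geig h (l h)" by metis
    let ?l = "\<lambda>h. if h \<in> H then l h else 0"
    have "W \<subseteq> W \<inter> gws H ?l" using l by (auto simp: gws_def)
    also have "\<dots> \<subseteq> (\<Union>\<theta>\<in>?\<Lambda>. W \<inter> gws H \<theta>)" by (rule UN_upper) simp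
    also note complex_lie.span_superset
    finally show ?thesis .
  next
    case False
    then obtain h where h: "h \<in> H" "\<And>c. \<not> W \<subseteq> geig h c" by auto
    have "W \<inter> geig h c \<subseteq> cspan (\<Union>\<theta>\<in>?\<Lambda>. W \<inter> gws H \<theta>)" for c
    proof -
      have s: "csubspace (W \<inter> geig h c)"
        by (rule complex_lie.subspace_inter[OF less.prems(1) subspace_geig])
      have "W \<inter> geig h c \<subset> W" using h(2)[of c] by auto
      from cdim_strict_mono[OF fd s less.prems(1) this]
      have "W \<inter> geig h c \<subseteq> cspan (\<Union>\<theta>\<in>?\<Lambda>. W \<inter> geig h c \<inter> gws H \<theta>)"
        by (rule less.hyps[OF _ s ad_stable_Int[OF less.prems(2) stable_geig[OF h(1)]]])
      also have "\<dots> \<subseteq> cspan (\<Union>\<theta>\<in>?\<Lambda>. W \<inter> gws H \<theta>)"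
        by (rule complex_lie.span_mono) auto
      finally show ?thesis .
    qed
    then have "cspan (\<Union>c. W \<inter> geig h c) \<subseteq> cspan (\<Union>\<theta>\<in>?\<Lambda>. W \<inter> gws H \<theta>)"
      by (intro complex_lie.span_minimal complex_lie.subspace_span) auto
    moreover have "ad_stable {h} W" using less.prems(2) h(1) by (simp add: ad_stable_def)
    ultimately show ?thesis using primary_decomposition[OF fd less.prems(1)] by blast
  qed
qed

text \<open>With \<open>h\<close> separating two weights, a power of
  \<open>shift h (\<mu>0 h)\<close> removes the component of weight \<open>\<mu>0\<close>, and it is
  injective modulo \<open>W\<close> on the component of the other weight. So the number of
  components can be reduced one by one.\<close>

lemma component_in_stable_subspace:
  assumes W: "csubspace W" "ad_stable H W"
    and "finite F" "\<And>\<mu> x. \<mu> \<in> F \<Longrightarrow> x \<notin> H \<Longrightarrow> \<mu> x = 0"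
    and "\<And>\<mu>. \<mu> \<in> F \<Longrightarrow> v \<mu> \<in> gws H \<mu>" and "(\<Sum>\<mu>\<in>F. v \<mu>) \<in> W" and "\<mu> \<in> F"
  shows "v \<mu> \<in> W"
  using assms(3-7)
proof (induction F arbitrary: v \<mu> rule: finite_induct)
  case (insert \<mu>0 F)
  have F: "v \<mu>1 \<in> W" if "\<mu>1 \<in> F" for \<mu>1
  proof -
    have "\<mu>1 \<noteq> \<mu>0" using that insert.hyps(2) by auto
    then obtain h where "\<mu>1 h \<noteq> \<mu>0 h" by (auto simp: fun_eq_iff)
    moreover from this have "h \<in> H" using insert.prems(1)[of \<mu>1 h] insert.prems(1)[of \<mu>0 h] that by (cases "h \<in> H") auto
    ultimately have h: "h \<in> H" "\<mu>1 h \<noteq> \<mu>0 h" by simp_all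
    obtain n where n: "(shift h (\<mu>0 h) ^^ n) (v \<mu>0) = 0"
      using insert.prems(2)[of \<mu>0] h(1) by (auto simp: gws_def geig_def)
    let ?D = "shift h (\<mu>0 h) ^^ n"
    have "?D (\<Sum>\<mu>\<in>insert \<mu>0 F. v \<mu>) = (\<Sum>\<mu>\<in>F. ?D (v \<mu>))"
      using n insert.hyps
      by (simp add: clinear_sum[OF clinear_funpow[OF clinear_shift]] shift_pow_simps)
    then have s: "(\<Sum>\<mu>\<in>F. ?D (v \<mu>)) \<in> W"
      using shift_pow_in_subspace[OF W h(1) insert.prems(3)] by metis
    have g: "?D (v \<mu>) \<in> gws H \<mu>" if "\<mu> \<in> F" for \<mu>
      using shift_pow_in_subspace[OF subspace_gws stable_gws h(1)] insert.prems(2) that by auto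
    have "?D (v \<mu>1) \<in> W"
      by (rule insert.IH[OF _ g s that]) (use insert.prems(1) in auto)
    moreover have "v \<mu>1 \<in> geig h (\<mu>1 h)"
      using insert.prems(2)[of \<mu>1] that h(1) by (auto simp: gws_def)
    ultimately show ?thesis
      using geig_in_subspace[OF W h(1,2)] by blast
  qed
  then have "(\<Sum>\<mu>\<in>F. v \<mu>) \<in> W" by (intro complex_lie.subspace_sum[OF W(1)])
  then have "v \<mu>0 \<in> W"
    using insert.prems(3) insert.hyps complex_lie.subspace_diff[OF W(1)]
    by (metis add_diff_cancel_right' sum.insert)
  then show ?case using F insert.prems(4) by auto
qed simp

section \<open>Simultaneous weight vectors: a form of Lie's theorem for nilpotent algebras\<close>

lemma uniform_exponent:
  fixes h :: 'a
  assumes "csubspace W" "W \<subseteq> geig h c"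
  obtains n where "\<And>w. w \<in> W \<Longrightarrow> (shift h c ^^ n) w = 0"
proof -
  obtain F where F: "F \<subseteq> W" "complex_lie.independent F" "W \<subseteq> cspan F"
    using complex_lie.basis_exists[of W] by metis
  have fin: "finite F" by (rule finite_independent[OF F(2)])
  have "\<forall>w\<in>F. \<exists>n. (shift h c ^^ n) w = 0"
    using assms(2) F(1) by (auto simp: geig_def)
  from bchoice[OF this] obtain e where e: "\<forall>w\<in>F. (shift h c ^^ e w) w = 0" ..
  define n where "n = (\<Sum>w\<in>F. e w)"
  have "F \<subseteq> {w. (shift h c ^^ n) w = 0}"
  proof clarify
    fix w assume w: "w \<in> F"
    then have "e w \<le> n" unfolding n_def by (intro member_le_sum fin) auto
    then show "(shift h c ^^ n) w = 0" using shift_pow_mono[of "e w"] e w by metis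
  qed
  moreover have "csubspace {w. (shift h c ^^ n) w = 0}"
    by (simp add: complex_lie.subspace_def shift_pow_simps)
  ultimately have "cspan F \<subseteq> {w. (shift h c ^^ n) w = 0}"
    by (rule complex_lie.span_minimal)
  then show thesis using F(3) by (intro that) auto
qed

text \<open>Modulo \<open>U\<close>, \<open>X = shift x c\<close> is nilpotent and
  \<open>[X, y]\<close> is the scalar \<open>s\<close>, so \<open>[X^k, y] = k s X^(k-1)\<close>.
  For the least \<open>k\<close> with \<open>X^k = 0\<close> the right-hand side must vanish, which
  in characteristic zero forces \<open>s = 0\<close>.\<close>

lemma commutator_scalar_zero:
  assumes U: "csubspace U" "ad_stable H U" and W: "csubspace W" "ad_stable H W" and "U \<subset> W"
    and x: "x \<in> H" and y: "y \<in> H" and Wx: "W \<subseteq> geig x c"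
    and s: "\<And>w. w \<in> W \<Longrightarrow> bracket (bracket x y) w - s *\<^sub>C w \<in> U"
  shows "s = 0"
proof (rule ccontr)
  assume "s \<noteq> 0"
  let ?X = "shift x c"
  obtain n where "\<And>w. w \<in> W \<Longrightarrow> (?X ^^ n) w = 0" using uniform_exponent[OF W(1) Wx] by blast
  then have "\<exists>n. \<forall>w\<in>W. (?X ^^ n) w \<in> U" using complex_lie.subspace_0[OF U(1)] by (intro exI[of _ n]) auto
  then obtain k where k: "\<forall>w\<in>W. (?X ^^ k) w \<in> U" and least: "\<And>j. j < k \<Longrightarrow> \<not> (\<forall>w\<in>W. (?X ^^ j) w \<in> U)"
    using exists_least_iff[of "\<lambda>n. \<forall>w\<in>W. (?X ^^ n) w \<in> U"] by blast
  have "k \<noteq> 0" using k \<open>U \<subset> W\<close> by (metis funpow_0 psubsetE subsetI)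
  \<comment> \<open>The commutator formula modulo \<open>U\<close>. At \<open>j = 0\<close> the
    exponent \<open>j - 1\<close> is truncated to 0, but its coefficient is 0.\<close>
  have *: "(?X ^^ j) (bracket y w) - bracket y ((?X ^^ j) w) - (of_nat j * s) *\<^sub>C (?X ^^ (j - 1)) w \<in> U"
    (is "?R j \<in> U") if w: "w \<in> W" for j w
  proof (induction j)
    case 0
    then show ?case by (simp add: complex_lie.subspace_0[OF U(1)])
  next
    case (Suc j)
    let ?u = "(?X ^^ j) w"
    have 1: "?X (?R j) \<in> U" by (rule shift_in_subspace[OF U x Suc])
    have 2: "bracket (bracket x y) ?u - s *\<^sub>C ?u \<in> U"
      by (rule s[OF shift_pow_in_subspace[OF W x w]])
    have 3: "?X ((of_nat j * s) *\<^sub>C (?X ^^ (j - 1)) w) = (of_nat j * s) *\<^sub>C ?u"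
      by (cases j) (simp_all only: shift_simps, simp_all)
    have 4: "?X (bracket y ?u) = bracket (bracket x y) ?u + bracket y (?X ?u)"
      by (simp add: shift_def bracket_derivation[of x y] bracket_diff_right bracket_scaleC_right)
    have "?X (?R j) = ?X ((?X ^^ j) (bracket y w)) - ?X (bracket y ?u) - (of_nat j * s) *\<^sub>C ?u"
      by (simp only: clinear_diff[OF clinear_shift] 3)
    then have "?R (Suc j) = ?X (?R j) + (bracket (bracket x y) ?u - s *\<^sub>C ?u)"
      by (simp add: 4 scaleC_add_left algebra_simps)
    then show ?case using complex_lie.subspace_add[OF U(1) 1 2] by simp
  qed
  have "(?X ^^ (k - 1)) w \<in> U" if w: "w \<in> W" for w
  proof -
    have "(?X ^^ k) (bracket y w) \<in> U" using k ad_stableD[OF W(2) y w] by simp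
    moreover have "bracket y ((?X ^^ k) w) \<in> U" using k w ad_stableD[OF U(2) y] by simp
    ultimately have "(?X ^^ k) (bracket y w) - bracket y ((?X ^^ k) w) \<in> U"
      by (rule complex_lie.subspace_diff[OF U(1)])
    from complex_lie.subspace_diff[OF U(1) this *[OF w, of k]]
    have "(of_nat k * s) *\<^sub>C (?X ^^ (k - 1)) w \<in> U" by simp
    from complex_lie.subspace_scale[OF U(1) this, of "1 / (of_nat k * s)"] show ?thesis
      using \<open>s \<noteq> 0\<close> \<open>k \<noteq> 0\<close> by (simp add: scaleC_scaleC scaleC_one)
  qed
  then show False using least[of "k - 1"] \<open>k \<noteq> 0\<close> by simp
qed

text \<open>Take \<open>V\<close> minimal among the stable subspaces strictly above
  \<open>U\<close>. Going up the lower central series from zero, each \<open>x\<close> acts on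
  \<open>V / U\<close> by the scalar \<open>\<theta> x\<close>: brackets of \<open>x\<close> with
  \<open>H\<close> lie in the term treated before, so they act by scalars, and these vanish; hence
  the kernel of \<open>x - \<theta> x\<close> is stable and nonzero, and by minimality it is all of
  \<open>V / U\<close>.\<close>

lemma relative_weight_vector:
  assumes U: "csubspace U" "ad_stable H U" and W: "csubspace W" "ad_stable H W" and "U \<subset> W"
    and WL: "W \<subseteq> gws H \<theta>"
  shows "\<exists>v\<in>W. v \<notin> U \<and> (\<forall>h\<in>H. bracket h v - \<theta> h *\<^sub>C v \<in> U)"
proof -
  let ?P = "\<lambda>V. csubspace V \<and> ad_stable H V \<and> U \<subset> V \<and> V \<subseteq> W"
  obtain V where V: "?P V" and min: "\<And>V'. ?P V' \<Longrightarrow> V' \<subseteq> V \<Longrightarrow> V' = V"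
    using minimal_subspace[OF fd, of ?P W] assms by auto
  then have V': "csubspace V" "ad_stable H V" "U \<subset> V" "V \<subseteq> W" by auto
  have Vg: "V \<subseteq> geig h (\<theta> h)" if "h \<in> H" for h
    using V'(4) WL that by (auto simp: gws_def)
  obtain v where v: "v \<in> V" "v \<notin> U" using V'(3) by auto
  have "v \<noteq> 0" using v complex_lie.subspace_0[OF U(1)] by auto
  \<comment> \<open>\<open>\<theta>\<close> is not yet known to be linear, so its value at 0 needs
    an argument. It starts the induction, where the term of the series is
    \<open>{0}\<close>.\<close>
  have l0: "\<theta> 0 = 0"
  proof (rule ccontr)
    assume "\<theta> 0 \<noteq> 0"
    obtain n where "(shift 0 (\<theta> 0) ^^ n) v = 0"
      using Vg[of 0] complex_lie.subspace_0[OF subspace_H] v(1) by (auto simp: geig_def)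
    moreover have "(shift 0 (\<theta> 0) ^^ n) v = (- \<theta> 0) ^ n *\<^sub>C v"
      by (induction n) (simp_all add: shift_def scaleC_one scaleC_scaleC)
    ultimately show False using \<open>v \<noteq> 0\<close> \<open>\<theta> 0 \<noteq> 0\<close> by simp
  qed
  obtain m where m: "lower_central H m = {0}" using nilp by (auto simp: lie_nilpotent_def)
  \<comment> \<open>At \<open>k = m\<close> the term is \<open>H\<close> itself; beyond
    \<open>m\<close> the truncated difference stays 0.\<close>
  have "\<forall>x\<in>lower_central H (m - k). \<forall>w\<in>V. shift x (\<theta> x) w \<in> U" for k
  proof (induction k)
    case 0
    then show ?case by (simp add: m shift_def l0 complex_lie.subspace_0[OF U(1)])
  next
    case (Suc k)
    show ?case
    proof (cases "k < m")
      case False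
      then show ?thesis using Suc by simp
    next
      case True
      then have mk: "m - k = Suc (m - Suc k)" by simp
      show ?thesis
      proof
        fix x assume x: "x \<in> lower_central H (m - Suc k)"
        have xH: "x \<in> H" using x lower_central_subset[OF subalg] by blast
        let ?K = "{w\<in>V. shift x (\<theta> x) w \<in> U}"
        have "csubspace ?K"
          using V'(1) U(1) by (auto simp: complex_lie.subspace_def shift_simps)
        moreover have "ad_stable H ?K"
          unfolding ad_stable_def
        proof (intro ballI)
          fix y w assume y: "y \<in> H" and w: "w \<in> ?K"
          have wV: "w \<in> V" and wU: "shift x (\<theta> x) w \<in> U" using w by auto
          have "bracket y x \<in> lower_central H (m - k)"
            unfolding mk by (rule lower_central_bracket[OF y x])
          then have xy: "bracket x y \<in> lower_central H (m - k)"
            using bracket_antisym[of x y] complex_lie.subspace_neg[OF lower_central_subspace[OF subspace_H]]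
            by metis
          have s: "bracket (bracket x y) w - \<theta> (bracket x y) *\<^sub>C w \<in> U" if "w \<in> V" for w
            using Suc xy that unfolding shift_def by blast
          have "\<theta> (bracket x y) = 0"
            by (rule commutator_scalar_zero[OF U V'(1,2,3) xH y Vg[OF xH] s])
          then have "bracket (bracket x y) w \<in> U" using s[OF wV] by simp
          moreover have "bracket y (shift x (\<theta> x) w) \<in> U"
            using ad_stableD[OF U(2) y wU] .
          moreover have "shift x (\<theta> x) (bracket y w) = bracket (bracket x y) w + bracket y (shift x (\<theta> x) w)"
            by (simp add: shift_def bracket_derivation[of x y] bracket_diff_right bracket_scaleC_right)
          ultimately have "shift x (\<theta> x) (bracket y w) \<in> U"
            using complex_lie.subspace_add[OF U(1)] by simp
          then show "bracket y w \<in> ?K" using ad_stableD[OF V'(2) y wV] by simp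
        qed
        moreover have "U \<subset> ?K"
        proof -
          have "U \<subseteq> ?K" using V'(3) shift_in_subspace[OF U xH] by auto
          \<comment> \<open>The last iterate of \<open>v\<close> outside \<open>U\<close> lies in
            the kernel.\<close>
          moreover have "\<exists>w\<in>?K. w \<notin> U"
          proof -
            obtain n where n: "(shift x (\<theta> x) ^^ n) v = 0" using Vg[OF xH] v(1) by (auto simp: geig_def)
            then have "\<exists>n. (shift x (\<theta> x) ^^ n) v \<in> U" using complex_lie.subspace_0[OF U(1)] by (intro exI[of _ n]) simp
            then obtain j where j: "(shift x (\<theta> x) ^^ j) v \<in> U" "\<And>i. i < j \<Longrightarrow> (shift x (\<theta> x) ^^ i) v \<notin> U"
              using exists_least_iff[of "\<lambda>n. (shift x (\<theta> x) ^^ n) v \<in> U"] by blast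
            have "j \<noteq> 0" using j(1) v(2) by (metis funpow_0)
            then obtain i where i: "j = Suc i" by (meson not0_implies_Suc)
            have "(shift x (\<theta> x) ^^ i) v \<in> ?K"
              using j(1) shift_pow_in_subspace[OF V'(1,2) xH v(1)] by (simp add: i)
            then show ?thesis using j(2)[of i] i by blast
          qed
          ultimately show ?thesis by blast
        qed
        moreover have "?K \<subseteq> V" by blast
        ultimately have "?K = V" using V'(4) min[of ?K] by blast
        then show "\<forall>w\<in>V. shift x (\<theta> x) w \<in> U" by blast
      qed
    qed
  qed
  from this[of m] have "\<forall>x\<in>H. shift x (\<theta> x) v \<in> U" using v(1) by simp
  then show ?thesis using v V'(4) by (auto simp: shift_def)
qed

text \<open>A true eigenvector, obtained with \<open>U = {0}\<close>, makes its eigenvalue a linear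
  function of \<open>h\<close>.\<close>

lemma weight_linear:
  assumes "gws H \<theta> \<noteq> {0}" "\<And>x. x \<notin> H \<Longrightarrow> \<theta> x = 0"
  shows "\<theta> \<in> dual_space H"
proof -
  have "{0} \<subset> gws H \<theta>" using assms(1) complex_lie.subspace_0[OF subspace_gws] by auto
  have "ad_stable H {0}" by (simp add: ad_stable_def)
  then obtain v where "v \<in> gws H \<theta>" "v \<notin> {0}" "\<And>h. h \<in> H \<Longrightarrow> bracket h v - \<theta> h *\<^sub>C v \<in> {0}"
    using relative_weight_vector[OF complex_lie.subspace_single_0 _ subspace_gws stable_gws
          \<open>{0} \<subset> gws H \<theta>\<close> subset_refl] by blast
  then have v: "v \<noteq> 0" "\<And>h. h \<in> H \<Longrightarrow> bracket h v - \<theta> h *\<^sub>C v = 0" by auto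
  then have e: "\<theta> h *\<^sub>C v = bracket h v" if "h \<in> H" for h using that by auto
  have "\<theta> (x + y) = \<theta> x + \<theta> y" if "x \<in> H" "y \<in> H" for x y
  proof -
    have "\<theta> (x + y) *\<^sub>C v = (\<theta> x + \<theta> y) *\<^sub>C v"
      using that complex_lie.subspace_add[OF subspace_H that] by (simp add: e bracket_add_left scaleC_add_left)
    then show ?thesis using v(1) by simp
  qed
  moreover have "\<theta> (c *\<^sub>C x) = c * \<theta> x" if "x \<in> H" for x c
  proof -
    have "\<theta> (c *\<^sub>C x) *\<^sub>C v = (c * \<theta> x) *\<^sub>C v"
      using that complex_lie.subspace_scale[OF subspace_H that]
      by (simp add: e bracket_scaleC_left flip: scaleC_scaleC)
    then show ?thesis using v(1) by simp
  qed
  ultimately show ?thesis using assms(2) by (simp add: dual_space_def)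
qed

section \<open>Bases adapted to the weights\<close>

text \<open>Triangularity at one basis vector, expressed without an ordering of the basis:
  \<open>b\<close> is an eigenvector modulo a stable \<open>U\<close> whose elements do not involve
  \<open>b\<close>. Stability of \<open>U\<close> makes the diagonal entry of
  \<open>ad h ad h'\<close> the product of the two weights.\<close>

definition flag_at :: "'a set \<Rightarrow> ('a \<Rightarrow> 'a \<Rightarrow> complex) \<Rightarrow> 'a \<Rightarrow> bool" where
  "flag_at B wt b \<longleftrightarrow> (\<exists>U. csubspace U \<and> ad_stable H U \<and>
     U \<subseteq> cspan {b'\<in>B - {b}. wt b' = wt b} \<and> (\<forall>h\<in>H. bracket h b - wt b h *\<^sub>C b \<in> U))"

text \<open>Spanning is left out so that such a set can be enlarged one vector at a time. The last
  clause keeps a true eigenvector for every weight; commutativity of \<open>H\<close> and the root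
  vectors rest on it.\<close>

definition adapted :: "'a set \<Rightarrow> ('a \<Rightarrow> 'a \<Rightarrow> complex) \<Rightarrow> bool" where
  "adapted B wt \<longleftrightarrow> complex_lie.independent B \<and>
     (\<forall>b\<in>B. wt b \<in> dual_space H \<and> b \<in> gws H (wt b) \<and> flag_at B wt b \<and>
        (\<exists>e\<in>B. wt e = wt b \<and> e \<in> root_space H (wt e)))"

lemma weight_part_stable:
  assumes "adapted B wt"
  shows "ad_stable H (cspan {b\<in>B. wt b = \<theta>})"
proof (rule ad_stable_span)
  fix h b assume h: "h \<in> H" and b: "b \<in> {b\<in>B. wt b = \<theta>}"
  then obtain U where "U \<subseteq> cspan {b'\<in>B - {b}. wt b' = wt b}" "bracket h b - wt b h *\<^sub>C b \<in> U"
    using assms unfolding adapted_def flag_at_def by blast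
  moreover have "cspan {b'\<in>B - {b}. wt b' = wt b} \<subseteq> cspan {b\<in>B. wt b = \<theta>}"
    using b by (intro complex_lie.span_mono) auto
  ultimately have 1: "bracket h b - wt b h *\<^sub>C b \<in> cspan {b\<in>B. wt b = \<theta>}" by blast
  have 2: "wt b h *\<^sub>C b \<in> cspan {b\<in>B. wt b = \<theta>}"
    using b by (intro complex_lie.span_scale complex_lie.span_base)
  from complex_lie.span_add[OF 1 2] show "bracket h b \<in> cspan {b\<in>B. wt b = \<theta>}" by simp
qed

lemma gws_span_cases:
  assumes ad: "adapted B wt" and "v \<in> cspan B" "v \<in> gws H \<theta>" "\<And>x. x \<notin> H \<Longrightarrow> \<theta> x = 0"
  shows "v \<in> cspan {b\<in>B. wt b = \<theta>}"
proof -
  let ?U = "cspan {b\<in>B. wt b = \<theta>}"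
  have fin: "finite B" using ad finite_independent by (simp add: adapted_def)
  obtain r where r: "v = (\<Sum>b\<in>B. r b *\<^sub>C b)"
    using assms(2) unfolding complex_lie.span_finite[OF fin] by auto
  define u where "u \<mu> = (\<Sum>b | b \<in> B \<and> wt b = \<mu>. r b *\<^sub>C b)" for \<mu>
  let ?F = "insert \<theta> (wt ` B)"
  have finF: "finite ?F" using fin by simp
  have "v = (\<Sum>\<mu>\<in>?F. u \<mu>)"
    unfolding r u_def using sum.group[OF fin finF, of wt "\<lambda>b. r b *\<^sub>C b"] by force
  also have "\<dots> = u \<theta> + (\<Sum>\<mu>\<in>?F - {\<theta>}. u \<mu>)"
    by (rule sum.remove[OF finF]) simp
  finally have v: "v = u \<theta> + (\<Sum>\<mu>\<in>?F - {\<theta>}. u \<mu>)" .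
  \<comment> \<open>With \<open>u \<theta> - v\<close> in the place of \<open>u \<theta>\<close> the
    components add up to zero, which lies in every subspace; so \<open>u \<theta> - v\<close> lies
    in the span of the basis vectors of weight \<open>\<theta>\<close>.\<close>
  let ?v = "\<lambda>\<mu>. if \<mu> = \<theta> then u \<theta> - v else u \<mu>"
  have ug: "u \<mu> \<in> gws H \<mu>" for \<mu>
    unfolding u_def using ad
    by (intro complex_lie.subspace_sum complex_lie.subspace_scale subspace_gws) (auto simp: adapted_def)
  have uU: "u \<theta> \<in> ?U"
    unfolding u_def by (intro complex_lie.span_sum complex_lie.span_scale complex_lie.span_base) auto
  have "(\<Sum>\<mu>\<in>?F. ?v \<mu>) = ?v \<theta> + (\<Sum>\<mu>\<in>?F - {\<theta>}. ?v \<mu>)"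
    by (rule sum.remove[OF finF]) simp
  also have "(\<Sum>\<mu>\<in>?F - {\<theta>}. ?v \<mu>) = (\<Sum>\<mu>\<in>?F - {\<theta>}. u \<mu>)"
    by (rule sum.cong) auto
  also have "?v \<theta> + (\<Sum>\<mu>\<in>?F - {\<theta>}. u \<mu>) = (u \<theta> + (\<Sum>\<mu>\<in>?F - {\<theta>}. u \<mu>)) - v"
    by simp
  also have "\<dots> = 0" by (simp only: v[symmetric] diff_self)
  finally have sum0: "(\<Sum>\<mu>\<in>?F. ?v \<mu>) = 0" .
  have "?v \<theta> \<in> ?U"
  proof (rule component_in_stable_subspace[OF complex_lie.subspace_span weight_part_stable[OF ad] finF,
        where v = ?v])
    show "(\<Sum>\<mu>\<in>?F. ?v \<mu>) \<in> ?U" unfolding sum0 by (rule complex_lie.span_zero)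
    show "?v \<mu> \<in> gws H \<mu>" for \<mu>
      by (auto simp: ug assms(3) intro!: complex_lie.subspace_diff[OF subspace_gws])
    show "\<mu> x = 0" if "\<mu> \<in> ?F" "x \<notin> H" for \<mu> x
      using that assms(4) ad by (auto simp: adapted_def dual_space_def)
  qed simp
  then have "u \<theta> - v \<in> ?U" by simp
  from complex_lie.span_diff[OF uU this] show ?thesis by simp
qed

text \<open>A set of maximal size must span: otherwise some weight space is not exhausted by its
  basis vectors, and a relative weight vector above their span can be added.\<close>

lemma adapted_basis_exists:
  obtains B wt where "adapted B wt" "cspan B = UNIV"
proof -
  obtain d where d: "\<And>B :: 'a set. complex_lie.independent B \<Longrightarrow> finite B \<and> card B \<le> d"
    using independent_bound[OF fd] by metis
  let ?Q = "\<lambda>n. \<exists>B wt. adapted B wt \<and> card B = n"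
  have "?Q 0" by (intro exI[of _ "{}"]) (simp add: adapted_def complex_lie.independent_empty)
  moreover have "\<And>n. ?Q n \<Longrightarrow> n \<le> d" using d by (auto simp: adapted_def)
  ultimately have "finite (Collect ?Q)" "Collect ?Q \<noteq> {}"
    by (auto intro: finite_subset[of _ "{..d}"])
  define n where "n = Max (Collect ?Q)"
  have "n \<in> Collect ?Q"
    unfolding n_def by (rule Max_in) fact+
  then have "?Q n" by (rule CollectD)
  have nmax: "m \<le> n" if "?Q m" for m
    unfolding n_def by (rule Max_ge) (fact, use that in \<open>rule CollectI\<close>)
  from \<open>?Q n\<close> obtain B wt where B: "adapted B wt" "card B = n" by blast
  have ind: "complex_lie.independent B" using B(1) by (simp add: adapted_def)
  have fin: "finite B" by (rule finite_independent[OF ind])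
  have "cspan B = UNIV"
  proof (rule ccontr)
    assume "cspan B \<noteq> UNIV"
    moreover have "UNIV \<subseteq> cspan (\<Union>\<theta>\<in>{\<theta>. \<forall>x. x \<notin> H \<longrightarrow> \<theta> x = 0}. UNIV \<inter> gws H \<theta>)"
      by (rule gws_decomposition) (auto simp: ad_stable_def complex_lie.subspace_UNIV)
    ultimately have "\<not> (\<Union>\<theta>\<in>{\<theta>. \<forall>x. x \<notin> H \<longrightarrow> \<theta> x = 0}. UNIV \<inter> gws H \<theta>) \<subseteq> cspan B"
      using complex_lie.span_minimal[OF _ complex_lie.subspace_span[of B]] by blast
    then obtain \<theta> where \<theta>: "\<And>x. x \<notin> H \<Longrightarrow> \<theta> x = 0" and nsub: "\<not> gws H \<theta> \<subseteq> cspan B"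
      by blast
    let ?A = "{b\<in>B. wt b = \<theta>}"
    have "?A \<subseteq> gws H \<theta>" using B(1) by (auto simp: adapted_def)
    then have "cspan ?A \<subseteq> gws H \<theta>" by (intro complex_lie.span_minimal subspace_gws)
    moreover have "cspan ?A \<subseteq> cspan B" by (rule complex_lie.span_mono) auto
    ultimately have "cspan ?A \<subset> gws H \<theta>" using nsub by blast
    from relative_weight_vector[OF complex_lie.subspace_span weight_part_stable[OF B(1)]
        subspace_gws stable_gws this subset_refl]
    obtain v where v: "v \<in> gws H \<theta>" "v \<notin> cspan ?A"
      and vh: "\<And>h. h \<in> H \<Longrightarrow> bracket h v - \<theta> h *\<^sub>C v \<in> cspan ?A"
      by blast
    have vB: "v \<notin> cspan B" using gws_span_cases[OF B(1) _ v(1) \<theta>] v(2) by blast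
    then have "v \<notin> B" using complex_lie.span_base by metis
    define wt' where "wt' = wt(v := \<theta>)"
    have wt'B: "wt' b = wt b" if "b \<in> B" for b using that \<open>v \<notin> B\<close> by (auto simp: wt'_def)
    have wt'v: "wt' v = \<theta>" by (simp add: wt'_def)
    have "v \<noteq> 0" using v(2) complex_lie.span_zero by metis
    have dual: "\<theta> \<in> dual_space H"
      using v(1) \<open>v \<noteq> 0\<close> \<theta> by (intro weight_linear) auto
    have "adapted (insert v B) wt'"
      unfolding adapted_def
    proof (intro conjI ballI)
      show "complex_lie.independent (insert v B)"
        by (rule complex_lie.independent_insertI[OF vB ind])
    next
      fix b assume "b \<in> insert v B"
      then show "wt' b \<in> dual_space H"
        using dual wt'v wt'B B(1) by (auto simp: adapted_def)
    next
      fix b assume "b \<in> insert v B"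
      then show "b \<in> gws H (wt' b)"
        using v(1) wt'v wt'B B(1) by (auto simp: adapted_def)
    next
      fix b assume b: "b \<in> insert v B"
      show "flag_at (insert v B) wt' b"
      proof (cases "b = v")
        case True
        have "?A \<subseteq> {b'\<in>insert v B - {b}. wt' b' = wt' b}"
          using True wt'v wt'B \<open>v \<notin> B\<close> by auto
        then show ?thesis
          unfolding flag_at_def using vh True wt'v weight_part_stable[OF B(1)]
          by (intro exI[of _ "cspan ?A"]) (auto simp: complex_lie.subspace_span dest: complex_lie.span_mono)
      next
        case False
        then have bB: "b \<in> B" using b by simp
        then obtain U where U: "csubspace U" "ad_stable H U"
          "U \<subseteq> cspan {b'\<in>B - {b}. wt b' = wt b}" "\<forall>h\<in>H. bracket h b - wt b h *\<^sub>C b \<in> U"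
          using B(1) unfolding adapted_def flag_at_def by blast
        have "{b'\<in>B - {b}. wt b' = wt b} \<subseteq> {b'\<in>insert v B - {b}. wt' b' = wt' b}"
          using wt'B bB by auto
        then have "U \<subseteq> cspan {b'\<in>insert v B - {b}. wt' b' = wt' b}"
          using U(3) complex_lie.span_mono by blast
        then show ?thesis unfolding flag_at_def using U wt'B[OF bB] by auto
      qed
    next
      fix b assume b: "b \<in> insert v B"
      show "\<exists>e\<in>insert v B. wt' e = wt' b \<and> e \<in> root_space H (wt' e)"
      proof (cases "wt' b \<in> wt ` B")
        case True
        then obtain b' where "b' \<in> B" "wt' b = wt b'" by auto
        moreover obtain e where "e \<in> B" "wt e = wt b'" "e \<in> root_space H (wt e)"
          using B(1) \<open>b' \<in> B\<close> unfolding adapted_def by blast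
        ultimately show ?thesis using wt'B by (intro bexI[of _ e]) auto
      next
        case False
        then have "b = v" using b wt'B by auto
        \<comment> \<open>For a new weight there are no basis vectors below \<open>v\<close>, so
          \<open>v\<close> is a true eigenvector.\<close>
        then have "?A = {}" using False wt'v by force
        then have "bracket h v = \<theta> h *\<^sub>C v" if "h \<in> H" for h
          using vh[OF that] unfolding \<open>?A = {}\<close> complex_lie.span_empty by simp
        then show ?thesis using \<open>b = v\<close> wt'v
          by (intro bexI[of _ v]) (auto simp: root_space_def)
      qed
    qed
    moreover have "card (insert v B) = Suc n" using B(2) fin \<open>v \<notin> B\<close> by simp
    ultimately have "Suc n \<le> n" by (intro nmax exI conjI)
    then show False by simp
  qed
  with B(1) show thesis by (rule that)
qed

end

section \<open>Traces and the Killing form\<close>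

locale cartan_decomposition = nilpotent_subalgebra H
  for H :: "'a::complex_lie_algebra set" +
  fixes B :: "'a set" and wt :: "'a \<Rightarrow> 'a \<Rightarrow> complex"
  assumes adapted: "adapted B wt" and span_B: "cspan B = UNIV"
    and self_normalizing: "lie_normalizer H = H"
    and simple: "lie_simple (UNIV :: 'a set)"
begin

lemma independent_B: "complex_lie.independent B"
  and wt_dual: "b \<in> B \<Longrightarrow> wt b \<in> dual_space H"
  and B_gws: "b \<in> B \<Longrightarrow> b \<in> gws H (wt b)"
  and B_flag: "b \<in> B \<Longrightarrow> flag_at B wt b"
  and B_eigen: "b \<in> B \<Longrightarrow> \<exists>e\<in>B. wt e = wt b \<and> e \<in> root_space H (wt e)"
  using adapted by (simp_all add: adapted_def)

lemma finite_B: "finite B"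
  by (rule finite_independent[OF independent_B])

lemma wt_add: "b \<in> B \<Longrightarrow> x \<in> H \<Longrightarrow> y \<in> H \<Longrightarrow> wt b (x + y) = wt b x + wt b y"
  and wt_scale: "b \<in> B \<Longrightarrow> x \<in> H \<Longrightarrow> wt b (c *\<^sub>C x) = c * wt b x"
  and wt_outside: "b \<in> B \<Longrightarrow> x \<notin> H \<Longrightarrow> wt b x = 0"
  using wt_dual[of b] by (simp_all add: dual_space_def)

lemma wt_zero: "b \<in> B \<Longrightarrow> wt b 0 = 0"
  using wt_scale[of b 0 0] complex_lie.subspace_0[OF subspace_H] by simp

lemma wt_sum:
  assumes "b \<in> B" "\<And>i. i \<in> I \<Longrightarrow> x i \<in> H"
  shows "wt b (\<Sum>i\<in>I. x i) = (\<Sum>i\<in>I. wt b (x i))"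
  using assms(2)
proof (induction I rule: infinite_finite_induct)
  case (insert i I)
  then have "(\<Sum>i\<in>I. x i) \<in> H" by (intro complex_lie.subspace_sum[OF subspace_H]) simp
  then show ?case using insert by (simp add: wt_add assms(1))
qed (simp_all add: wt_zero assms(1))

definition coord :: "'a \<Rightarrow> 'a \<Rightarrow> complex" where
  "coord b x = complex_lie.representation B x b"

lemma coord_add: "coord b (x + y) = coord b x + coord b y"
  by (simp add: coord_def complex_lie.representation_add independent_B span_B)

lemma coord_diff: "coord b (x - y) = coord b x - coord b y"
  by (simp add: coord_def complex_lie.representation_diff independent_B span_B)

lemma coord_scale: "coord b (c *\<^sub>C x) = c * coord b x"
  by (simp add: coord_def complex_lie.representation_scale independent_B span_B)

lemma coord_zero: "coord b 0 = 0"
  by (simp add: coord_def complex_lie.representation_zero)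

lemma coord_sum: "coord b (\<Sum>i\<in>I. f i) = (\<Sum>i\<in>I. coord b (f i))"
  by (induction I rule: infinite_finite_induct) (simp_all add: coord_zero coord_add)

lemma coord_basis: "c \<in> B \<Longrightarrow> coord b c = (if b = c then 1 else 0)"
  by (simp add: coord_def complex_lie.representation_basis independent_B)

lemma sum_coord: "(\<Sum>b\<in>B. coord b x *\<^sub>C b) = x"
  unfolding coord_def
  by (rule complex_lie.sum_representation_eq) (simp_all add: independent_B span_B finite_B)

lemma coord_in_span: "C \<subseteq> B \<Longrightarrow> x \<in> cspan C \<Longrightarrow> b \<notin> C \<Longrightarrow> coord b x = 0"
  using complex_lie.representation_extend[OF independent_B, of x C]
    complex_lie.representation_ne_zero[of C x b] by (auto simp: coord_def)

lemma sum_coord_subset: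
  assumes "C \<subseteq> B" "x \<in> cspan C"
  shows "(\<Sum>c\<in>C. coord c x *\<^sub>C c) = x"
proof -
  have "(\<Sum>c\<in>C. coord c x *\<^sub>C c) = (\<Sum>c\<in>B. coord c x *\<^sub>C c)"
    by (rule sum.mono_neutral_left) (use assms finite_B in \<open>auto simp: coord_in_span\<close>)
  then show ?thesis by (simp add: sum_coord)
qed

lemma gws_eq: "(\<And>x. x \<notin> H \<Longrightarrow> \<theta> x = 0) \<Longrightarrow> gws H \<theta> = cspan {b\<in>B. wt b = \<theta>}"
proof (intro equalityI subsetI)
  fix v assume "\<And>x. x \<notin> H \<Longrightarrow> \<theta> x = 0" "v \<in> gws H \<theta>"
  then show "v \<in> cspan {b\<in>B. wt b = \<theta>}"
    by (rule_tac gws_span_cases[OF adapted]) (simp_all add: span_B)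
next
  fix v assume "v \<in> cspan {b\<in>B. wt b = \<theta>}"
  moreover have "cspan {b\<in>B. wt b = \<theta>} \<subseteq> gws H \<theta>"
    by (rule complex_lie.span_minimal[OF _ subspace_gws]) (use B_gws in auto)
  ultimately show "v \<in> gws H \<theta>" by blast
qed

lemma coord_gws:
  assumes "v \<in> gws H \<theta>" "\<And>x. x \<notin> H \<Longrightarrow> \<theta> x = 0" "wt b \<noteq> \<theta>"
  shows "coord b v = 0"
proof (rule coord_in_span)
  show "v \<in> cspan {b\<in>B. wt b = \<theta>}" using assms(1) gws_eq[OF assms(2)] by simp
qed (use assms(3) in auto)

text \<open>If \<open>H\<close> were smaller than the weight space of 0, a relative weight vector
  above \<open>U = H\<close> would normalize \<open>H\<close> without lying in it.\<close>

lemma gws_0: "gws H 0 = H"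
proof (rule ccontr)
  assume "gws H 0 \<noteq> H"
  moreover have "H \<subseteq> gws H 0" using in_geig_0 by (auto simp: gws_def)
  ultimately have "H \<subset> gws H 0" by blast
  from relative_weight_vector[OF subspace_H stable_H subspace_gws stable_gws this subset_refl]
  obtain v where v: "v \<notin> H" "\<forall>h\<in>H. bracket h v - 0 h *\<^sub>C v \<in> H" by blast
  have "bracket v h \<in> H" if "h \<in> H" for h
  proof -
    have "bracket h v \<in> H" using v(2) that by simp
    then show ?thesis
      using bracket_antisym[of v h] complex_lie.subspace_neg[OF subspace_H] by simp
  qed
  then have "v \<in> lie_normalizer H" by (simp add: lie_normalizer_def)
  then show False using v(1) self_normalizing by simp
qed

lemma H_eq: "H = cspan {b\<in>B. wt b = 0}"
  using gws_eq[of 0] gws_0 by simp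

lemma B_in_H_iff:
  assumes "b \<in> B"
  shows "b \<in> H \<longleftrightarrow> wt b = 0"
proof
  assume "b \<in> H"
  then have "b \<in> gws H 0" by (simp only: gws_0)
  then have "coord b b = 0" if "wt b \<noteq> 0" by (rule coord_gws) (use that in simp_all)
  then show "wt b = 0" using coord_basis[OF assms, of b] by auto
next
  assume "wt b = 0"
  then show "b \<in> H" using B_gws[OF assms] by (simp only: gws_0)
qed

lemma bracket_weight: "b \<in> B \<Longrightarrow> c \<in> B \<Longrightarrow> bracket b c \<in> gws H (wt b + wt c)"
  by (intro gws_bracket B_gws)

section \<open>Partial traces and relations among weights\<close>

text \<open>The trace of the compression of \<open>f\<close> to the span of \<open>C\<close>; if
  that span is stable under \<open>f\<close>, the trace of the restriction.\<close>

definition tr :: "'a set \<Rightarrow> ('a \<Rightarrow> 'a) \<Rightarrow> complex" where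
  "tr C f = (\<Sum>b\<in>C. coord b (f b))"

lemma tr_commute:
  assumes C: "C \<subseteq> B" and f: "clinear f" and g: "clinear g"
    and fC: "\<And>c. c \<in> C \<Longrightarrow> f c \<in> cspan C" and gC: "\<And>c. c \<in> C \<Longrightarrow> g c \<in> cspan C"
  shows "tr C (\<lambda>x. f (g x)) = tr C (\<lambda>x. g (f x))"
proof -
  have *: "coord b (f (g b)) = (\<Sum>c\<in>C. coord c (g b) * coord b (f c))"
    if "b \<in> C" "clinear f" "\<And>c. c \<in> C \<Longrightarrow> g c \<in> cspan C" for f g b
  proof -
    have "f (g b) = f (\<Sum>c\<in>C. coord c (g b) *\<^sub>C c)"
      by (simp only: sum_coord_subset[OF C that(3)[OF that(1)]])
    then show ?thesis by (simp add: clinear_sum[OF that(2)] clinear_scale[OF that(2)] coord_sum coord_scale)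
  qed
  have "tr C (\<lambda>x. f (g x)) = (\<Sum>b\<in>C. \<Sum>c\<in>C. coord c (g b) * coord b (f c))"
    unfolding tr_def by (rule sum.cong) (simp_all add: * f gC)
  also have "\<dots> = (\<Sum>c\<in>C. \<Sum>b\<in>C. coord b (f c) * coord c (g b))"
    by (subst sum.swap) (simp add: mult.commute)
  also have "\<dots> = tr C (\<lambda>x. g (f x))"
    unfolding tr_def by (rule sum.cong) (simp_all add: * g fC)
  finally show ?thesis .
qed

lemma coord_flag:
  assumes "b \<in> B" "h \<in> H"
  shows "coord b (bracket h b) = wt b h"
    and "h' \<in> H \<Longrightarrow> coord b (bracket h (bracket h' b)) = wt b h * wt b h'"
proof -
  obtain U where U: "csubspace U" "ad_stable H U"
    "U \<subseteq> cspan {b'\<in>B - {b}. wt b' = wt b}" "\<forall>h\<in>H. bracket h b - wt b h *\<^sub>C b \<in> U"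
    using B_flag[OF assms(1)] unfolding flag_at_def by blast
  have U0: "coord b u = 0" if "u \<in> U" for u
    by (rule coord_in_span[of "{b'\<in>B - {b}. wt b' = wt b}"]) (use that U(3) in auto)
  have e: "coord b (bracket k b) = wt b k" if "k \<in> H" for k
    using U0[OF U(4)[rule_format, OF that]] coord_basis[OF assms(1), of b]
    by (simp add: coord_diff coord_scale)
  show "coord b (bracket h b) = wt b h" by (rule e[OF assms(2)])
  assume h': "h' \<in> H"
  have "bracket h (bracket h' b - wt b h' *\<^sub>C b) \<in> U"
    using U(4) h' by (intro ad_stableD[OF U(2) assms(2)]) blast
  from U0[OF this] show "coord b (bracket h (bracket h' b)) = wt b h * wt b h'"
    using e[OF assms(2)] by (simp add: bracket_diff_right bracket_scaleC_right coord_diff coord_scale)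
qed

lemma trace_ad_bracket:
  assumes C: "C \<subseteq> B" and e: "\<And>c. c \<in> C \<Longrightarrow> bracket e c \<in> cspan C"
    and f: "\<And>c. c \<in> C \<Longrightarrow> bracket f c \<in> cspan C" and h: "bracket e f \<in> H"
  shows "(\<Sum>c\<in>C. wt c (bracket e f)) = 0"
proof -
  have "(\<Sum>c\<in>C. wt c (bracket e f)) = tr C (bracket (bracket e f))"
    unfolding tr_def by (rule sum.cong) (use C in \<open>auto simp: coord_flag(1) h\<close>)
  also have "\<dots> = tr C (\<lambda>x. bracket e (bracket f x)) - tr C (\<lambda>x. bracket f (bracket e x))"
    by (simp add: tr_def bracket_bracket_left coord_diff sum_subtractf)
  also have "\<dots> = 0"
    using tr_commute[OF C clinear_ad clinear_ad e f] by simp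
  finally show ?thesis .
qed

section \<open>The Killing form\<close>

definition K :: "'a \<Rightarrow> 'a \<Rightarrow> complex" where
  "K x y = tr B (\<lambda>z. bracket x (bracket y z))"

lemma K_add_left: "K (x + y) z = K x z + K y z"
  and K_add_right: "K z (x + y) = K z x + K z y"
  and K_scale_left: "K (c *\<^sub>C x) z = c * K x z"
  and K_scale_right: "K z (c *\<^sub>C x) = c * K z x"
  by (simp_all add: K_def tr_def bracket_add_left bracket_add_right bracket_scaleC_left
      bracket_scaleC_right coord_add coord_scale sum.distrib sum_distrib_left)

lemma K_zero_left: "K 0 x = 0" and K_zero_right: "K x 0 = 0"
  by (simp_all add: K_def tr_def coord_zero)

lemma K_sum_left: "K (\<Sum>i\<in>I. x i) y = (\<Sum>i\<in>I. K (x i) y)"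
  by (induction I rule: infinite_finite_induct) (simp_all add: K_zero_left K_add_left)

lemma K_sum_right: "K y (\<Sum>i\<in>I. x i) = (\<Sum>i\<in>I. K y (x i))"
  by (induction I rule: infinite_finite_induct) (simp_all add: K_zero_right K_add_right)

lemma K_minus_left: "K (- x) y = - K x y"
  using K_scale_left[of "- 1" x y] by (simp add: scaleC_one)

lemma K_sym: "K x y = K y x"
  unfolding K_def by (rule tr_commute) (simp_all add: clinear_ad span_B)

lemma K_invariant: "K (bracket x y) z = K x (bracket y z)"
proof -
  have "tr B (\<lambda>w. bracket y (bracket x (bracket z w))) = tr B (\<lambda>w. bracket x (bracket z (bracket y w)))"
    by (rule tr_commute[of _ "bracket y" "\<lambda>w. bracket x (bracket z w)"])
      (simp_all add: clinear_ad span_B clinearI bracket_add_right bracket_scaleC_right)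
  then show ?thesis
    by (simp add: K_def tr_def bracket_bracket_left bracket_diff_right coord_diff sum_subtractf)
qed

lemma K_H:
  assumes "x \<in> H" "y \<in> H"
  shows "K x y = (\<Sum>b\<in>B. wt b x * wt b y)"
  unfolding K_def tr_def by (rule sum.cong) (simp_all add: coord_flag(2) assms)

text \<open>The double bracket moves every weight by \<open>\<theta> + \<mu>\<close>, so it has no
  diagonal entries.\<close>

lemma K_orthogonal:
  assumes "x \<in> gws H \<theta>" "y \<in> gws H \<mu>" "\<theta> + \<mu> \<noteq> 0"
    and "\<And>x. x \<notin> H \<Longrightarrow> \<theta> x = 0" "\<And>x. x \<notin> H \<Longrightarrow> \<mu> x = 0"
  shows "K x y = 0"
proof -
  have "coord b (bracket x (bracket y b)) = 0" if b: "b \<in> B" for b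
  proof (rule coord_gws)
    show "bracket x (bracket y b) \<in> gws H (\<theta> + (\<mu> + wt b))"
      by (intro gws_bracket assms B_gws b)
    show "(\<theta> + (\<mu> + wt b)) x = 0" if "x \<notin> H" for x
      using that assms(4,5) wt_outside[OF b] by simp
    show "wt b \<noteq> \<theta> + (\<mu> + wt b)"
      using assms(3) by (metis add.assoc add_cancel_left_left)
  qed
  then show ?thesis by (simp add: K_def tr_def)
qed

text \<open>
  The weights along a string through \<open>wt b\<close> are \<open>wt b + k\<alpha>\<close> with integers \<open>k\<close>, and
  \<open>ad [e, f]\<close> is a commutator on the sum of the corresponding weight spaces.
\<close>

lemma weight_ratio:
  assumes e: "e \<in> gws H \<alpha>" and f: "f \<in> gws H (- \<alpha>)" and out: "\<And>x. x \<notin> H \<Longrightarrow> \<alpha> x = 0" and b: "b \<in> B"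
  shows "\<exists>r::real. wt b (bracket e f) = of_real r * \<alpha> (bracket e f)"
proof -
  let ?h = "bracket e f"
  have hH: "?h \<in> H" using gws_bracket[OF e f] gws_0 by simp
  define C where "C = {c\<in>B. \<exists>k::int. \<forall>x. wt c x = wt b x + of_int k * \<alpha> x}"
  have CB: "C \<subseteq> B" by (auto simp: C_def)
  have bC: "b \<in> C" using b by (auto simp: C_def intro!: exI[of _ 0])
  have finC: "finite C" using finite_subset[OF CB finite_B] .
  have span: "bracket x c \<in> cspan C"
    if c: "c \<in> C" and x: "x \<in> gws H \<theta>" "\<And>y. \<theta> y = of_int j * \<alpha> y" for x c \<theta> and j :: int
  proof -
    have cB: "c \<in> B" using c CB by blast
    obtain k :: int where k: "\<forall>x. wt c x = wt b x + of_int k * \<alpha> x"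
      using c by (auto simp: C_def)
    have "bracket x c \<in> gws H (\<theta> + wt c)" by (rule gws_bracket[OF x(1) B_gws[OF cB]])
    also have "gws H (\<theta> + wt c) = cspan {d\<in>B. wt d = \<theta> + wt c}"
      by (rule gws_eq) (simp add: x(2) out wt_outside[OF cB])
    also have "\<dots> \<subseteq> cspan C"
    proof (rule complex_lie.span_mono, clarify)
      fix d assume d: "d \<in> B" "wt d = \<theta> + wt c"
      have "\<forall>x. wt d x = wt b x + of_int (j + k) * \<alpha> x"
        using d(2) x(2) k by (simp add: algebra_simps)
      then show "d \<in> C" unfolding C_def using d(1) by blast
    qed
    finally show ?thesis .
  qed
  have "(\<Sum>c\<in>C. wt c ?h) = 0"
  proof (rule trace_ad_bracket[OF CB _ _ hH])
    show "bracket e c \<in> cspan C" if "c \<in> C" for c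
      by (rule span[OF that e, of 1]) simp
    show "bracket f c \<in> cspan C" if "c \<in> C" for c
      by (rule span[OF that f, of "- 1"]) simp
  qed
  moreover have "\<forall>c\<in>C. \<exists>k::int. wt c ?h = wt b ?h + of_int k * \<alpha> ?h"
    by (auto simp: C_def)
  from bchoice[OF this] obtain k :: "'a \<Rightarrow> int"
    where k: "\<forall>c\<in>C. wt c ?h = wt b ?h + of_int (k c) * \<alpha> ?h" ..
  ultimately have "(\<Sum>c\<in>C. wt b ?h + of_int (k c) * \<alpha> ?h) = 0" by simp
  then have "of_nat (card C) * wt b ?h = - (of_int (\<Sum>c\<in>C. k c) * \<alpha> ?h)"
    by (simp add: sum.distrib sum_distrib_right eq_neg_iff_add_eq_0)
  moreover have "card C \<noteq> 0" using bC finC by auto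
  ultimately have "wt b ?h = of_real (- (of_int (\<Sum>c\<in>C. k c) / of_nat (card C))) * \<alpha> ?h"
    by (simp add: field_simps)
  then show ?thesis by blast
qed

section \<open>Nondegeneracy of the Killing form\<close>

lemma derived_UNIV: "lie_prod UNIV UNIV = (UNIV :: 'a set)"
proof -
  have "lie_ideal (lie_prod UNIV UNIV) (UNIV :: 'a set)"
    unfolding lie_ideal_def lie_prod_def
    by (auto simp: complex_lie.subspace_span intro: complex_lie.span_base)
  moreover obtain x y :: 'a where "bracket x y \<noteq> 0" using simple by (auto simp: lie_simple_def)
  then have "lie_prod UNIV UNIV \<noteq> {0 :: 'a}"
    unfolding lie_prod_def using complex_lie.span_base[of "bracket x y" "{bracket a b | a b. a \<in> UNIV \<and> b \<in> UNIV}"] by auto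
  ultimately show ?thesis using simple unfolding lie_simple_def by blast
qed

text \<open>The lower central series of an algebra equal to its derived algebra never descends,
  whereas \<open>H\<close> is nilpotent.\<close>

lemma H_neq_UNIV: "H \<noteq> UNIV"
proof
  assume H: "H = UNIV"
  obtain m where m: "lower_central H m = {0}" using nilp by (auto simp: lie_nilpotent_def)
  have "lower_central H n = UNIV" for n
    by (induction n) (simp_all add: H derived_UNIV)
  then have "(UNIV :: 'a set) = {0}" using m by simp
  moreover obtain x y :: 'a where "bracket x y \<noteq> 0" using simple by (auto simp: lie_simple_def)
  ultimately show False by (metis UNIV_I singletonD)
qed

definition hpart :: "'a \<Rightarrow> 'a" where
  "hpart x = (\<Sum>b | b \<in> B \<and> wt b = 0. coord b x *\<^sub>C b)"

lemma hpart_add: "hpart (x + y) = hpart x + hpart y"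
  and hpart_scale: "hpart (c *\<^sub>C x) = c *\<^sub>C hpart x"
  by (simp_all add: hpart_def coord_add coord_scale scaleC_add_left sum.distrib
      complex_lie.scale_sum_right scaleC_scaleC)

lemma hpart_zero: "hpart 0 = 0"
  using hpart_scale[of 0 0] by simp

lemma hpart_in_H: "hpart x \<in> H"
  unfolding hpart_def
  by (intro complex_lie.subspace_sum[OF subspace_H] complex_lie.subspace_scale[OF subspace_H])
    (simp add: B_in_H_iff)

lemma hpart_id: "x \<in> H \<Longrightarrow> hpart x = x"
  unfolding hpart_def by (rule sum_coord_subset) (use H_eq in auto)

lemma hpart_gws:
  assumes "x \<in> gws H \<theta>" "\<theta> \<noteq> 0" "\<And>x. x \<notin> H \<Longrightarrow> \<theta> x = 0"
  shows "hpart x = 0"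
proof -
  have "coord b x = 0" if "wt b = 0" for b
    by (rule coord_gws[OF assms(1,3)]) (use that assms(2) in auto)
  then show ?thesis by (simp add: hpart_def)
qed

text \<open>Suppose \<open>K = 0\<close>, and let \<open>h = [b, c]\<close> with opposite weights.
  All weights on \<open>h\<close> are real multiples \<open>r d\<close> of \<open>wt b h\<close>, so
  \<open>K h h\<close> is \<open>(wt b h)^2\<close> times the sum of the squares
  \<open>(r d)^2\<close>. If \<open>wt b h\<close> were not 0, then \<open>r b = 1\<close> would
  make this nonzero; so \<open>wt b h = 0\<close>, and all weights vanish on \<open>h\<close>. The
  algebra is its own derived algebra, so the \<open>H\<close>-parts of brackets span
  \<open>H\<close>; then every weight is 0 and \<open>H\<close> is everything.\<close>

lemma K_not_zero: "\<exists>x y. K x y \<noteq> 0"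
proof (rule ccontr)
  assume "\<nexists>x y. K x y \<noteq> 0"
  then have K0: "K x y = 0" for x y by blast
  have wt0: "wt d (hpart (bracket b c)) = 0" if b: "b \<in> B" and c: "c \<in> B" and d: "d \<in> B" for b c d
  proof (cases "wt b + wt c = 0")
    case False
    have "hpart (bracket b c) = 0"
      by (rule hpart_gws[OF bracket_weight[OF b c] False]) (simp add: wt_outside b c)
    then show ?thesis by (simp add: wt_zero d)
  next
    case True
    let ?h = "bracket b c" and ?\<alpha> = "wt b"
    have neg: "wt c = - ?\<alpha>" using True by (simp add: eq_neg_iff_add_eq_0 add.commute)
    have hH: "?h \<in> H" using bracket_weight[OF b c] True gws_0 by simp
    have "\<forall>d\<in>B. \<exists>r::real. wt d ?h = of_real r * ?\<alpha> ?h"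
      using weight_ratio[OF B_gws[OF b] _ wt_outside[OF b]] B_gws[OF c] neg by simp
    from bchoice[OF this] obtain r :: "'a \<Rightarrow> real"
      where r: "\<forall>d\<in>B. wt d ?h = of_real (r d) * ?\<alpha> ?h" ..
    have "?\<alpha> ?h = 0"
    proof (rule ccontr)
      assume a: "?\<alpha> ?h \<noteq> 0"
      have "0 = (\<Sum>d\<in>B. wt d ?h * wt d ?h)" using K_H[OF hH hH] K0 by simp
      also have "\<dots> = (\<Sum>d\<in>B. of_real ((r d)\<^sup>2) * (?\<alpha> ?h)\<^sup>2)"
        by (rule sum.cong) (simp_all add: r power2_eq_square)
      also have "\<dots> = of_real (\<Sum>d\<in>B. (r d)\<^sup>2) * (?\<alpha> ?h)\<^sup>2"
        by (simp add: sum_distrib_right)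
      finally have "(of_real (\<Sum>d\<in>B. (r d)\<^sup>2) :: complex) = 0" using a by simp
      then have "(\<Sum>d\<in>B. (r d)\<^sup>2) = 0" by (simp only: of_real_eq_0_iff)
      then have "r b = 0" using b finite_B by (simp add: sum_nonneg_eq_0_iff)
      then show False using r[rule_format, OF b] a by simp
    qed
    then show ?thesis using r d hpart_id[OF hH] by simp
  qed
  have "wt d h = 0" if d: "d \<in> B" and h: "h \<in> H" for d h
  proof -
    \<comment> \<open>Composing with \<open>hpart\<close> extends the weight linearly to the whole
      algebra, where it can be tested on brackets of basis vectors.\<close>
    let ?Z = "{x. wt d (hpart x) = 0}"
    have sub: "csubspace ?Z"
      by (auto simp: complex_lie.subspace_def hpart_zero hpart_add hpart_scale wt_zero wt_add wt_scale
          d hpart_in_H)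
    have "bracket x y \<in> ?Z" for x y
      by (rule bracket_in_span2[of x B y B, OF _ _ _ sub]) (simp_all add: span_B wt0 d)
    then have "lie_prod UNIV UNIV \<subseteq> ?Z"
      unfolding lie_prod_def by (intro complex_lie.span_minimal sub) auto
    then have "h \<in> ?Z" unfolding derived_UNIV by blast
    then show ?thesis using hpart_id[OF h] by simp
  qed
  then have "wt d = 0" if "d \<in> B" for d
    using wt_outside[OF that] that by (intro ext) (metis zero_fun_apply)
  then have "{b\<in>B. wt b = 0} = B" by auto
  then have "H = UNIV" using H_eq span_B by simp
  then show False using H_neq_UNIV by simp
qed

text \<open>The radical of an invariant form is an ideal, and here it is not everything.\<close>

lemma K_nondegenerate:
  assumes "\<And>y. K x y = 0"
  shows "x = 0"
proof -
  let ?R = "{x. \<forall>y. K x y = 0}"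
  have "lie_ideal ?R UNIV"
    unfolding lie_ideal_def
  proof (intro conjI ballI)
    show "csubspace ?R"
      by (simp add: complex_lie.subspace_def K_zero_left K_add_left K_scale_left)
    fix x y assume y: "y \<in> ?R"
    have "K (bracket x y) z = - K (bracket y x) z" for z
      by (subst bracket_antisym) (rule K_minus_left)
    then show "bracket x y \<in> ?R" using y by (simp add: K_invariant)
  qed simp
  then have "?R = {0} \<or> ?R = UNIV" using simple unfolding lie_simple_def by blast
  moreover have "?R \<noteq> UNIV" using K_not_zero by blast
  ultimately show ?thesis using assms by blast
qed

lemma K_eq_zero_if:
  assumes "\<And>b. b \<in> B \<Longrightarrow> K x b = 0"
  shows "x = 0"
proof (rule K_nondegenerate)
  fix y
  have "K x y = K x (\<Sum>b\<in>B. coord b y *\<^sub>C b)" by (simp only: sum_coord)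
  also have "\<dots> = 0" by (simp add: K_sum_right K_scale_right assms)
  finally show "K x y = 0" .
qed

text \<open>\<open>K h\<close> vanishes on \<open>H\<close>, where it is a sum of products of
  weights, and on the other weight spaces by orthogonality.\<close>

lemma eq_zero_if_weights_zero:
  assumes h: "h \<in> H" and "\<And>b. b \<in> B \<Longrightarrow> wt b h = 0"
  shows "h = 0"
proof (rule K_eq_zero_if)
  fix b assume b: "b \<in> B"
  show "K h b = 0"
  proof (cases "wt b = 0")
    case True
    then show ?thesis using K_H[OF h, of b] b assms(2) by (simp add: B_in_H_iff)
  next
    case False
    show ?thesis
      by (rule K_orthogonal[of h 0 b "wt b"]) (use False b h in \<open>simp_all add: gws_0 B_gws wt_outside\<close>)
  qed
qed

text \<open>On the true eigenvector of each weight, \<open>ad [x, y]\<close> is a commutator of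
  scalars; so every weight vanishes on \<open>[x, y]\<close>.\<close>

lemma H_abelian:
  assumes x: "x \<in> H" and y: "y \<in> H"
  shows "bracket x y = 0"
proof (rule eq_zero_if_weights_zero)
  show xy: "bracket x y \<in> H" using stable_H x y by (simp add: ad_stable_def)
  fix b assume "b \<in> B"
  then obtain e where e: "e \<in> B" "wt e = wt b" "e \<in> root_space H (wt e)" using B_eigen by blast
  have eig: "bracket h e = wt e h *\<^sub>C e" if "h \<in> H" for h
    using e(3) that by (simp add: root_space_def)
  have "wt e (bracket x y) *\<^sub>C e = bracket (bracket x y) e" by (simp add: eig xy)
  also have "\<dots> = 0" by (simp add: bracket_bracket_left eig x y bracket_scaleC_right scaleC_scaleC mult.commute)
  finally have "wt e (bracket x y) = 0 \<or> e = 0" by simp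
  moreover have "e \<noteq> 0" using e(1) independent_B complex_lie.dependent_zero by metis
  ultimately show "wt b (bracket x y) = 0" using e(2) by simp
qed

end

section \<open>Root spaces\<close>

context cartan_decomposition
begin

definition \<Delta> :: "('a \<Rightarrow> complex) set" where
  "\<Delta> = wt ` B - {0}"

lemma \<Delta>_outside: "\<phi> \<in> \<Delta> \<Longrightarrow> x \<notin> H \<Longrightarrow> \<phi> x = 0"
  by (auto simp: \<Delta>_def wt_outside)

lemma \<Delta>_dual: "\<phi> \<in> \<Delta> \<Longrightarrow> \<phi> \<in> dual_space H"
  by (auto simp: \<Delta>_def wt_dual)

lemma finite_\<Delta>: "finite \<Delta>"
  by (simp add: \<Delta>_def finite_B)

lemma B_nonzero: "b \<in> B \<Longrightarrow> b \<noteq> 0"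
  using independent_B complex_lie.dependent_zero by metis

text \<open>Some basis vector \<open>f\<close> pairs nontrivially with the eigenvector
  \<open>e\<close>, and by orthogonality its weight is \<open>- \<alpha>\<close>. Invariance gives
  \<open>K [e, f] x = \<alpha> x * K e f\<close> for \<open>x\<close> in \<open>H\<close>. If
  \<open>\<alpha>\<close> vanished on \<open>[e, f]\<close>, then by \<open>weight_ratio\<close> all
  weights would, so \<open>[e, f] = 0\<close> and \<open>\<alpha> = 0\<close>.\<close>

lemma opposite_vector:
  assumes \<alpha>: "\<alpha> \<in> \<Delta>"
  obtains e f where "e \<in> B" "wt e = \<alpha>" "e \<in> root_space H \<alpha>" "f \<in> B" "wt f = - \<alpha>"
    "bracket e f \<in> H" "\<alpha> (bracket e f) \<noteq> 0"
proof -
  obtain b where b: "b \<in> B" "wt b = \<alpha>" using \<alpha> by (auto simp: \<Delta>_def)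
  obtain e where "e \<in> B" "wt e = wt b" "e \<in> root_space H (wt e)"
    using B_eigen[OF b(1)] by blast
  then have e: "e \<in> B" "wt e = \<alpha>" "e \<in> root_space H \<alpha>" by (simp_all add: b(2))
  have "\<exists>f\<in>B. K e f \<noteq> 0" using K_eq_zero_if[of e] B_nonzero[OF e(1)] by blast
  then obtain f where f: "f \<in> B" "K e f \<noteq> 0" ..
  have eg: "e \<in> gws H \<alpha>" using B_gws[OF e(1)] e(2) by simp
  have "wt f = - \<alpha>"
  proof (rule ccontr)
    assume "wt f \<noteq> - \<alpha>"
    then have "\<alpha> + wt f \<noteq> 0" by (metis add.commute add_eq_0_iff)
    from K_orthogonal[OF eg B_gws[OF f(1)] this] show False
      using f(2) \<Delta>_outside[OF \<alpha>] wt_outside[OF f(1)] by simp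
  qed
  then have fg: "f \<in> gws H (- \<alpha>)" using B_gws[OF f(1)] by simp
  let ?h = "bracket e f"
  have hH: "?h \<in> H" using gws_bracket[OF eg fg] gws_0 by simp
  have Kh: "K ?h x = \<alpha> x * K e f" if x: "x \<in> H" for x
  proof -
    have "K ?h x = K x ?h" by (rule K_sym)
    also have "\<dots> = K (bracket x e) f" by (simp add: K_invariant)
    also have "bracket x e = \<alpha> x *\<^sub>C e" using e(3) x by (simp add: root_space_def)
    finally show ?thesis by (simp add: K_scale_left)
  qed
  have "\<alpha> ?h \<noteq> 0"
  proof
    assume a: "\<alpha> ?h = 0"
    have "?h = 0"
    proof (rule eq_zero_if_weights_zero[OF hH])
      fix b assume "b \<in> B"
      then show "wt b ?h = 0"
        using weight_ratio[OF eg fg \<Delta>_outside[OF \<alpha>], of b] a by auto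
    qed
    then have "\<alpha> x = 0" if "x \<in> H" for x using Kh[OF that] f(2) by (simp add: K_zero_left)
    then have "\<alpha> = 0" using \<Delta>_outside[OF \<alpha>] by (auto simp: fun_eq_iff)
    then show False using \<alpha> by (simp add: \<Delta>_def)
  qed
  with e f(1) \<open>wt f = - \<alpha>\<close> hH show thesis by (rule_tac that)
qed

text \<open>
  Comparing the traces of \<open>ad e ad f\<close> and \<open>ad f ad e\<close> on \<open>H\<close> plus the weight spaces of
  \<open>-\<alpha>, -2\<alpha>, \<dots>\<close> (with \<open>ad e\<close> cut off on \<open>H\<close>) shows that the multiplicities of
  \<open>-k\<alpha>\<close>, weighted by \<open>k\<close>, add up to 1.
\<close>

lemma neg_root_unique:
  assumes \<alpha>: "\<alpha> \<in> \<Delta>"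
  obtains f where "f \<in> B" "wt f = - \<alpha>"
    "\<And>c. c \<in> B \<Longrightarrow> wt c = - \<alpha> \<Longrightarrow> c = f"
proof -
  obtain e f where e: "e \<in> B" "wt e = \<alpha>" "e \<in> root_space H \<alpha>" and f: "f \<in> B" "wt f = - \<alpha>"
    and hH: "bracket e f \<in> H" and ah: "\<alpha> (bracket e f) \<noteq> 0"
    using opposite_vector[OF \<alpha>] .
  let ?h = "bracket e f"
  have eg: "e \<in> gws H \<alpha>" using B_gws[OF e(1)] e(2) by simp
  have fg: "f \<in> gws H (- \<alpha>)" using B_gws[OF f(1)] f(2) by simp
  define C where "C = {c\<in>B. \<exists>k::nat. \<forall>x. wt c x = - (of_nat k * \<alpha> x)}"
  define C0 where "C0 = {c\<in>B. wt c = 0}"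
  have CB: "C \<subseteq> B" by (auto simp: C_def)
  have finC: "finite C" using finite_subset[OF CB finite_B] .
  have C0C: "C0 \<subseteq> C" by (auto simp: C_def C0_def intro!: exI[of _ 0])
  have C0H: "c \<in> H" if "c \<in> C0" for c using that B_in_H_iff by (auto simp: C0_def)
  have in_C: "x \<in> cspan C"
    if x: "x \<in> gws H \<theta>" and k: "\<And>x. \<theta> x = - (of_nat k * \<alpha> x)" for x \<theta> k
  proof -
    have "gws H \<theta> = cspan {d\<in>B. wt d = \<theta>}"
      by (rule gws_eq) (simp add: k \<Delta>_outside[OF \<alpha>])
    also have "\<dots> \<subseteq> cspan C"
      by (rule complex_lie.span_mono) (use k in \<open>auto simp: C_def\<close>)
    finally show ?thesis using x by blast
  qed
  have fC: "bracket f c \<in> cspan C" if c: "c \<in> C" for c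
  proof -
    have cB: "c \<in> B" using c CB by blast
    obtain k :: nat where k: "\<forall>x. wt c x = - (of_nat k * \<alpha> x)" using c by (auto simp: C_def)
    show ?thesis
      by (rule in_C[OF gws_bracket[OF fg B_gws[OF cB]], of "Suc k"]) (simp add: k algebra_simps)
  qed
  have eC: "bracket e c \<in> cspan C" if c: "c \<in> C" "c \<notin> C0" for c
  proof -
    have cB: "c \<in> B" using c CB by blast
    obtain k :: nat where k: "\<forall>x. wt c x = - (of_nat k * \<alpha> x)" using c(1) by (auto simp: C_def)
    have "k \<noteq> 0" using k c(2) cB by (auto simp: C0_def fun_eq_iff)
    then obtain j where "k = Suc j" by (meson not0_implies_Suc)
    then show ?thesis
      by (intro in_C[OF gws_bracket[OF eg B_gws[OF cB]], of j]) (simp add: k algebra_simps)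
  qed
  \<comment> \<open>Projection to the span of \<open>C\<close>. \<open>ad e\<close> leaves this span
    only on \<open>C0\<close>, where its values are multiples of \<open>e\<close>, and
    \<open>P\<close> kills \<open>e\<close>.\<close>
  define P where "P x = (\<Sum>c\<in>C. coord c x *\<^sub>C c)" for x
  have Plin: "clinear P"
    by (rule clinearI)
      (simp_all add: P_def coord_add coord_scale scaleC_add_left sum.distrib complex_lie.scale_sum_right scaleC_scaleC)
  have PC: "P x \<in> cspan C" for x
    unfolding P_def by (intro complex_lie.span_sum complex_lie.span_scale complex_lie.span_base)
  have Pid: "P x = x" if "x \<in> cspan C" for x
    unfolding P_def by (rule sum_coord_subset[OF CB that])
  have coordP: "coord c (P x) = coord c x" if "c \<in> C" for c x
  proof -
    have "coord c (P x) = (\<Sum>d\<in>C. if c = d then coord d x else 0)"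
      unfolding P_def coord_sum coord_scale by (rule sum.cong) (use CB in \<open>auto simp: coord_basis\<close>)
    then show ?thesis using that finC by simp
  qed
  have e0: "bracket e c = - (\<alpha> c *\<^sub>C e)" if "c \<in> C0" for c
    using bracket_antisym[of e c] e(3) C0H[OF that] by (simp add: root_space_def)
  have eC': "e \<notin> C"
  proof
    assume "e \<in> C"
    then obtain k :: nat where "\<forall>x. \<alpha> x = - (of_nat k * \<alpha> x)" using e(2) by (auto simp: C_def)
    then have "\<alpha> ?h * (1 + of_nat k) = 0" by (simp add: algebra_simps eq_neg_iff_add_eq_0)
    then have "\<alpha> ?h * of_nat (Suc k) = 0" by simp
    then show False using ah by (simp del: of_nat_Suc)
  qed
  have P0: "P (bracket e c) = 0" if "c \<in> C0" for c
  proof -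
    have "P e = 0" unfolding P_def
      by (rule sum.neutral) (use eC' e(1) in \<open>auto simp: coord_basis\<close>)
    then show ?thesis
      by (simp add: e0[OF that] complex_lie.scale_minus_left[symmetric] clinear_scale[OF Plin]
          del: complex_lie.scale_minus_left)
  qed
  have trh: "(\<Sum>c\<in>C. wt c ?h) = tr C (bracket ?h)"
    unfolding tr_def by (rule sum.cong) (use CB hH in \<open>auto simp: coord_flag(1)\<close>)
  have "tr C (\<lambda>x. P (bracket e (bracket f x))) = tr C (\<lambda>x. bracket f (P (bracket e x)))"
    by (rule tr_commute[OF CB, of "\<lambda>x. P (bracket e x)" "bracket f"])
      (simp_all add: clinear_ad fC PC clinearI clinear_add[OF Plin] clinear_scale[OF Plin]
        bracket_add_right bracket_scaleC_right)
  moreover have "tr C (\<lambda>x. P (bracket e (bracket f x))) = tr C (\<lambda>x. bracket e (bracket f x))"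
    unfolding tr_def by (rule sum.cong) (simp_all add: coordP)
  \<comment> \<open>The cost of cutting off: for \<open>c\<close> in \<open>C0\<close>,
    \<open>[f, [e, c]]\<close> is \<open>\<alpha> c\<close> times \<open>[e, f]\<close>, and the
    diagonal entries add up to \<open>\<alpha>\<close> evaluated at \<open>[e, f]\<close>.\<close>
  moreover have "tr C (\<lambda>x. bracket f (P (bracket e x))) = tr C (\<lambda>x. bracket f (bracket e x)) - \<alpha> ?h"
  proof -
    have "tr C (\<lambda>x. bracket f (bracket e x)) - tr C (\<lambda>x. bracket f (P (bracket e x)))
        = (\<Sum>c\<in>C. coord c (bracket f (bracket e c)) - coord c (bracket f (P (bracket e c))))"
      by (simp add: tr_def sum_subtractf)
    also have "\<dots> = (\<Sum>c\<in>C0. coord c (bracket f (bracket e c)) - coord c (bracket f (P (bracket e c))))"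
      by (rule sum.mono_neutral_right[OF finC C0C]) (auto simp: Pid eC)
    also have "\<dots> = (\<Sum>c\<in>C0. coord c ?h * \<alpha> c)"
    proof (rule sum.cong)
      fix c assume c: "c \<in> C0"
      have "bracket f (bracket e c) = \<alpha> c *\<^sub>C ?h"
        by (simp add: e0[OF c] bracket_minus_right bracket_scaleC_right bracket_antisym[of f e])
      then show "coord c (bracket f (bracket e c)) - coord c (bracket f (P (bracket e c)))
          = coord c ?h * \<alpha> c"
        by (simp add: P0[OF c] coord_scale coord_zero mult.commute)
    qed simp
    also have "\<dots> = \<alpha> (\<Sum>c\<in>C0. coord c ?h *\<^sub>C c)"
      using wt_sum[OF e(1), of C0 "\<lambda>c. coord c ?h *\<^sub>C c"] wt_scale[OF e(1)] C0H
        complex_lie.subspace_scale[OF subspace_H] e(2) by simp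
    also have "(\<Sum>c\<in>C0. coord c ?h *\<^sub>C c) = ?h"
      using hpart_id[OF hH] by (simp add: hpart_def C0_def)
    finally show ?thesis by (simp add: algebra_simps)
  qed
  moreover have "tr C (bracket ?h) = tr C (\<lambda>x. bracket e (bracket f x)) - tr C (\<lambda>x. bracket f (bracket e x))"
    by (simp add: tr_def bracket_bracket_left coord_diff sum_subtractf)
  ultimately have tot: "(\<Sum>c\<in>C. wt c ?h) = - \<alpha> ?h" using trh by simp
  have "\<forall>c\<in>C. \<exists>k::nat. \<forall>x. wt c x = - (of_nat k * \<alpha> x)" by (auto simp: C_def)
  from bchoice[OF this] obtain k :: "'a \<Rightarrow> nat"
    where k: "\<forall>c\<in>C. \<forall>x. wt c x = - (of_nat (k c) * \<alpha> x)" ..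
  have "(\<Sum>c\<in>C. wt c ?h) = - (of_nat (\<Sum>c\<in>C. k c) * \<alpha> ?h)"
    by (simp add: k sum_negf sum_distrib_right)
  then have "(of_nat (\<Sum>c\<in>C. k c) :: complex) * \<alpha> ?h = of_nat 1 * \<alpha> ?h" using tot by simp
  then have "(of_nat (\<Sum>c\<in>C. k c) :: complex) = of_nat 1" using ah by (metis mult_right_cancel)
  then have ksum: "(\<Sum>c\<in>C. k c) = 1" by (simp only: of_nat_eq_iff)
  have k1: "c \<in> C \<and> k c = 1" if c: "c \<in> B" "wt c = - \<alpha>" for c
  proof -
    have cC: "c \<in> C" using c by (auto simp: C_def intro!: exI[of _ 1])
    then have "of_nat (k c) * \<alpha> ?h = \<alpha> ?h" using k c(2) by (metis fun_Compl_def neg_equal_iff_equal)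
    then show ?thesis using cC ah by simp
  qed
  show thesis
  proof (rule that[OF f])
    fix c assume c: "c \<in> B" "wt c = - \<alpha>"
    show "c = f"
    proof (rule ccontr)
      assume "c \<noteq> f"
      have "(\<Sum>d\<in>{c, f}. k d) \<le> (\<Sum>d\<in>C. k d)"
        by (rule sum_mono2[OF finC]) (use k1[OF c] k1[OF f] in auto)
      then show False using \<open>c \<noteq> f\<close> ksum k1[OF c] k1[OF f] by simp
    qed
  qed
qed

lemma neg_in_\<Delta>:
  assumes "\<phi> \<in> \<Delta>"
  shows "- \<phi> \<in> \<Delta>"
proof -
  obtain f where f: "f \<in> B" "wt f = - \<phi>" using neg_root_unique[OF assms] by metis
  then have "- \<phi> \<in> wt ` B" by force
  moreover have "- \<phi> \<noteq> 0" using assms by (auto simp: \<Delta>_def fun_eq_iff)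
  ultimately show ?thesis by (simp add: \<Delta>_def)
qed

lemma weight_unique:
  assumes "\<phi> \<in> \<Delta>" "b \<in> B" "c \<in> B" "wt b = \<phi>" "wt c = \<phi>"
  shows "b = c"
proof -
  obtain f where f: "\<And>c. c \<in> B \<Longrightarrow> wt c = - (- \<phi>) \<Longrightarrow> c = f"
    using neg_root_unique[OF neg_in_\<Delta>[OF assms(1)]] by metis
  have "b = f" "c = f" by (rule f, simp_all add: assms)+
  then show ?thesis by simp
qed

section \<open>Root vectors and their brackets\<close>

text \<open>A root vector without normalization: structure constants enter only through whether they
  vanish.\<close>

definition E :: "('a \<Rightarrow> complex) \<Rightarrow> 'a" where
  "E \<phi> = (THE b. b \<in> B \<and> wt b = \<phi>)"

lemma E:
  assumes "\<phi> \<in> \<Delta>"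
  shows E_in_B: "E \<phi> \<in> B" and wt_E: "wt (E \<phi>) = \<phi>"
proof -
  obtain b where b: "b \<in> B" "wt b = \<phi>" using assms by (auto simp: \<Delta>_def)
  have "E \<phi> \<in> B \<and> wt (E \<phi>) = \<phi>"
    unfolding E_def by (rule theI[of _ b]) (use b weight_unique[OF assms] in auto)
  then show "E \<phi> \<in> B" "wt (E \<phi>) = \<phi>" by simp_all
qed

lemma E_eq: "b \<in> B \<Longrightarrow> wt b \<noteq> 0 \<Longrightarrow> E (wt b) = b"
  by (rule weight_unique[of "wt b"]) (auto simp: \<Delta>_def E_in_B wt_E)

lemma E_nonzero: "\<phi> \<in> \<Delta> \<Longrightarrow> E \<phi> \<noteq> 0"
  by (rule B_nonzero[OF E_in_B])

lemma E_inj: "\<phi> \<in> \<Delta> \<Longrightarrow> \<mu> \<in> \<Delta> \<Longrightarrow> E \<phi> = E \<mu> \<longleftrightarrow> \<phi> = \<mu>"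
  using wt_E by metis

lemma bracket_H_E: "\<phi> \<in> \<Delta> \<Longrightarrow> h \<in> H \<Longrightarrow> bracket h (E \<phi>) = \<phi> h *\<^sub>C E \<phi>"
proof -
  assume \<phi>: "\<phi> \<in> \<Delta>" and h: "h \<in> H"
  obtain e where e: "e \<in> B" "wt e = wt (E \<phi>)" "e \<in> root_space H (wt e)"
    using B_eigen[OF E_in_B[OF \<phi>]] by blast
  have "e = E \<phi>" by (rule weight_unique[OF \<phi> e(1) E_in_B[OF \<phi>]]) (simp_all add: e wt_E \<phi>)
  then show ?thesis using e(3) h by (simp add: root_space_def wt_E[OF \<phi>])
qed

lemma E_gws: "\<phi> \<in> \<Delta> \<Longrightarrow> E \<phi> \<in> gws H \<phi>"
  using B_gws[OF E_in_B] wt_E by metis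

lemma gws_root: "\<phi> \<in> \<Delta> \<Longrightarrow> gws H \<phi> = cspan {E \<phi>}"
proof -
  assume \<phi>: "\<phi> \<in> \<Delta>"
  have "{b\<in>B. wt b = \<phi>} = {E \<phi>}"
    using weight_unique[OF \<phi>] E_in_B[OF \<phi>] wt_E[OF \<phi>] by blast
  then show ?thesis using gws_eq[of \<phi>] \<Delta>_outside[OF \<phi>] by simp
qed

lemma gws_not_root:
  assumes "\<theta> \<notin> \<Delta>" "\<theta> \<noteq> 0" "\<And>x. x \<notin> H \<Longrightarrow> \<theta> x = 0"
  shows "gws H \<theta> = {0}"
proof -
  have "gws H \<theta> = cspan {b\<in>B. wt b = \<theta>}" by (rule gws_eq) (rule assms(3))
  also have "{b\<in>B. wt b = \<theta>} = {}" using assms(1,2) by (auto simp: \<Delta>_def)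
  finally show ?thesis by (simp only: complex_lie.span_empty)
qed

lemma bracket_E_E_root:
  assumes "\<phi> \<in> \<Delta>" "\<mu> \<in> \<Delta>" "\<phi> + \<mu> \<in> \<Delta>"
  obtains c where "bracket (E \<phi>) (E \<mu>) = c *\<^sub>C E (\<phi> + \<mu>)"
proof -
  have "bracket (E \<phi>) (E \<mu>) \<in> gws H (\<phi> + \<mu>)" by (intro gws_bracket E_gws assms)
  then show thesis using that by (auto simp: gws_root[OF assms(3)] complex_lie.span_singleton)
qed

lemma bracket_E_E_not_root:
  assumes "\<phi> \<in> \<Delta>" "\<mu> \<in> \<Delta>" "\<phi> + \<mu> \<notin> \<Delta>" "\<phi> + \<mu> \<noteq> 0"
  shows "bracket (E \<phi>) (E \<mu>) = 0"
proof -
  have "bracket (E \<phi>) (E \<mu>) \<in> gws H (\<phi> + \<mu>)" by (intro gws_bracket E_gws assms)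
  moreover have "gws H (\<phi> + \<mu>) = {0}"
    by (rule gws_not_root[OF assms(3,4)]) (simp add: \<Delta>_outside assms(1,2))
  ultimately show ?thesis by simp
qed

lemma bracket_E_E_opposite: "\<phi> \<in> \<Delta> \<Longrightarrow> bracket (E \<phi>) (E (- \<phi>)) \<in> H"
  using gws_bracket[OF E_gws E_gws[OF neg_in_\<Delta>], of \<phi> \<phi>] gws_0 by simp

lemma \<Delta>_eq_roots: "roots H = \<Delta>"
proof (intro equalityI subsetI)
  fix \<nu> assume "\<nu> \<in> roots H"
  then have \<nu>: "\<nu> \<in> dual_space H" "\<nu> \<noteq> 0" "root_space H \<nu> \<noteq> {0}" by (auto simp: roots_def)
  have out: "\<And>x. x \<notin> H \<Longrightarrow> \<nu> x = 0" using \<nu>(1) by (simp add: dual_space_def)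
  have "root_space H \<nu> \<subseteq> gws H \<nu>"
  proof
    fix z assume "z \<in> root_space H \<nu>"
    then have "(shift h (\<nu> h) ^^ 1) z = 0" if "h \<in> H" for h
      using that by (simp add: root_space_def shift_def)
    then show "z \<in> gws H \<nu>" unfolding gws_def geig_def by blast
  qed
  moreover have "0 \<in> root_space H \<nu>" by (simp add: root_space_def)
  ultimately show "\<nu> \<in> \<Delta>" using gws_not_root[OF _ \<nu>(2) out] \<nu>(3) by blast
next
  fix \<phi> assume \<phi>: "\<phi> \<in> \<Delta>"
  then have "E \<phi> \<in> root_space H \<phi>" by (simp add: root_space_def bracket_H_E)
  then show "\<phi> \<in> roots H"
    using \<phi> E_nonzero[OF \<phi>] \<Delta>_dual[OF \<phi>] by (auto simp: roots_def \<Delta>_def)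
qed

lemma root_space_eq:
  assumes "\<phi> \<in> \<Delta>"
  shows "root_space H \<phi> = cspan {E \<phi>}"
proof (intro equalityI subsetI)
  fix z assume z: "z \<in> root_space H \<phi>"
  have "z \<in> gws H \<phi>"
    unfolding gws_def geig_def
    using z by (auto simp: root_space_def shift_def intro!: exI[of _ 1])
  then show "z \<in> cspan {E \<phi>}" by (simp add: gws_root[OF assms])
next
  fix z assume "z \<in> cspan {E \<phi>}"
  then show "z \<in> root_space H \<phi>"
    by (auto simp: complex_lie.span_singleton root_space_def bracket_scaleC_right bracket_H_E assms
        scaleC_scaleC mult.commute)
qed

lemma root_decomposition: "x = hpart x + (\<Sum>\<phi>\<in>\<Delta>. coord (E \<phi>) x *\<^sub>C E \<phi>)"
proof -
  have "x = (\<Sum>b\<in>B. coord b x *\<^sub>C b)" by (simp add: sum_coord)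
  also have "\<dots> = hpart x + (\<Sum>b | b \<in> B \<and> wt b \<noteq> 0. coord b x *\<^sub>C b)"
    unfolding hpart_def by (subst sum.union_disjoint[symmetric]) (auto simp: finite_B intro!: sum.cong)
  also have "(\<Sum>b | b \<in> B \<and> wt b \<noteq> 0. coord b x *\<^sub>C b) = (\<Sum>\<phi>\<in>\<Delta>. coord (E \<phi>) x *\<^sub>C E \<phi>)"
    by (rule sum.reindex_bij_witness[of _ E wt]) (auto simp: E_eq E_in_B wt_E \<Delta>_def)
  finally show ?thesis .
qed

lemma coord_E_E: "\<phi> \<in> \<Delta> \<Longrightarrow> \<mu> \<in> \<Delta> \<Longrightarrow> coord (E \<phi>) (E \<mu>) = (if \<phi> = \<mu> then 1 else 0)"
  by (simp add: coord_basis E_in_B E_inj)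

lemma hpart_E: "\<phi> \<in> \<Delta> \<Longrightarrow> hpart (E \<phi>) = 0"
  by (rule hpart_gws[OF E_gws]) (auto simp: \<Delta>_outside \<Delta>_def wt_outside)

text \<open>Since the weight components of a vector stay in an H-stable subspace and root spaces are
  lines, such a subspace is governed by its intersection with \<open>H\<close> and a set of
  roots.\<close>

lemma stable_components:
  assumes W: "csubspace W" "ad_stable H W" and x: "x \<in> W"
  shows "hpart x \<in> W" and "\<phi> \<in> \<Delta> \<Longrightarrow> coord (E \<phi>) x \<noteq> 0 \<Longrightarrow> E \<phi> \<in> W"
proof -
  let ?v = "\<lambda>\<mu>. if \<mu> = 0 then hpart x else coord (E \<mu>) x *\<^sub>C E \<mu>"
  let ?F = "insert 0 \<Delta>"
  have 0: "0 \<notin> \<Delta>" by (simp add: \<Delta>_def)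
  have fin: "finite ?F" by (simp add: finite_\<Delta>)
  have "(\<Sum>\<mu>\<in>?F. ?v \<mu>) = hpart x + (\<Sum>\<phi>\<in>\<Delta>. coord (E \<phi>) x *\<^sub>C E \<phi>)"
    using 0 finite_\<Delta> by (simp, intro sum.cong) auto
  then have s: "(\<Sum>\<mu>\<in>?F. ?v \<mu>) = x" by (simp only: root_decomposition[symmetric])
  have comp: "?v \<mu> \<in> W" if "\<mu> \<in> ?F" for \<mu>
  proof (rule component_in_stable_subspace[OF W fin, where v = ?v])
    show "\<mu> x = 0" if "\<mu> \<in> ?F" "x \<notin> H" for \<mu> x using that \<Delta>_outside by auto
    show "?v \<mu> \<in> gws H \<mu>" if "\<mu> \<in> ?F" for \<mu>
    proof (cases "\<mu> = 0")
      case True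
      then show ?thesis by (simp add: gws_0 hpart_in_H)
    next
      case False
      then show ?thesis using that by (auto intro!: complex_lie.subspace_scale[OF subspace_gws] E_gws)
    qed
    show "(\<Sum>\<mu>\<in>?F. ?v \<mu>) \<in> W" unfolding s by (rule x)
  qed (rule that)
  show "hpart x \<in> W" using comp[of 0] by simp
  assume \<phi>: "\<phi> \<in> \<Delta>" "coord (E \<phi>) x \<noteq> 0"
  have "\<phi> \<noteq> 0" using \<phi>(1) 0 by auto
  then have "coord (E \<phi>) x *\<^sub>C E \<phi> \<in> W" using comp[of \<phi>] \<phi>(1) by simp
  from complex_lie.subspace_scale[OF W(1) this, of "1 / coord (E \<phi>) x"] \<phi>(2)
  show "E \<phi> \<in> W" by (simp add: scaleC_scaleC scaleC_one)
qed

lemma subspace_eq_span: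
  assumes W: "csubspace W" "ad_stable H W"
  shows "W = cspan (W \<inter> H \<union> E ` {\<phi>\<in>\<Delta>. E \<phi> \<in> W})"
proof
  show "W \<subseteq> cspan (W \<inter> H \<union> E ` {\<phi>\<in>\<Delta>. E \<phi> \<in> W})" (is "_ \<subseteq> cspan ?X")
  proof
    fix x assume x: "x \<in> W"
    have "hpart x \<in> cspan ?X"
      using stable_components(1)[OF W x] hpart_in_H by (intro complex_lie.span_base) simp
    moreover have "coord (E \<phi>) x *\<^sub>C E \<phi> \<in> cspan ?X" if "\<phi> \<in> \<Delta>" for \<phi>
    proof (cases "coord (E \<phi>) x = 0")
      case True
      then show ?thesis by (simp add: complex_lie.span_zero)
    next
      case False
      then show ?thesis using stable_components(2)[OF W x that False] that
        by (intro complex_lie.span_scale complex_lie.span_base) auto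
    qed
    ultimately have "hpart x + (\<Sum>\<phi>\<in>\<Delta>. coord (E \<phi>) x *\<^sub>C E \<phi>) \<in> cspan ?X"
      by (intro complex_lie.span_add complex_lie.span_sum)
    then show "x \<in> cspan ?X" by (simp only: root_decomposition[symmetric])
  qed
  show "cspan (W \<inter> H \<union> E ` {\<phi>\<in>\<Delta>. E \<phi> \<in> W}) \<subseteq> W"
    by (rule complex_lie.span_minimal[OF _ W(1)]) auto
qed

section \<open>The inner product on roots\<close>

lemma K_E_opposite:
  assumes \<phi>: "\<phi> \<in> \<Delta>"
  shows "K (E \<phi>) (E (- \<phi>)) \<noteq> 0"
proof
  assume 0: "K (E \<phi>) (E (- \<phi>)) = 0"
  have "E \<phi> = 0"
  proof (rule K_eq_zero_if)
    fix b assume b: "b \<in> B"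
    show "K (E \<phi>) b = 0"
    proof (cases "wt b = - \<phi>")
      case True
      then have "b = E (- \<phi>)" using E_eq[OF b] neg_in_\<Delta>[OF \<phi>] by (auto simp: \<Delta>_def)
      then show ?thesis using 0 by simp
    next
      case False
      then have "\<phi> + wt b \<noteq> 0" by (metis add.commute add_eq_0_iff)
      from K_orthogonal[OF E_gws[OF \<phi>] B_gws[OF b] this] show ?thesis
        using \<Delta>_outside[OF \<phi>] wt_outside[OF b] by simp
    qed
  qed
  then show False using E_nonzero[OF \<phi>] by simp
qed

text \<open>The vector of \<open>H\<close> that represents \<open>\<phi>\<close> through
  \<open>K\<close>. Defining it by a bracket puts it into \<open>H\<close> and makes the bracket of
  opposite root vectors a multiple of it.\<close>

definition t :: "('a \<Rightarrow> complex) \<Rightarrow> 'a" where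
  "t \<phi> = (1 / K (E \<phi>) (E (- \<phi>))) *\<^sub>C bracket (E \<phi>) (E (- \<phi>))"

lemma t_in_H: "\<phi> \<in> \<Delta> \<Longrightarrow> t \<phi> \<in> H"
  unfolding t_def by (intro complex_lie.subspace_scale[OF subspace_H] bracket_E_E_opposite)

lemma bracket_opposite: "\<phi> \<in> \<Delta> \<Longrightarrow> bracket (E \<phi>) (E (- \<phi>)) = K (E \<phi>) (E (- \<phi>)) *\<^sub>C t \<phi>"
  by (simp add: t_def scaleC_scaleC scaleC_one K_E_opposite)

lemma K_t: "\<phi> \<in> \<Delta> \<Longrightarrow> h \<in> H \<Longrightarrow> K (t \<phi>) h = \<phi> h"
proof -
  assume \<phi>: "\<phi> \<in> \<Delta>" and h: "h \<in> H"
  have "K (bracket (E \<phi>) (E (- \<phi>))) h = K h (bracket (E \<phi>) (E (- \<phi>)))" by (rule K_sym)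
  also have "\<dots> = \<phi> h * K (E \<phi>) (E (- \<phi>))"
    by (simp add: K_invariant[symmetric] bracket_H_E \<phi> h K_scale_left)
  finally show ?thesis using K_E_opposite[OF \<phi>] by (simp add: t_def K_scale_left)
qed

lemma t_nonzero: "\<phi> \<in> \<Delta> \<Longrightarrow> t \<phi> \<noteq> 0"
proof
  assume \<phi>: "\<phi> \<in> \<Delta>" and "t \<phi> = 0"
  then have "\<phi> h = 0" if "h \<in> H" for h using K_t[OF \<phi> that] by (simp add: K_zero_left)
  then have "\<phi> = 0" using \<Delta>_outside[OF \<phi>] by (auto simp: fun_eq_iff)
  then show False using \<phi> by (simp add: \<Delta>_def)
qed

text \<open>By \<open>weight_ratio\<close> the weights on \<open>t \<phi>\<close> are real multiples
  \<open>r b\<close> of \<open>\<phi> (t \<phi>)\<close>. Since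
  \<open>\<phi> (t \<phi>) = K (t \<phi>) (t \<phi>)\<close> is \<open>R\<close> times its own
  square, with \<open>R\<close> the sum of the \<open>(r b)^2\<close>, it equals
  \<open>1 / R\<close>.\<close>

lemma wt_t_real:
  assumes \<phi>: "\<phi> \<in> \<Delta>"
  shows "b \<in> B \<Longrightarrow> wt b (t \<phi>) = of_real (Re (wt b (t \<phi>)))" and "Re (\<phi> (t \<phi>)) > 0"
proof -
  let ?h = "bracket (E \<phi>) (E (- \<phi>))" and ?c = "K (E \<phi>) (E (- \<phi>))"
  have hH: "?h \<in> H" by (rule bracket_E_E_opposite[OF \<phi>])
  have "\<forall>b\<in>B. \<exists>r::real. wt b (t \<phi>) = of_real r * \<phi> (t \<phi>)"
  proof
    fix b assume b: "b \<in> B"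
    obtain r :: real where "wt b ?h = of_real r * \<phi> ?h"
      using weight_ratio[OF E_gws[OF \<phi>] E_gws[OF neg_in_\<Delta>[OF \<phi>]] \<Delta>_outside[OF \<phi>] b] by blast
    moreover have "wt b ?h = ?c * wt b (t \<phi>)" "\<phi> ?h = ?c * \<phi> (t \<phi>)"
      using wt_scale[OF b t_in_H[OF \<phi>]] wt_scale[OF E_in_B[OF \<phi>] t_in_H[OF \<phi>]]
      by (simp_all add: bracket_opposite[OF \<phi>] wt_E[OF \<phi>])
    ultimately have "wt b (t \<phi>) = of_real r * \<phi> (t \<phi>)" using K_E_opposite[OF \<phi>] by simp
    then show "\<exists>r::real. wt b (t \<phi>) = of_real r * \<phi> (t \<phi>)" by blast
  qed
  from bchoice[OF this] obtain r :: "'a \<Rightarrow> real"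
    where r: "\<forall>b\<in>B. wt b (t \<phi>) = of_real (r b) * \<phi> (t \<phi>)" ..
  have n0: "\<phi> (t \<phi>) \<noteq> 0"
    using eq_zero_if_weights_zero[OF t_in_H[OF \<phi>]] r t_nonzero[OF \<phi>] by fastforce
  define R where "R = (\<Sum>b\<in>B. (r b)\<^sup>2)"
  have "\<phi> (t \<phi>) = K (t \<phi>) (t \<phi>)" by (simp add: K_t \<phi> t_in_H)
  also have "\<dots> = (\<Sum>b\<in>B. of_real ((r b)\<^sup>2) * (\<phi> (t \<phi>))\<^sup>2)"
    unfolding K_H[OF t_in_H[OF \<phi>] t_in_H[OF \<phi>]]
    by (rule sum.cong) (simp_all add: r power2_eq_square)
  also have "\<dots> = of_real R * (\<phi> (t \<phi>))\<^sup>2" by (simp add: R_def sum_distrib_right)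
  finally have "of_real R * \<phi> (t \<phi>) = 1" using n0 by (simp add: power2_eq_square)
  moreover from this have "R \<noteq> 0" by auto
  ultimately have e: "\<phi> (t \<phi>) = of_real (1 / R)" by (simp add: eq_divide_eq mult.commute)
  have "R \<ge> 0" unfolding R_def by (intro sum_nonneg) simp
  then show "Re (\<phi> (t \<phi>)) > 0" using \<open>R \<noteq> 0\<close> unfolding e Re_complex_of_real by simp
  assume "b \<in> B"
  then have "wt b (t \<phi>) = of_real (r b * (1 / R))" using r e by simp
  then show "wt b (t \<phi>) = of_real (Re (wt b (t \<phi>)))" by (metis Re_complex_of_real)
qed

text \<open>For roots \<open>\<phi>\<close> and \<open>\<mu>\<close> the value
  \<open>\<phi> (t \<mu>)\<close> is real, so taking the real part loses nothing and makes signs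
  available.\<close>

definition ip :: "('a \<Rightarrow> complex) \<Rightarrow> ('a \<Rightarrow> complex) \<Rightarrow> real" where
  "ip \<phi> \<mu> = Re (\<phi> (t \<mu>))"

lemma root_t: "\<phi> \<in> \<Delta> \<Longrightarrow> \<mu> \<in> \<Delta> \<Longrightarrow> \<phi> (t \<mu>) = of_real (ip \<phi> \<mu>)"
  using wt_t_real(1)[of \<mu> "E \<phi>"] by (simp add: ip_def E_in_B wt_E)

lemma ip_pos: "\<phi> \<in> \<Delta> \<Longrightarrow> ip \<phi> \<phi> > 0"
  using wt_t_real(2) by (simp add: ip_def)

lemma ip_sym: "\<phi> \<in> \<Delta> \<Longrightarrow> \<mu> \<in> \<Delta> \<Longrightarrow> ip \<phi> \<mu> = ip \<mu> \<phi>"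
  using K_t[of \<phi> "t \<mu>"] K_t[of \<mu> "t \<phi>"] K_sym[of "t \<phi>" "t \<mu>"] t_in_H by (simp add: ip_def)

text \<open>
  If the lowering operator killed \<open>E \<phi>\<close>, the half string \<open>\<phi>, \<phi> + \<mu>, \<dots>\<close> would be stable under
  \<open>E \<mu>\<close> and \<open>E (- \<mu>)\<close>, but all its weights are positive on \<open>t \<mu>\<close>.
\<close>

lemma lowering_nonzero:
  assumes \<phi>: "\<phi> \<in> \<Delta>" and \<mu>: "\<mu> \<in> \<Delta>" and pos: "ip \<phi> \<mu> > 0"
  shows "bracket (E (- \<mu>)) (E \<phi>) \<noteq> 0"
proof
  assume zero: "bracket (E (- \<mu>)) (E \<phi>) = 0"
  let ?h = "bracket (E \<mu>) (E (- \<mu>))"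
  have n: "- \<mu> \<in> \<Delta>" by (rule neg_in_\<Delta>[OF \<mu>])
  define C where "C = {b\<in>B. \<exists>k::nat. \<forall>x. wt b x = \<phi> x + of_nat k * \<mu> x}"
  have CB: "C \<subseteq> B" by (auto simp: C_def)
  have finC: "finite C" using finite_subset[OF CB finite_B] .
  have EC: "E \<phi> \<in> C" using \<phi> by (auto simp: C_def E_in_B wt_E intro!: exI[of _ 0])
  have in_C: "x \<in> cspan C"
    if x: "x \<in> gws H \<theta>" and k: "\<And>x. \<theta> x = \<phi> x + of_nat k * \<mu> x" for x \<theta> k
  proof -
    have "gws H \<theta> = cspan {d\<in>B. wt d = \<theta>}"
      by (rule gws_eq) (simp add: k \<Delta>_outside \<phi> \<mu>)
    also have "\<dots> \<subseteq> cspan C"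
      by (rule complex_lie.span_mono) (use k in \<open>auto simp: C_def\<close>)
    finally show ?thesis using x by blast
  qed
  have "(\<Sum>c\<in>C. wt c ?h) = 0"
  proof (rule trace_ad_bracket[OF CB])
    fix c assume c: "c \<in> C"
    then have cB: "c \<in> B" using CB by blast
    obtain k :: nat where k: "\<forall>x. wt c x = \<phi> x + of_nat k * \<mu> x" using c by (auto simp: C_def)
    show "bracket (E \<mu>) c \<in> cspan C"
      by (rule in_C[OF gws_bracket[OF E_gws[OF \<mu>] B_gws[OF cB]], of "Suc k"]) (simp add: k algebra_simps)
    show "bracket (E (- \<mu>)) c \<in> cspan C"
    proof (cases k)
      \<comment> \<open>The bottom of the half string: only \<open>E \<phi>\<close> has this weight,
        and it is killed by assumption.\<close>
      case 0
      then have "wt c = \<phi>" using k by (auto simp: fun_eq_iff)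
      then have "c = E \<phi>" using E_eq[OF cB] \<phi> by (auto simp: \<Delta>_def)
      then show ?thesis using zero complex_lie.span_zero by simp
    next
      case (Suc j)
      then show ?thesis
        by (intro in_C[OF gws_bracket[OF E_gws[OF n] B_gws[OF cB]], of j]) (simp add: k algebra_simps)
    qed
  qed (rule bracket_E_E_opposite[OF \<mu>])
  moreover have "(\<Sum>c\<in>C. wt c ?h) = K (E \<mu>) (E (- \<mu>)) * (\<Sum>c\<in>C. wt c (t \<mu>))"
    unfolding sum_distrib_left
    by (rule sum.cong) (use CB in \<open>auto simp: bracket_opposite \<mu> wt_scale t_in_H\<close>)
  ultimately have "(\<Sum>c\<in>C. wt c (t \<mu>)) = 0" using K_E_opposite[OF \<mu>] by simp
  then have "(\<Sum>c\<in>C. Re (wt c (t \<mu>))) = 0" by (simp only: Re_sum[symmetric] zero_complex.sel)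
  moreover have "(\<Sum>c\<in>C. Re (wt c (t \<mu>))) > 0"
  proof (rule sum_pos[OF finC])
    show "C \<noteq> {}" using EC by blast
    fix c assume "c \<in> C"
    then obtain k :: nat where "wt c (t \<mu>) = \<phi> (t \<mu>) + of_nat k * \<mu> (t \<mu>)" by (auto simp: C_def)
    then have "Re (wt c (t \<mu>)) = ip \<phi> \<mu> + of_nat k * ip \<mu> \<mu>" by (simp add: ip_def)
    then show "Re (wt c (t \<mu>)) > 0" using pos ip_pos[OF \<mu>] by (simp add: add_pos_nonneg)
  qed
  ultimately show False by simp
qed

lemma bracket_nonzero_root:
  assumes "\<phi> \<in> \<Delta>" "\<mu> \<in> \<Delta>" "bracket (E \<phi>) (E \<mu>) \<noteq> 0" "\<phi> + \<mu> \<noteq> 0"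
  shows "\<phi> + \<mu> \<in> \<Delta>"
  using bracket_E_E_not_root assms by blast

text \<open>Pair \<open>[E \<phi>, E \<mu>]\<close> with \<open>E \<rho>\<close> and use invariance.
  This serves to reverse a step from one root to another.\<close>

lemma bracket_cyclic:
  assumes \<phi>: "\<phi> \<in> \<Delta>" and \<mu>: "\<mu> \<in> \<Delta>" and \<rho>: "\<rho> \<in> \<Delta>" and s: "\<phi> + \<mu> + \<rho> = 0"
    and n: "bracket (E \<phi>) (E \<mu>) \<noteq> 0"
  shows "bracket (E \<mu>) (E \<rho>) \<noteq> 0"
proof
  assume 0: "bracket (E \<mu>) (E \<rho>) = 0"
  have e: "\<phi> + \<mu> = - \<rho>" using s by (simp add: eq_neg_iff_add_eq_0)
  have "\<phi> + \<mu> \<in> \<Delta>" unfolding e by (rule neg_in_\<Delta>[OF \<rho>])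
  from bracket_E_E_root[OF \<phi> \<mu> this] obtain c where c: "bracket (E \<phi>) (E \<mu>) = c *\<^sub>C E (- \<rho>)"
    unfolding e .
  have "c * K (E (- \<rho>)) (E \<rho>) = K (bracket (E \<phi>) (E \<mu>)) (E \<rho>)" by (simp add: c K_scale_left)
  also have "\<dots> = 0" by (simp add: K_invariant 0 K_zero_right)
  finally have "c = 0" using K_E_opposite[OF neg_in_\<Delta>[OF \<rho>]] by simp
  then show False using n c by simp
qed

text \<open>\<open>[E \<gamma>, E (- \<gamma>)]\<close> has trace 0 on the span of these root
  vectors, and it is a nonzero multiple of \<open>t \<gamma>\<close>.\<close>

lemma sum_roots_orthogonal:
  assumes A: "A \<subseteq> \<Delta>" and \<gamma>: "\<gamma> \<in> \<Delta>"
    and "\<And>\<phi>. \<phi> \<in> A \<Longrightarrow> bracket (E \<gamma>) (E \<phi>) \<in> cspan (E ` A)"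
    and "\<And>\<phi>. \<phi> \<in> A \<Longrightarrow> bracket (E (- \<gamma>)) (E \<phi>) \<in> cspan (E ` A)"
  shows "(\<Sum>\<phi>\<in>A. \<phi> (t \<gamma>)) = 0"
proof -
  let ?h = "bracket (E \<gamma>) (E (- \<gamma>))"
  have "(\<Sum>c\<in>E ` A. wt c ?h) = 0"
    by (rule trace_ad_bracket) (use A assms(3,4) E_in_B bracket_E_E_opposite[OF \<gamma>] in auto)
  moreover have "inj_on E A" by (rule inj_onI) (use A E_inj in blast)
  ultimately have "(\<Sum>\<phi>\<in>A. wt (E \<phi>) ?h) = 0" by (simp add: sum.reindex)
  moreover have "(\<Sum>\<phi>\<in>A. wt (E \<phi>) ?h) = K (E \<gamma>) (E (- \<gamma>)) * (\<Sum>\<phi>\<in>A. \<phi> (t \<gamma>))"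
    unfolding sum_distrib_left
  proof (rule sum.cong)
    fix \<phi> assume "\<phi> \<in> A"
    then have "\<phi> \<in> \<Delta>" using A by blast
    then show "wt (E \<phi>) ?h = K (E \<gamma>) (E (- \<gamma>)) * \<phi> (t \<gamma>)"
      using wt_scale[OF E_in_B t_in_H[OF \<gamma>]] by (simp add: bracket_opposite \<gamma> wt_E)
  qed simp
  ultimately show ?thesis using K_E_opposite[OF \<gamma>] by simp
qed

text \<open>All weights are real on sums of vectors \<open>t \<phi>\<close>, so \<open>K x x\<close>
  is a sum of real squares; if all of them vanish, so does \<open>x\<close>.\<close>

lemma sum_t_norm:
  assumes A: "A \<subseteq> \<Delta>"
  defines "x \<equiv> \<Sum>\<phi>\<in>A. t \<phi>"
  shows "x \<in> H" and "K x x = of_real (Re (K x x))" and "x \<noteq> 0 \<Longrightarrow> Re (K x x) > 0"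
proof -
  show xH: "x \<in> H" unfolding x_def
    by (rule complex_lie.subspace_sum[OF subspace_H]) (use A t_in_H in blast)
  have real: "wt b x = of_real (Re (wt b x))" if b: "b \<in> B" for b
  proof -
    have "wt b x = (\<Sum>\<phi>\<in>A. wt b (t \<phi>))"
      unfolding x_def by (rule wt_sum[OF b]) (use A t_in_H in blast)
    also have "\<dots> = (\<Sum>\<phi>\<in>A. of_real (Re (wt b (t \<phi>))))"
      by (rule sum.cong) (use A wt_t_real(1)[OF _ b] in auto)
    also have "\<dots> = of_real (\<Sum>\<phi>\<in>A. Re (wt b (t \<phi>)))" by simp
    finally show ?thesis by (metis Re_complex_of_real)
  qed
  have "K x x = (\<Sum>b\<in>B. wt b x * wt b x)" by (rule K_H[OF xH xH])
  also have "\<dots> = (\<Sum>b\<in>B. of_real ((Re (wt b x))\<^sup>2))"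
    by (rule sum.cong) (simp_all add: power2_eq_square real[symmetric])
  finally have e: "K x x = of_real (\<Sum>b\<in>B. (Re (wt b x))\<^sup>2)" by simp
  then show "K x x = of_real (Re (K x x))" by (metis Re_complex_of_real)
  assume "x \<noteq> 0"
  then obtain b where b: "b \<in> B" "wt b x \<noteq> 0" using eq_zero_if_weights_zero[OF xH] by blast
  then have "Re (wt b x) \<noteq> 0" using real[OF b(1)] by (metis of_real_0)
  then have "(\<Sum>b\<in>B. (Re (wt b x))\<^sup>2) > 0"
    by (intro sum_pos2[OF finite_B b(1)]) auto
  then show "Re (K x x) > 0" by (simp add: e)
qed

end

section \<open>Simple roots\<close>

lemma sum_fun_apply: "(\<Sum>i\<in>I. f i) x = (\<Sum>i\<in>I. f i x)"
  by (induction I rule: infinite_finite_induct) simp_all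

context nilpotent_subalgebra
begin

lemma dual_add: "\<nu> \<in> dual_space H \<Longrightarrow> x \<in> H \<Longrightarrow> y \<in> H \<Longrightarrow> \<nu> (x + y) = \<nu> x + \<nu> y"
  and dual_scale: "\<nu> \<in> dual_space H \<Longrightarrow> x \<in> H \<Longrightarrow> \<nu> (c *\<^sub>C x) = c * \<nu> x"
  and dual_outside: "\<nu> \<in> dual_space H \<Longrightarrow> x \<notin> H \<Longrightarrow> \<nu> x = 0"
  by (simp_all add: dual_space_def)

lemma dual_zero: "\<nu> \<in> dual_space H \<Longrightarrow> \<nu> 0 = 0"
  using dual_scale[of \<nu> 0 0] complex_lie.subspace_0[OF subspace_H] by simp

lemma dual_diff:
  assumes "\<nu> \<in> dual_space H" "x \<in> H" "y \<in> H"
  shows "\<nu> (x - y) = \<nu> x - \<nu> y"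
  using dual_add[OF assms(1) complex_lie.subspace_diff[OF subspace_H assms(2,3)] assms(3)] by simp

lemma dual_sum:
  assumes "\<nu> \<in> dual_space H" "\<And>i. i \<in> I \<Longrightarrow> x i \<in> H"
  shows "\<nu> (\<Sum>i\<in>I. x i) = (\<Sum>i\<in>I. \<nu> (x i))"
  using assms(2)
proof (induction I rule: infinite_finite_induct)
  case (insert i I)
  then have "(\<Sum>i\<in>I. x i) \<in> H" by (intro complex_lie.subspace_sum[OF subspace_H]) simp
  then show ?case using insert by (simp add: dual_add assms(1))
qed (simp_all add: dual_zero assms(1))

text \<open>Elimination: a functional \<open>\<alpha>\<close> outside the span of \<open>S\<close>
  is nonzero somewhere on the common kernel of \<open>S\<close>, which supplies \<open>z\<close>;
  the old dual vectors are then corrected by multiples of \<open>z\<close>.\<close>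

lemma dual_vectors:
  assumes "finite S" "S \<subseteq> dual_space H" "\<not> functional_dependent S"
  shows "\<exists>x. \<forall>\<alpha>\<in>S. x \<alpha> \<in> H \<and> (\<forall>\<beta>\<in>S. \<beta> (x \<alpha>) = (if \<beta> = \<alpha> then 1 else 0))"
  using assms
proof (induction S rule: finite_induct)
  case (insert \<alpha> S)
  have ind: "\<not> functional_dependent S" "\<alpha> \<notin> functional.span S"
    using insert.prems(2) insert.hyps(2) by (simp_all add: functional.independent_insert)
  have S: "S \<subseteq> dual_space H" and \<alpha>: "\<alpha> \<in> dual_space H" using insert.prems(1) by auto
  obtain x where x: "\<forall>\<alpha>\<in>S. x \<alpha> \<in> H \<and> (\<forall>\<beta>\<in>S. \<beta> (x \<alpha>) = (if \<beta> = \<alpha> then 1 else 0))"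
    using insert.IH[OF S ind(1)] ..
  have xH: "x s \<in> H" if "s \<in> S" for s using x that by blast
  have xs: "s' (x s) = (if s' = s then 1 else 0)" if "s \<in> S" "s' \<in> S" for s s' using x that by blast
  have "\<exists>y\<in>H. \<alpha> y - (\<Sum>s\<in>S. \<alpha> (x s) * s y) \<noteq> 0"
  proof (rule ccontr)
    assume "\<not> ?thesis"
    then have 0: "\<alpha> y = (\<Sum>s\<in>S. \<alpha> (x s) * s y)" if "y \<in> H" for y using that by auto
    have "\<alpha> y = (\<Sum>s\<in>S. functional_scale (\<alpha> (x s)) s y)" for y
    proof (cases "y \<in> H")
      case True
      then show ?thesis by (simp add: 0 functional_scale_def)
    next
      case False
      then have "s y = 0" if "s \<in> S" for s using S that dual_outside by blast
      then have "(\<Sum>s\<in>S. functional_scale (\<alpha> (x s)) s y) = 0"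
        by (intro sum.neutral) (simp add: functional_scale_def)
      then show ?thesis using False by (simp add: dual_outside[OF \<alpha>])
    qed
    then have "\<alpha> = (\<Sum>s\<in>S. functional_scale (\<alpha> (x s)) s)"
      unfolding fun_eq_iff sum_fun_apply by (rule allI)
    also have "\<dots> \<in> functional.span S"
      by (intro functional.span_sum functional.span_scale functional.span_base)
    finally show False using ind(2) by simp
  qed
  then obtain y where y: "y \<in> H" and d0: "\<alpha> y - (\<Sum>s\<in>S. \<alpha> (x s) * s y) \<noteq> 0" ..
  define d where "d = \<alpha> y - (\<Sum>s\<in>S. \<alpha> (x s) * s y)"
  define u where "u = (\<Sum>s\<in>S. s y *\<^sub>C x s)"
  have uH: "u \<in> H" unfolding u_def
    by (intro complex_lie.subspace_sum[OF subspace_H] complex_lie.subspace_scale[OF subspace_H] xH)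
  have du: "\<nu> u = (\<Sum>s\<in>S. s y * \<nu> (x s))" if "\<nu> \<in> dual_space H" for \<nu>
    unfolding u_def
    using dual_sum[OF that, of S "\<lambda>s. s y *\<^sub>C x s"] dual_scale[OF that] xH
      complex_lie.subspace_scale[OF subspace_H] by simp
  define z where "z = (1 / d) *\<^sub>C (y - u)"
  have zH: "z \<in> H" unfolding z_def
    by (intro complex_lie.subspace_scale[OF subspace_H] complex_lie.subspace_diff[OF subspace_H] y uH)
  have dz: "\<nu> z = (1 / d) * (\<nu> y - \<nu> u)" if "\<nu> \<in> dual_space H" for \<nu>
    unfolding z_def using that y uH complex_lie.subspace_diff[OF subspace_H y uH]
    by (simp add: dual_scale dual_diff)
  have \<alpha>z: "\<alpha> z = 1" using d0 by (simp add: dz[OF \<alpha>] du[OF \<alpha>] d_def mult.commute)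
  have sz: "s z = 0" if s: "s \<in> S" for s
  proof -
    have "s u = (\<Sum>s'\<in>S. if s = s' then s' y else 0)"
      using S s by (subst du) (auto intro!: sum.cong simp: xs)
    also have "\<dots> = s y" using s insert.hyps(1) by simp
    finally show ?thesis using S s dz[of s] by auto
  qed
  define x' where "x' s = (if s = \<alpha> then z else x s - \<alpha> (x s) *\<^sub>C z)" for s
  have x'H: "x s - \<alpha> (x s) *\<^sub>C z \<in> H" if "s \<in> S" for s
    by (intro complex_lie.subspace_diff[OF subspace_H] complex_lie.subspace_scale[OF subspace_H] xH[OF that] zH)
  have \<nu>x': "\<nu> (x s - \<alpha> (x s) *\<^sub>C z) = \<nu> (x s) - \<alpha> (x s) * \<nu> z" if "s \<in> S" "\<nu> \<in> dual_space H" for s \<nu>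
    using that xH zH complex_lie.subspace_scale[OF subspace_H zH] by (simp add: dual_diff dual_scale)
  show ?case
  proof (intro exI[of _ x'] ballI conjI)
    fix s assume s: "s \<in> insert \<alpha> S"
    show "x' s \<in> H" using s zH x'H by (auto simp: x'_def)
    fix s' assume s': "s' \<in> insert \<alpha> S"
    show "s' (x' s) = (if s' = s then 1 else 0)"
    proof (cases "s = \<alpha>")
      case True
      then show ?thesis using s' \<alpha>z sz insert.hyps(2) by (auto simp: x'_def)
    next
      case False
      then have sS: "s \<in> S" using s by simp
      have "s' \<in> dual_space H" using s' S \<alpha> by auto
      then have e: "s' (x' s) = s' (x s) - \<alpha> (x s) * s' z" using \<nu>x'[OF sS] False by (simp add: x'_def)
      show ?thesis
      proof (cases "s' = \<alpha>")
        case True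
        then show ?thesis using e \<alpha>z False by simp
      next
        case False
        then have "s' \<in> S" using s' by simp
        then show ?thesis using e xs[OF sS] sz by simp
      qed
    qed
  qed
qed simp

end

locale simple_roots = cartan_decomposition H B wt
  for H :: "'a::complex_lie_algebra set" and B wt +
  fixes S :: "('a \<Rightarrow> complex) set"
  assumes S: "simple_root_system H S"
begin

lemma finite_S: "finite S" and S_\<Delta>: "S \<subseteq> \<Delta>" and S_independent: "\<not> functional_dependent S"
  using S by (simp_all add: simple_root_system_def \<Delta>_eq_roots)

text \<open>Fundamental coweights: evaluating a root at \<open>\<omega> \<alpha>\<close> reads off
  its coefficient at \<open>\<alpha>\<close>, so coefficients are unique and additive.\<close>

definition \<omega> :: "('a \<Rightarrow> complex) \<Rightarrow> 'a" where
  "\<omega> = (SOME x. \<forall>\<alpha>\<in>S. x \<alpha> \<in> H \<and> (\<forall>\<beta>\<in>S. \<beta> (x \<alpha>) = (if \<beta> = \<alpha> then 1 else 0)))"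

lemma \<omega>: "\<alpha> \<in> S \<Longrightarrow> \<omega> \<alpha> \<in> H \<and> (\<forall>\<beta>\<in>S. \<beta> (\<omega> \<alpha>) = (if \<beta> = \<alpha> then 1 else 0))"
proof -
  have "S \<subseteq> dual_space H" using S_\<Delta> \<Delta>_dual by blast
  from someI_ex[OF dual_vectors[OF finite_S this S_independent]]
  show "\<alpha> \<in> S \<Longrightarrow> \<omega> \<alpha> \<in> H \<and> (\<forall>\<beta>\<in>S. \<beta> (\<omega> \<alpha>) = (if \<beta> = \<alpha> then 1 else 0))"
    unfolding \<omega>_def by blast
qed

lemma \<omega>_in_H: "\<alpha> \<in> S \<Longrightarrow> \<omega> \<alpha> \<in> H"
  and simple_\<omega>: "\<alpha> \<in> S \<Longrightarrow> \<beta> \<in> S \<Longrightarrow> \<beta> (\<omega> \<alpha>) = (if \<beta> = \<alpha> then 1 else 0)"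
  using \<omega> by blast+

abbreviation cf :: "('a \<Rightarrow> complex) \<Rightarrow> ('a \<Rightarrow> complex) \<Rightarrow> int" where
  "cf \<equiv> root_coeff S"

lemma combination_\<omega>:
  assumes "\<phi> = (\<Sum>\<alpha>\<in>S. functional_scale (of_int (n \<alpha>)) \<alpha>)" "\<alpha> \<in> S"
  shows "\<phi> (\<omega> \<alpha>) = of_int (n \<alpha>)"
proof -
  have "\<phi> (\<omega> \<alpha>) = (\<Sum>\<beta>\<in>S. of_int (n \<beta>) * \<beta> (\<omega> \<alpha>))"
    by (simp add: assms(1) sum_fun_apply functional_scale_def)
  also have "\<dots> = (\<Sum>\<beta>\<in>S. if \<alpha> = \<beta> then of_int (n \<beta>) else 0)"
    by (rule sum.cong) (auto simp: simple_\<omega> assms(2))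
  also have "\<dots> = of_int (n \<alpha>)" using finite_S assms(2) by simp
  finally show ?thesis .
qed

text \<open>Evaluation at the coweights shows uniqueness, which gives the definite description in
  \<open>root_coeff\<close> its value.\<close>

lemma root_coeff_spec:
  assumes "\<phi> \<in> \<Delta>"
  shows "\<phi> = (\<Sum>\<alpha>\<in>S. functional_scale (of_int (cf \<phi> \<alpha>)) \<alpha>) \<and> (\<forall>\<alpha>. \<alpha> \<notin> S \<longrightarrow> cf \<phi> \<alpha> = 0)"
    and "(\<forall>\<alpha>\<in>S. 0 \<le> cf \<phi> \<alpha>) \<or> (\<forall>\<alpha>\<in>S. cf \<phi> \<alpha> \<le> 0)"
proof -
  obtain n :: "('a \<Rightarrow> complex) \<Rightarrow> int" where n: "\<phi> = (\<Sum>\<alpha>\<in>S. functional_scale (of_int (n \<alpha>)) \<alpha>)"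
    and sgn: "(\<forall>\<alpha>\<in>S. 0 \<le> n \<alpha>) \<or> (\<forall>\<alpha>\<in>S. n \<alpha> \<le> 0)"
    using S assms unfolding simple_root_system_def \<Delta>_eq_roots by blast
  define m where "m \<alpha> = (if \<alpha> \<in> S then n \<alpha> else 0)" for \<alpha>
  have "(\<Sum>\<alpha>\<in>S. functional_scale (of_int (n \<alpha>)) \<alpha>) = (\<Sum>\<alpha>\<in>S. functional_scale (of_int (m \<alpha>)) \<alpha>)"
    by (rule sum.cong) (simp_all add: m_def)
  then have m: "\<phi> = (\<Sum>\<alpha>\<in>S. functional_scale (of_int (m \<alpha>)) \<alpha>) \<and> (\<forall>\<alpha>. \<alpha> \<notin> S \<longrightarrow> m \<alpha> = 0)"
    using n by (simp add: m_def)
  have eq: "cf \<phi> = m"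
    unfolding root_coeff_def
  proof (rule the_equality)
    show "\<phi> = (\<Sum>\<alpha>\<in>S. functional_scale (of_int (m \<alpha>)) \<alpha>) \<and> (\<forall>\<alpha>. \<alpha> \<notin> S \<longrightarrow> m \<alpha> = 0)"
      by (rule m)
    fix n' assume n': "\<phi> = (\<Sum>\<alpha>\<in>S. functional_scale (of_int (n' \<alpha>)) \<alpha>) \<and> (\<forall>\<alpha>. \<alpha> \<notin> S \<longrightarrow> n' \<alpha> = 0)"
    show "n' = m"
    proof
      fix \<alpha>
      show "n' \<alpha> = m \<alpha>"
      proof (cases "\<alpha> \<in> S")
        case True
        have "(of_int (n' \<alpha>) :: complex) = of_int (m \<alpha>)"
          using combination_\<omega>[OF conjunct1[OF n'] True] combination_\<omega>[OF conjunct1[OF m] True] by simp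
        then show ?thesis by (simp only: of_int_eq_iff)
      qed (use n' m in simp)
    qed
  qed
  show "\<phi> = (\<Sum>\<alpha>\<in>S. functional_scale (of_int (cf \<phi> \<alpha>)) \<alpha>) \<and> (\<forall>\<alpha>. \<alpha> \<notin> S \<longrightarrow> cf \<phi> \<alpha> = 0)"
    unfolding eq by (rule m)
  show "(\<forall>\<alpha>\<in>S. 0 \<le> cf \<phi> \<alpha>) \<or> (\<forall>\<alpha>\<in>S. cf \<phi> \<alpha> \<le> 0)"
    unfolding eq using sgn by (simp add: m_def)
qed

lemma root_eq_sum: "\<phi> \<in> \<Delta> \<Longrightarrow> \<phi> x = (\<Sum>\<alpha>\<in>S. of_int (cf \<phi> \<alpha>) * \<alpha> x)"
proof -
  assume "\<phi> \<in> \<Delta>"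
  from fun_cong[OF conjunct1[OF root_coeff_spec(1)[OF this]], of x]
  show ?thesis by (simp add: sum_fun_apply functional_scale_def)
qed

lemma root_\<omega>: "\<phi> \<in> \<Delta> \<Longrightarrow> \<alpha> \<in> S \<Longrightarrow> \<phi> (\<omega> \<alpha>) = of_int (cf \<phi> \<alpha>)"
  by (rule combination_\<omega>[OF conjunct1[OF root_coeff_spec(1)]])

lemma cf_eqI: "\<phi> \<in> \<Delta> \<Longrightarrow> \<alpha> \<in> S \<Longrightarrow> \<phi> (\<omega> \<alpha>) = of_int k \<Longrightarrow> cf \<phi> \<alpha> = k"
  using root_\<omega>[of \<phi> \<alpha>] by simp

lemma cf_add: "\<phi> \<in> \<Delta> \<Longrightarrow> \<mu> \<in> \<Delta> \<Longrightarrow> \<phi> + \<mu> \<in> \<Delta> \<Longrightarrow> \<alpha> \<in> S \<Longrightarrow> cf (\<phi> + \<mu>) \<alpha> = cf \<phi> \<alpha> + cf \<mu> \<alpha>"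
  by (rule cf_eqI) (simp_all add: root_\<omega>)

lemma cf_minus: "\<phi> \<in> \<Delta> \<Longrightarrow> \<alpha> \<in> S \<Longrightarrow> cf (- \<phi>) \<alpha> = - cf \<phi> \<alpha>"
  by (rule cf_eqI) (simp_all add: root_\<omega> neg_in_\<Delta>)

lemma cf_simple: "\<alpha> \<in> S \<Longrightarrow> \<beta> \<in> S \<Longrightarrow> cf \<beta> \<alpha> = (if \<beta> = \<alpha> then 1 else 0)"
  by (rule cf_eqI) (use S_\<Delta> in \<open>auto simp: simple_\<omega>\<close>)

lemma root_eqI:
  assumes "\<phi> \<in> \<Delta>" "\<mu> \<in> \<Delta>" "\<And>\<alpha>. \<alpha> \<in> S \<Longrightarrow> cf \<phi> \<alpha> = cf \<mu> \<alpha>"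
  shows "\<phi> = \<mu>"
  by (rule ext) (simp add: root_eq_sum[OF assms(1)] root_eq_sum[OF assms(2)] assms(3))

section \<open>Positivity, height and induction over positive roots\<close>

definition pos :: "('a \<Rightarrow> complex) \<Rightarrow> bool" where
  "pos \<phi> \<longleftrightarrow> (\<forall>\<alpha>\<in>S. 0 \<le> cf \<phi> \<alpha>)"

lemma positive_roots_eq: "positive_roots H S = {\<phi>\<in>\<Delta>. pos \<phi>}"
  by (simp add: positive_roots_def pos_def \<Delta>_eq_roots)

lemma pos_or_neg: "\<phi> \<in> \<Delta> \<Longrightarrow> pos \<phi> \<or> pos (- \<phi>)"
  using root_coeff_spec(2)[of \<phi>] by (simp add: pos_def cf_minus)

definition ht :: "('a \<Rightarrow> complex) \<Rightarrow> int" where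
  "ht \<phi> = (\<Sum>\<alpha>\<in>S. cf \<phi> \<alpha>)"

lemma ht_add: "\<phi> \<in> \<Delta> \<Longrightarrow> \<mu> \<in> \<Delta> \<Longrightarrow> \<phi> + \<mu> \<in> \<Delta> \<Longrightarrow> ht (\<phi> + \<mu>) = ht \<phi> + ht \<mu>"
  by (simp add: ht_def cf_add sum.distrib)

lemma ht_simple: "\<alpha> \<in> S \<Longrightarrow> ht \<alpha> = 1"
  using finite_S by (simp add: ht_def cf_simple)

lemma ht_minus: "\<phi> \<in> \<Delta> \<Longrightarrow> ht (- \<phi>) = - ht \<phi>"
  by (simp add: ht_def cf_minus sum_negf)

lemma ht_pos:
  assumes "\<phi> \<in> \<Delta>" "pos \<phi>"
  shows "ht \<phi> \<ge> 1"
proof -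
  have "\<exists>\<alpha>\<in>S. cf \<phi> \<alpha> \<noteq> 0"
  proof (rule ccontr)
    assume "\<not> ?thesis"
    then have "\<phi> x = 0" for x by (simp add: root_eq_sum[OF assms(1)])
    then show False using assms(1) by (auto simp: \<Delta>_def fun_eq_iff)
  qed
  then obtain \<alpha> where \<alpha>: "\<alpha> \<in> S" "cf \<phi> \<alpha> \<noteq> 0" ..
  have "ht \<phi> > 0"
    unfolding ht_def
    by (rule sum_pos2[OF finite_S \<alpha>(1)]) (use assms(2) \<alpha> in \<open>force simp: pos_def\<close>)+
  then show ?thesis by simp
qed

lemma simple_pos: "\<alpha> \<in> S \<Longrightarrow> pos \<alpha>"
  by (simp add: pos_def cf_simple)

lemma ip_minus:
  assumes "\<phi> \<in> \<Delta>" "\<mu> \<in> \<Delta>"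
  shows "ip (- \<phi>) (- \<mu>) = ip \<phi> \<mu>"
proof -
  have "ip (- \<phi>) (- \<mu>) = - ip \<phi> (- \<mu>)" by (simp add: ip_def)
  moreover have "ip \<phi> (- \<mu>) = ip (- \<mu>) \<phi>" by (rule ip_sym) (simp_all add: assms neg_in_\<Delta>)
  moreover have "ip (- \<mu>) \<phi> = - ip \<mu> \<phi>" by (simp add: ip_def)
  moreover have "ip \<mu> \<phi> = ip \<phi> \<mu>" by (rule ip_sym) (simp_all add: assms)
  ultimately show ?thesis by linarith
qed

text \<open>\<open>ip \<phi> \<phi> > 0\<close> is the sum of the
  \<open>cf \<phi> \<alpha> * ip \<alpha> \<phi>\<close>, so some simple \<open>\<alpha>\<close> has
  both factors positive. Lowering by it is nonzero, and cyclicity reverses the step. The mirrored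
  bracket is recorded too, so that one induction can treat \<open>\<phi>\<close> and
  \<open>- \<phi>\<close> together.\<close>

lemma simple_step:
  assumes \<phi>: "\<phi> \<in> \<Delta>" "pos \<phi>" "\<phi> \<notin> S"
  obtains \<alpha> where "\<alpha> \<in> S" "\<phi> - \<alpha> \<in> \<Delta>" "pos (\<phi> - \<alpha>)"
    "bracket (E \<alpha>) (E (\<phi> - \<alpha>)) \<noteq> 0" "bracket (E (- \<alpha>)) (E (- (\<phi> - \<alpha>))) \<noteq> 0"
proof -
  have "(of_real (ip \<phi> \<phi>) :: complex) = (\<Sum>\<alpha>\<in>S. of_int (cf \<phi> \<alpha>) * \<alpha> (t \<phi>))"
    using root_t[OF \<phi>(1) \<phi>(1)] root_eq_sum[OF \<phi>(1)] by simp
  also have "\<dots> = (\<Sum>\<alpha>\<in>S. of_real (of_int (cf \<phi> \<alpha>) * ip \<alpha> \<phi>))"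
    by (rule sum.cong) (use S_\<Delta> root_t[OF _ \<phi>(1)] in auto)
  also have "\<dots> = of_real (\<Sum>\<alpha>\<in>S. of_int (cf \<phi> \<alpha>) * ip \<alpha> \<phi>)" by simp
  finally have "ip \<phi> \<phi> = (\<Sum>\<alpha>\<in>S. of_int (cf \<phi> \<alpha>) * ip \<alpha> \<phi>)" by (simp only: of_real_eq_iff)
  then have "\<not> (\<Sum>\<alpha>\<in>S. of_int (cf \<phi> \<alpha>) * ip \<alpha> \<phi>) \<le> 0" using ip_pos[OF \<phi>(1)] by simp
  then have "\<exists>\<alpha>\<in>S. \<not> of_int (cf \<phi> \<alpha>) * ip \<alpha> \<phi> \<le> 0"     using sum_nonpos[of S "\<lambda>\<alpha>. of_int (cf \<phi> \<alpha>) * ip \<alpha> \<phi>"] by blast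
  then obtain \<alpha> where \<alpha>: "\<alpha> \<in> S" and p: "of_int (cf \<phi> \<alpha>) * ip \<alpha> \<phi> > 0" by auto
  have a\<Delta>: "\<alpha> \<in> \<Delta>" using \<alpha> S_\<Delta> by blast
  have c0: "0 \<le> cf \<phi> \<alpha>" using \<phi>(2) \<alpha> by (simp add: pos_def)
  have ipos: "ip \<phi> \<alpha> > 0" "cf \<phi> \<alpha> > 0"
    using p c0 ip_sym[OF \<phi>(1) a\<Delta>] by (auto simp: zero_less_mult_iff)
  have low: "bracket (E (- \<alpha>)) (E \<phi>) \<noteq> 0" by (rule lowering_nonzero[OF \<phi>(1) a\<Delta> ipos(1)])
  have up: "bracket (E \<alpha>) (E (- \<phi>)) \<noteq> 0"
    using lowering_nonzero[OF neg_in_\<Delta>[OF \<phi>(1)] neg_in_\<Delta>[OF a\<Delta>]] ip_minus[OF \<phi>(1) a\<Delta>] ipos(1)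
    by simp
  have ne: "\<phi> \<noteq> \<alpha>" using \<alpha> \<phi>(3) by blast
  have d\<Delta>: "\<phi> - \<alpha> \<in> \<Delta>"
    using bracket_nonzero_root[OF neg_in_\<Delta>[OF a\<Delta>] \<phi>(1) low] ne by simp
  have cfd: "cf (\<phi> - \<alpha>) \<beta> = cf \<phi> \<beta> - (if \<alpha> = \<beta> then 1 else 0)" if "\<beta> \<in> S" for \<beta>
    by (rule cf_eqI[OF d\<Delta> that]) (use \<alpha> that \<phi>(1) in \<open>simp add: root_\<omega> simple_\<omega>\<close>)
  have dpos: "pos (\<phi> - \<alpha>)"
    unfolding pos_def
  proof
    fix \<beta> assume "\<beta> \<in> S"
    then show "0 \<le> cf (\<phi> - \<alpha>) \<beta>"
      using \<phi>(2) ipos(2) cfd[of \<beta>] by (cases "\<alpha> = \<beta>") (simp_all add: pos_def)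
  qed
  have "bracket (E (- \<phi>)) (E \<alpha>) \<noteq> 0" using up bracket_antisym[of "E (- \<phi>)" "E \<alpha>"] by simp
  then have "bracket (E \<alpha>) (E (\<phi> - \<alpha>)) \<noteq> 0"
    by (rule bracket_cyclic[rotated 4]) (simp_all add: a\<Delta> d\<Delta> neg_in_\<Delta> \<phi>(1))
  moreover have "bracket (E \<phi>) (E (- \<alpha>)) \<noteq> 0" using low bracket_antisym[of "E \<phi>" "E (- \<alpha>)"] by simp
  then have "bracket (E (- \<alpha>)) (E (- (\<phi> - \<alpha>))) \<noteq> 0"
    by (rule bracket_cyclic[rotated 4]) (use neg_in_\<Delta>[OF d\<Delta>] in \<open>simp_all add: a\<Delta> neg_in_\<Delta> \<phi>(1)\<close>)
  ultimately show thesis using that \<alpha> d\<Delta> dpos by blast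
qed

text \<open>Induction on height. The nonzero brackets in the step let a property pass from root
  vectors to their brackets.\<close>

lemma pos_root_induct:
  assumes "\<phi> \<in> \<Delta>" "pos \<phi>" and simple: "\<And>\<alpha>. \<alpha> \<in> S \<Longrightarrow> P \<alpha>"
    and step: "\<And>\<mu> \<alpha>. \<mu> \<in> \<Delta> \<Longrightarrow> pos \<mu> \<Longrightarrow> \<alpha> \<in> S \<Longrightarrow> \<alpha> + \<mu> \<in> \<Delta> \<Longrightarrow> pos (\<alpha> + \<mu>) \<Longrightarrow>
      bracket (E \<alpha>) (E \<mu>) \<noteq> 0 \<Longrightarrow> bracket (E (- \<alpha>)) (E (- \<mu>)) \<noteq> 0 \<Longrightarrow> P \<mu> \<Longrightarrow> P (\<alpha> + \<mu>)"
  shows "P \<phi>"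
  using assms(1,2)
proof (induction "nat (ht \<phi>)" arbitrary: \<phi> rule: less_induct)
  case less
  show ?case
  proof (cases "\<phi> \<in> S")
    case True
    then show ?thesis by (rule simple)
  next
    case False
    obtain \<alpha> where \<alpha>: "\<alpha> \<in> S" "\<phi> - \<alpha> \<in> \<Delta>" "pos (\<phi> - \<alpha>)"
      "bracket (E \<alpha>) (E (\<phi> - \<alpha>)) \<noteq> 0" "bracket (E (- \<alpha>)) (E (- (\<phi> - \<alpha>))) \<noteq> 0"
      using simple_step[OF less.prems False] .
    have e: "\<alpha> + (\<phi> - \<alpha>) = \<phi>" by simp
    have "ht \<phi> = ht \<alpha> + ht (\<phi> - \<alpha>)"
      using ht_add[of \<alpha> "\<phi> - \<alpha>"] \<alpha>(1,2) S_\<Delta> less.prems(1) unfolding e by blast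
    then have "nat (ht (\<phi> - \<alpha>)) < nat (ht \<phi>)"
      using ht_simple[OF \<alpha>(1)] ht_pos[OF \<alpha>(2,3)] by simp
    from less.hyps[OF this \<alpha>(2,3)] have "P (\<phi> - \<alpha>)" .
    from step[OF \<alpha>(2,3,1) _ _ \<alpha>(4,5) this] show ?thesis unfolding e using less.prems by blast
  qed
qed

text \<open>Stability under two elements implies stability under their bracket, and the simple root
  vectors with their negatives generate all root vectors.\<close>

lemma stabilizer_UNIV:
  assumes W: "csubspace W" and h: "ad_stable H W"
    and e: "\<And>\<alpha>. \<alpha> \<in> S \<Longrightarrow> ad_stable {E \<alpha>, E (- \<alpha>)} W"
  shows "ad_stable UNIV W"
proof -
  have br: "ad_stable {E (\<mu> + \<rho>)} W"
    if \<mu>: "\<mu> \<in> \<Delta>" "ad_stable {E \<mu>} W" and \<rho>: "\<rho> \<in> \<Delta>" "ad_stable {E \<rho>} W"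
      and s: "\<mu> + \<rho> \<in> \<Delta>" and n: "bracket (E \<mu>) (E \<rho>) \<noteq> 0" for \<mu> \<rho>
    unfolding ad_stable_def
  proof (intro ballI)
    fix x w assume x: "x \<in> {E (\<mu> + \<rho>)}" and w: "w \<in> W"
    obtain c where c: "bracket (E \<mu>) (E \<rho>) = c *\<^sub>C E (\<mu> + \<rho>)" using bracket_E_E_root[OF \<mu>(1) \<rho>(1) s] .
    have c0: "c \<noteq> 0" using n c by auto
    have m: "bracket (E \<mu>) v \<in> W" if "v \<in> W" for v by (rule ad_stableD[OF \<mu>(2) _ that]) simp
    have r: "bracket (E \<rho>) v \<in> W" if "v \<in> W" for v by (rule ad_stableD[OF \<rho>(2) _ that]) simp
    have "bracket (bracket (E \<mu>) (E \<rho>)) w \<in> W"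
      unfolding bracket_bracket_left by (intro complex_lie.subspace_diff[OF W] m r w)
    from complex_lie.subspace_scale[OF W this, of "1 / c"]
    show "bracket x w \<in> W" using x c0 by (simp add: c bracket_scaleC_left scaleC_scaleC scaleC_one)
  qed
  have "ad_stable {E \<phi>} W \<and> ad_stable {E (- \<phi>)} W" if "\<phi> \<in> \<Delta>" "pos \<phi>" for \<phi>
    using that
  proof (rule pos_root_induct)
    fix \<alpha> assume "\<alpha> \<in> S"
    then show "ad_stable {E \<alpha>} W \<and> ad_stable {E (- \<alpha>)} W"
      using e by (simp add: ad_stable_def)
  next
    fix \<mu> \<alpha> assume a: "\<mu> \<in> \<Delta>" "\<alpha> \<in> S" "\<alpha> + \<mu> \<in> \<Delta>" "bracket (E \<alpha>) (E \<mu>) \<noteq> 0"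
      "bracket (E (- \<alpha>)) (E (- \<mu>)) \<noteq> 0" and st: "ad_stable {E \<mu>} W \<and> ad_stable {E (- \<mu>)} W"
    have \<alpha>: "\<alpha> \<in> \<Delta>" "ad_stable {E \<alpha>} W" "ad_stable {E (- \<alpha>)} W"
      using a(2) S_\<Delta> e[OF a(2)] by (auto simp: ad_stable_def)
    have neg: "- \<alpha> + - \<mu> = - (\<alpha> + \<mu>)" by simp
    have "ad_stable {E (\<alpha> + \<mu>)} W"
      by (rule br) (simp_all add: \<alpha> a st)
    moreover have "ad_stable {E (- \<alpha> + - \<mu>)} W"
      by (rule br) (use neg_in_\<Delta>[OF a(3)] neg in \<open>simp_all add: \<alpha> a(1,5) st neg_in_\<Delta>\<close>)
    ultimately show "ad_stable {E (\<alpha> + \<mu>)} W \<and> ad_stable {E (- (\<alpha> + \<mu>))} W"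
      unfolding neg by blast
  qed
  then have E: "ad_stable {E \<phi>} W" if "\<phi> \<in> \<Delta>" for \<phi>
    using pos_or_neg[OF that] neg_in_\<Delta>[OF that] that by (metis add.inverse_inverse)
  show ?thesis
    unfolding ad_stable_def
  proof (intro ballI)
    fix x w assume w: "w \<in> W"
    have "bracket (hpart x + (\<Sum>\<phi>\<in>\<Delta>. coord (E \<phi>) x *\<^sub>C E \<phi>)) w \<in> W"
      unfolding bracket_add_left bracket_sum_left bracket_scaleC_left
      using hpart_in_H ad_stableD[OF h _ w] ad_stableD[OF E _ w]
      by (intro complex_lie.subspace_add[OF W] complex_lie.subspace_sum[OF W] complex_lie.subspace_scale[OF W]) auto
    then show "bracket x w \<in> W" by (simp only: root_decomposition[symmetric])
  qed
qed

section \<open>Singular vectors and the highest root\<close>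

primrec word :: "('a \<Rightarrow> complex) \<Rightarrow> ('a \<Rightarrow> complex) list \<Rightarrow> 'a" where
  "word \<phi> [] = E \<phi>"
| "word \<phi> (\<alpha> # \<alpha>s) = bracket (E (- \<alpha>)) (word \<phi> \<alpha>s)"

lemma word_gws:
  assumes "\<phi> \<in> \<Delta>" "set \<alpha>s \<subseteq> S"
  shows "word \<phi> \<alpha>s \<in> gws H (\<lambda>x. \<phi> x - (\<Sum>\<alpha>\<leftarrow>\<alpha>s. \<alpha> x))"
  using assms(2)
proof (induction \<alpha>s)
  case Nil
  show ?case using E_gws[OF assms(1)] by simp
next
  case (Cons \<alpha> \<alpha>s)
  then have "word \<phi> \<alpha>s \<in> gws H (\<lambda>x. \<phi> x - (\<Sum>\<alpha>\<leftarrow>\<alpha>s. \<alpha> x))" and "\<alpha> \<in> \<Delta>"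
    using S_\<Delta> by auto
  from gws_bracket[OF E_gws[OF neg_in_\<Delta>[OF this(2)]] this(1)]
  have "word \<phi> (\<alpha> # \<alpha>s) \<in> gws H (- \<alpha> + (\<lambda>x. \<phi> x - (\<Sum>\<alpha>\<leftarrow>\<alpha>s. \<alpha> x)))" by simp
  also have "- \<alpha> + (\<lambda>x. \<phi> x - (\<Sum>\<alpha>\<leftarrow>\<alpha>s. \<alpha> x)) = (\<lambda>x. \<phi> x - (\<Sum>\<alpha>\<leftarrow>\<alpha> # \<alpha>s. \<alpha> x))"
    by (rule ext) simp
  finally show ?case .
qed

lemma word_eigen:
  assumes "\<phi> \<in> \<Delta>" "set \<alpha>s \<subseteq> S" "h \<in> H"
  shows "\<exists>c. bracket h (word \<phi> \<alpha>s) = c *\<^sub>C word \<phi> \<alpha>s"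
  using assms(2)
proof (induction \<alpha>s)
  case Nil
  show ?case using bracket_H_E[OF assms(1,3)] by auto
next
  case (Cons \<alpha> \<alpha>s)
  then obtain c where c: "bracket h (word \<phi> \<alpha>s) = c *\<^sub>C word \<phi> \<alpha>s" by auto
  have "- \<alpha> \<in> \<Delta>" using Cons.prems S_\<Delta> neg_in_\<Delta> by auto
  then have "bracket h (word \<phi> (\<alpha> # \<alpha>s)) = ((- \<alpha>) h + c) *\<^sub>C word \<phi> (\<alpha> # \<alpha>s)"
    using bracket_derivation[of h "E (- \<alpha>)" "word \<phi> \<alpha>s"] c
    by (simp add: bracket_H_E assms(3) bracket_scaleC_left bracket_scaleC_right
        complex_lie.scale_left_diff_distrib bracket_minus_left)
  then show ?case by blast
qed

text \<open>The span of the words of lowering operators applied to a singular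
  \<open>E \<phi>\<close> is stable under raising operators too, hence a nonzero ideal, hence
  everything. So each root vector occurs in some word, and its root is \<open>\<phi>\<close> minus a
  sum of simple roots.\<close>

lemma singular_maximal:
  assumes \<phi>: "\<phi> \<in> \<Delta>" and sing: "\<And>\<alpha>. \<alpha> \<in> S \<Longrightarrow> bracket (E \<alpha>) (E \<phi>) = 0"
    and \<mu>: "\<mu> \<in> \<Delta>" and \<alpha>: "\<alpha> \<in> S"
  shows "cf \<mu> \<alpha> \<le> cf \<phi> \<alpha>"
proof -
  let ?X = "{word \<phi> \<alpha>s | \<alpha>s. set \<alpha>s \<subseteq> S}"
  let ?W = "cspan ?X"
  have W: "csubspace ?W" by (rule complex_lie.subspace_span)
  have XW: "word \<phi> \<alpha>s \<in> ?W" if "set \<alpha>s \<subseteq> S" for \<alpha>s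
    by (rule complex_lie.span_base) (use that in blast)
  have h: "ad_stable H ?W"
  proof (rule ad_stable_span)
    fix x b assume x: "x \<in> H" and "b \<in> ?X"
    then obtain \<alpha>s where b: "b = word \<phi> \<alpha>s" "set \<alpha>s \<subseteq> S" by blast
    obtain c where "bracket x b = c *\<^sub>C b" using word_eigen[OF \<phi> b(2) x] b(1) by blast
    then show "bracket x b \<in> ?W" using complex_lie.span_scale[OF XW[OF b(2)]] b(1) by simp
  qed
  have f: "ad_stable {E (- \<beta>)} ?W" if \<beta>: "\<beta> \<in> S" for \<beta>
  proof (rule ad_stable_span)
    fix x b assume x: "x \<in> {E (- \<beta>)}" and "b \<in> ?X"
    then obtain \<alpha>s where b: "b = word \<phi> \<alpha>s" "set \<alpha>s \<subseteq> S" by blast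
    have "bracket x b = word \<phi> (\<beta> # \<alpha>s)" using x b(1) by simp
    then show "bracket x b \<in> ?W" using XW[of "\<beta> # \<alpha>s"] b(2) \<beta> by simp
  qed
  have e: "bracket (E \<beta>) (word \<phi> \<alpha>s) \<in> ?W" if \<beta>: "\<beta> \<in> S" and s: "set \<alpha>s \<subseteq> S" for \<beta> \<alpha>s
    using s
  proof (induction \<alpha>s)
    case Nil
    show ?case by (simp add: sing[OF \<beta>] complex_lie.span_zero)
  next
    case (Cons \<gamma> \<alpha>s)
    have \<gamma>: "\<gamma> \<in> S" and s: "set \<alpha>s \<subseteq> S" using Cons.prems by auto
    have \<beta>\<Delta>: "\<beta> \<in> \<Delta>" and \<gamma>\<Delta>: "\<gamma> \<in> \<Delta>" using \<beta> \<gamma> S_\<Delta> by auto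
    have 1: "bracket (E (- \<gamma>)) (bracket (E \<beta>) (word \<phi> \<alpha>s)) \<in> ?W"
      by (rule ad_stableD[OF f[OF \<gamma>] _ Cons.IH[OF s]]) simp
    have 2: "bracket (bracket (E \<beta>) (E (- \<gamma>))) (word \<phi> \<alpha>s) \<in> ?W"
    proof (cases "\<beta> = \<gamma>")
      case True
      then have "bracket (E \<beta>) (E (- \<gamma>)) \<in> H" using bracket_E_E_opposite[OF \<beta>\<Delta>] by simp
      then show ?thesis by (rule ad_stableD[OF h _ XW[OF s]])
    next
      case False
      \<comment> \<open>A difference of distinct simple roots has coefficients of both
        signs.\<close>
      have "\<beta> + - \<gamma> \<notin> \<Delta>"
      proof
        assume d: "\<beta> + - \<gamma> \<in> \<Delta>"
        have "cf (\<beta> + - \<gamma>) \<beta> = 1" "cf (\<beta> + - \<gamma>) \<gamma> = - 1"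
          using cf_add[OF \<beta>\<Delta> neg_in_\<Delta>[OF \<gamma>\<Delta>] d] \<beta> \<gamma> False by (simp_all add: cf_minus \<gamma>\<Delta> cf_simple)
        then show False using root_coeff_spec(2)[OF d] \<beta> \<gamma> by force
      qed
      moreover have "\<beta> + - \<gamma> \<noteq> 0" using False by simp
      ultimately have "bracket (E \<beta>) (E (- \<gamma>)) = 0"
        by (rule bracket_E_E_not_root[OF \<beta>\<Delta> neg_in_\<Delta>[OF \<gamma>\<Delta>]])
      then show ?thesis by (simp add: complex_lie.span_zero)
    qed
    have "bracket (E \<beta>) (word \<phi> (\<gamma> # \<alpha>s)) = bracket (bracket (E \<beta>) (E (- \<gamma>))) (word \<phi> \<alpha>s)
        + bracket (E (- \<gamma>)) (bracket (E \<beta>) (word \<phi> \<alpha>s))"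
      by (simp add: bracket_derivation[of "E \<beta>"])
    then show ?case using complex_lie.span_add[OF 2 1] by simp
  qed
  have "ad_stable UNIV ?W"
  proof (rule stabilizer_UNIV[OF W h])
    fix \<beta> assume \<beta>: "\<beta> \<in> S"
    have "ad_stable {E \<beta>} ?W"
      by (rule ad_stable_span) (use e[OF \<beta>] in auto)
    with f[OF \<beta>] show "ad_stable {E \<beta>, E (- \<beta>)} ?W" by (simp add: ad_stable_def)
  qed
  then have "lie_ideal ?W UNIV" using W by (simp add: lie_ideal_def ad_stable_def)
  then have "?W = {0} \<or> ?W = UNIV" using simple unfolding lie_simple_def by blast
  moreover have "E \<phi> \<in> ?W" using XW[of "[]"] by simp
  ultimately have WU: "?W = UNIV" using E_nonzero[OF \<phi>] by blast
  have "\<exists>\<alpha>s. set \<alpha>s \<subseteq> S \<and> coord (E \<mu>) (word \<phi> \<alpha>s) \<noteq> 0"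
  proof (rule ccontr)
    assume "\<not> ?thesis"
    then have "?X \<subseteq> {x. coord (E \<mu>) x = 0}" by blast
    moreover have "csubspace {x. coord (E \<mu>) x = 0}"
      by (simp add: complex_lie.subspace_def coord_zero coord_add coord_scale)
    ultimately have "?W \<subseteq> {x. coord (E \<mu>) x = 0}" by (rule complex_lie.span_minimal)
    then have "coord (E \<mu>) (E \<mu>) = 0" unfolding WU by blast
    then show False by (simp add: coord_E_E \<mu>)
  qed
  then obtain \<alpha>s where s: "set \<alpha>s \<subseteq> S" and n: "coord (E \<mu>) (word \<phi> \<alpha>s) \<noteq> 0" by blast
  have "wt (E \<mu>) = (\<lambda>x. \<phi> x - (\<Sum>\<alpha>\<leftarrow>\<alpha>s. \<alpha> x))"
  proof (rule ccontr)
    assume ne: "\<not> ?thesis"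
    have "coord (E \<mu>) (word \<phi> \<alpha>s) = 0"
    proof (rule coord_gws[OF word_gws[OF \<phi> s] _ ne])
      fix x assume x: "x \<notin> H"
      have "\<forall>\<alpha>\<in>set \<alpha>s. \<alpha> x = 0" using s S_\<Delta> \<Delta>_outside x by blast
      then have "(\<Sum>\<alpha>\<leftarrow>\<alpha>s. \<alpha> x) = 0" by (induction \<alpha>s) auto
      then show "\<phi> x - (\<Sum>\<alpha>\<leftarrow>\<alpha>s. \<alpha> x) = 0" using \<Delta>_outside[OF \<phi> x] by simp
    qed
    then show False using n by simp
  qed
  then have "\<mu> (\<omega> \<alpha>) = \<phi> (\<omega> \<alpha>) - (\<Sum>\<beta>\<leftarrow>\<alpha>s. \<beta> (\<omega> \<alpha>))" by (simp add: wt_E[OF \<mu>])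
  \<comment> \<open>The coefficient at \<open>\<alpha>\<close> drops by the number of occurrences of
    \<open>\<alpha>\<close> in the word.\<close>
  moreover have "(\<Sum>\<beta>\<leftarrow>\<alpha>s. \<beta> (\<omega> \<alpha>)) = of_int (int (count_list \<alpha>s \<alpha>))"
    using s by (induction \<alpha>s) (auto simp: simple_\<omega> \<alpha>)
  ultimately have "(of_int (cf \<mu> \<alpha>) :: complex) = of_int (cf \<phi> \<alpha> - int (count_list \<alpha>s \<alpha>))"
    by (simp add: root_\<omega> \<phi> \<mu> \<alpha>)
  then have "cf \<mu> \<alpha> = cf \<phi> \<alpha> - int (count_list \<alpha>s \<alpha>)" by (simp only: of_int_eq_iff)
  then show ?thesis by simp
qed

abbreviation \<psi> :: "'a \<Rightarrow> complex" where
  "\<psi> \<equiv> highest_root H S"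

lemma highest_rootI:
  assumes \<phi>: "\<phi> \<in> \<Delta>" and sing: "\<And>\<alpha>. \<alpha> \<in> S \<Longrightarrow> bracket (E \<alpha>) (E \<phi>) = 0"
  shows "\<psi> = \<phi>"
  unfolding highest_root_def
proof (rule the_equality)
  show "\<phi> \<in> roots H \<and> (\<forall>\<mu>\<in>roots H. \<forall>\<alpha>\<in>S. cf \<mu> \<alpha> \<le> cf \<phi> \<alpha>)"
    using \<phi> singular_maximal[OF \<phi> sing] by (simp add: \<Delta>_eq_roots)
next
  fix \<mu> assume \<mu>: "\<mu> \<in> roots H \<and> (\<forall>\<rho>\<in>roots H. \<forall>\<alpha>\<in>S. cf \<rho> \<alpha> \<le> cf \<mu> \<alpha>)"
  then have "\<mu> \<in> \<Delta>" by (simp add: \<Delta>_eq_roots)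
  then show "\<mu> = \<phi>"
    by (rule root_eqI[OF _ \<phi>])
      (use \<mu> \<phi> singular_maximal[OF \<phi> sing \<open>\<mu> \<in> \<Delta>\<close>] in \<open>force simp: \<Delta>_eq_roots\<close>)
qed

lemma \<Delta>_nonempty: "\<Delta> \<noteq> {}"
proof
  assume "\<Delta> = {}"
  then have "{b\<in>B. wt b = 0} = B" by (auto simp: \<Delta>_def)
  then have "H = UNIV" using H_eq span_B by simp
  then show False using H_neq_UNIV by simp
qed

text \<open>At a root of maximal height, a nonzero bracket with a simple root vector would give a
  root of greater height.\<close>

lemma singular_exists:
  obtains \<phi> where "\<phi> \<in> \<Delta>" "\<And>\<alpha>. \<alpha> \<in> S \<Longrightarrow> bracket (E \<alpha>) (E \<phi>) = 0"
proof -
  have "Max (ht ` \<Delta>) \<in> ht ` \<Delta>" by (rule Max_in) (simp_all add: finite_\<Delta> \<Delta>_nonempty)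
  then obtain \<phi> where \<phi>: "\<phi> \<in> \<Delta>" "Max (ht ` \<Delta>) = ht \<phi>" by blast
  have max: "ht \<mu> \<le> ht \<phi>" if "\<mu> \<in> \<Delta>" for \<mu>
    using Max_ge[of "ht ` \<Delta>" "ht \<mu>"] that finite_\<Delta> \<phi>(2) by simp
  have "bracket (E \<alpha>) (E \<phi>) = 0" if \<alpha>: "\<alpha> \<in> S" for \<alpha>
  proof (rule ccontr)
    assume n: "bracket (E \<alpha>) (E \<phi>) \<noteq> 0"
    have a: "\<alpha> \<in> \<Delta>" using \<alpha> S_\<Delta> by blast
    have "\<alpha> + \<phi> \<noteq> 0"
    proof
      assume "\<alpha> + \<phi> = 0"
      then have "\<phi> = - \<alpha>" by (simp add: add_eq_0_iff)
      then show False using max[OF a] ht_minus[OF a] ht_simple[OF \<alpha>] by simp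
    qed
    then have s: "\<alpha> + \<phi> \<in> \<Delta>" by (rule bracket_nonzero_root[OF a \<phi>(1) n])
    then show False using max[OF s] ht_add[OF a \<phi>(1) s] ht_simple[OF \<alpha>] by simp
  qed
  with \<phi>(1) show thesis by (rule that)
qed

lemma highest_root: "\<psi> \<in> \<Delta>" and highest_root_max: "\<mu> \<in> \<Delta> \<Longrightarrow> \<alpha> \<in> S \<Longrightarrow> cf \<mu> \<alpha> \<le> cf \<psi> \<alpha>"
proof -
  obtain \<phi> where \<phi>: "\<phi> \<in> \<Delta>" "\<And>\<alpha>. \<alpha> \<in> S \<Longrightarrow> bracket (E \<alpha>) (E \<phi>) = 0" using singular_exists by blast
  have "\<psi> = \<phi>" by (rule highest_rootI[OF \<phi>])
  then show "\<psi> \<in> \<Delta>" "\<mu> \<in> \<Delta> \<Longrightarrow> \<alpha> \<in> S \<Longrightarrow> cf \<mu> \<alpha> \<le> cf \<psi> \<alpha>"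
    using \<phi> singular_maximal[OF \<phi>] by simp_all
qed

end

section \<open>Parabolic subalgebras\<close>

context cartan_decomposition
begin

lemma coord_E_span:
  assumes "X \<subseteq> \<Delta>" "x \<in> cspan (E ` X)" "\<phi> \<in> \<Delta>" "\<phi> \<notin> X"
  shows "coord (E \<phi>) x = 0"
proof (rule coord_in_span)
  show "E ` X \<subseteq> B" using assms(1) E_in_B by blast
  show "E \<phi> \<notin> E ` X" using assms E_inj by blast
qed (rule assms)

lemma E_in_span_iff: "X \<subseteq> \<Delta> \<Longrightarrow> \<phi> \<in> \<Delta> \<Longrightarrow> E \<phi> \<in> cspan (E ` X) \<longleftrightarrow> \<phi> \<in> X"
  using coord_E_span[of X "E \<phi>" \<phi>] coord_E_E[of \<phi> \<phi>] by (auto intro: complex_lie.span_base)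

lemma hpart_span_E:
  assumes "X \<subseteq> \<Delta>" "x \<in> cspan (E ` X)"
  shows "hpart x = 0"
proof -
  have "csubspace {x. hpart x = 0}"
    by (simp add: complex_lie.subspace_def hpart_zero hpart_add hpart_scale)
  moreover have "E ` X \<subseteq> {x. hpart x = 0}" using assms(1) hpart_E by blast
  ultimately show ?thesis using assms(2) complex_lie.span_minimal by blast
qed

lemma in_span_EI:
  assumes "hpart x = 0" "\<And>\<phi>. \<phi> \<in> \<Delta> \<Longrightarrow> coord (E \<phi>) x \<noteq> 0 \<Longrightarrow> \<phi> \<in> X"
  shows "x \<in> cspan (E ` X)"
proof -
  have "(\<Sum>\<phi>\<in>\<Delta>. coord (E \<phi>) x *\<^sub>C E \<phi>) \<in> cspan (E ` X)"
  proof (rule complex_lie.span_sum)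
    fix \<phi> assume "\<phi> \<in> \<Delta>"
    then show "coord (E \<phi>) x *\<^sub>C E \<phi> \<in> cspan (E ` X)"
      using assms(2)[of \<phi>] complex_lie.span_zero[of "E ` X"]
      by (cases "coord (E \<phi>) x = 0") (auto intro: complex_lie.span_scale complex_lie.span_base)
  qed
  then show ?thesis using root_decomposition[of x] assms(1) by simp
qed

lemma E_from_bracket:
  assumes W: "csubspace W" and "\<phi> \<in> \<Delta>" "\<mu> \<in> \<Delta>" "\<phi> + \<mu> \<in> \<Delta>"
    and n: "bracket (E \<phi>) (E \<mu>) \<noteq> 0" and w: "bracket (E \<phi>) (E \<mu>) \<in> W"
  shows "E (\<phi> + \<mu>) \<in> W"
proof -
  obtain c where c: "bracket (E \<phi>) (E \<mu>) = c *\<^sub>C E (\<phi> + \<mu>)" using bracket_E_E_root[OF assms(2-4)] .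
  then have "c \<noteq> 0" using n by auto
  with complex_lie.subspace_scale[OF W w, of "1 / c"] show ?thesis by (simp add: c scaleC_scaleC scaleC_one)
qed

lemma bracket_E_E_in:
  assumes W: "csubspace W" and "\<phi> \<in> \<Delta>" "\<mu> \<in> \<Delta>" "\<phi> + \<mu> \<noteq> 0"
    and "\<phi> + \<mu> \<in> \<Delta> \<Longrightarrow> bracket (E \<phi>) (E \<mu>) \<noteq> 0 \<Longrightarrow> E (\<phi> + \<mu>) \<in> W"
  shows "bracket (E \<phi>) (E \<mu>) \<in> W"
proof (cases "\<phi> + \<mu> \<in> \<Delta> \<and> bracket (E \<phi>) (E \<mu>) \<noteq> 0")
  case True
  obtain c where "bracket (E \<phi>) (E \<mu>) = c *\<^sub>C E (\<phi> + \<mu>)"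
    using bracket_E_E_root[OF assms(2,3)] True by blast
  then show ?thesis using complex_lie.subspace_scale[OF W] assms(5) True by simp
next
  case False
  then have "bracket (E \<phi>) (E \<mu>) = 0" using bracket_E_E_not_root[OF assms(2,3)] assms(4) by blast
  then show ?thesis using complex_lie.subspace_0[OF W] by simp
qed

lemma H_stable_span_E:
  assumes "X \<subseteq> \<Delta>"
  shows "ad_stable H (cspan (E ` X))"
proof (rule ad_stable_span)
  fix h b assume h: "h \<in> H" and "b \<in> E ` X"
  then obtain \<phi> where \<phi>: "\<phi> \<in> X" "b = E \<phi>" by blast
  have "bracket h b = \<phi> h *\<^sub>C E \<phi>" using \<phi> assms h bracket_H_E by blast
  then show "bracket h b \<in> cspan (E ` X)"
    using \<phi>(1) by (simp add: complex_lie.span_scale complex_lie.span_base)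
qed

end

locale parabolic = simple_roots H B wt S
  for H :: "'a::complex_lie_algebra set" and B wt S +
  fixes Q M T :: "'a set"
  assumes Q: "standard_parabolic H S Q" and Q_proper: "Q \<noteq> UNIV"
    and M: "levi_factor Q M" and H_M: "H \<subseteq> M" and T: "T = lie_center M"
begin

abbreviation N :: "'a set" where
  "N \<equiv> nilradical Q"

section \<open>The roots of the nilradical and of the Levi factor\<close>

text \<open>Phrased through membership in \<open>Q\<close>, so that closure properties follow
  directly from those of \<open>Q\<close>; the description by coefficients comes later, in
  \<open>\<Delta>N_iff\<close>.\<close>

definition \<Delta>N :: "('a \<Rightarrow> complex) set" where
  "\<Delta>N = {\<phi>\<in>\<Delta>. E (- \<phi>) \<notin> Q}"

definition \<Delta>M :: "('a \<Rightarrow> complex) set" where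
  "\<Delta>M = {\<phi>\<in>\<Delta>. E \<phi> \<in> Q \<and> E (- \<phi>) \<in> Q}"

lemma \<Delta>N_\<Delta>: "\<Delta>N \<subseteq> \<Delta>" and \<Delta>M_\<Delta>: "\<Delta>M \<subseteq> \<Delta>"
  by (auto simp: \<Delta>N_def \<Delta>M_def)

lemma subspace_Q: "csubspace Q"
  and bracket_Q: "x \<in> Q \<Longrightarrow> y \<in> Q \<Longrightarrow> bracket x y \<in> Q"
  and borel_Q: "borel H S \<subseteq> Q"
  using Q by (simp_all add: standard_parabolic_def lie_subalgebra_def)

lemma H_Q: "H \<subseteq> Q"
proof -
  have "H \<subseteq> borel H S" unfolding borel_def by (meson Un_upper1 complex_lie.span_superset order_trans)
  with borel_Q show ?thesis by blast
qed

lemma pos_Q: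
  assumes "\<phi> \<in> \<Delta>" "pos \<phi>"
  shows "E \<phi> \<in> Q"
proof -
  have "E \<phi> \<in> root_space H \<phi>" using assms(1) by (simp add: root_space_def bracket_H_E)
  then have "E \<phi> \<in> borel H S"
    unfolding borel_def positive_roots_eq using assms by (intro complex_lie.span_base) blast
  with borel_Q show ?thesis by blast
qed

lemma stable_Q: "ad_stable H Q"
  using H_Q bracket_Q by (auto simp: ad_stable_def)

lemma Q_span: "Q = cspan (H \<union> E ` {\<phi>\<in>\<Delta>. E \<phi> \<in> Q})"
  using subspace_eq_span[OF subspace_Q stable_Q] H_Q by (simp add: Int_absorb1)

lemma E_sum_in_Q:
  assumes "\<phi> \<in> \<Delta>" "\<mu> \<in> \<Delta>" "\<phi> + \<mu> \<in> \<Delta>" "bracket (E \<phi>) (E \<mu>) \<noteq> 0" "E \<phi> \<in> Q" "E \<mu> \<in> Q"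
  shows "E (\<phi> + \<mu>) \<in> Q"
  by (rule E_from_bracket[OF subspace_Q assms(1-4) bracket_Q[OF assms(5,6)]])

lemma \<Delta>N_pos: "\<phi> \<in> \<Delta>N \<Longrightarrow> pos \<phi>"
  using pos_or_neg[of \<phi>] pos_Q[OF neg_in_\<Delta>, of \<phi>] by (auto simp: \<Delta>N_def)

lemma \<Delta>_cases: "\<phi> \<in> \<Delta> \<Longrightarrow> \<phi> \<in> \<Delta>M \<or> \<phi> \<in> \<Delta>N \<or> - \<phi> \<in> \<Delta>N"
  by (auto simp: \<Delta>M_def \<Delta>N_def neg_in_\<Delta>)

lemma E_Q_iff: "\<phi> \<in> \<Delta> \<Longrightarrow> E \<phi> \<in> Q \<longleftrightarrow> \<phi> \<in> \<Delta>M \<or> \<phi> \<in> \<Delta>N"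
  using pos_Q \<Delta>N_pos by (auto simp: \<Delta>M_def \<Delta>N_def)

lemma \<Delta>M_minus: "\<phi> \<in> \<Delta>M \<Longrightarrow> - \<phi> \<in> \<Delta>M"
  by (simp add: \<Delta>M_def neg_in_\<Delta>)

text \<open>If \<open>E (- (\<mu> + \<phi>))\<close> were in \<open>Q\<close>, bracketing it with
  \<open>E \<mu>\<close> would bring back \<open>E (- \<phi>)\<close>, which is outside
  \<open>Q\<close>; that bracket is nonzero by applying cyclicity twice.\<close>

lemma bracket_Q_N:
  assumes x: "x \<in> Q" and y: "y \<in> cspan (E ` \<Delta>N)"
  shows "bracket x y \<in> cspan (E ` \<Delta>N)"
proof -
  have sub: "csubspace (cspan (E ` \<Delta>N))" by (rule complex_lie.subspace_span)
  have "x \<in> cspan (H \<union> E ` {\<phi>\<in>\<Delta>. E \<phi> \<in> Q})" using x Q_span by simp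
  then show ?thesis
  proof (rule bracket_in_span2[OF _ y _ sub])
    fix a b assume a: "a \<in> H \<union> E ` {\<phi>\<in>\<Delta>. E \<phi> \<in> Q}" and b: "b \<in> E ` \<Delta>N"
    show "bracket a b \<in> cspan (E ` \<Delta>N)"
    proof (cases "a \<in> H")
      case True
      then show ?thesis
        using ad_stableD[OF H_stable_span_E[OF \<Delta>N_\<Delta>]] b complex_lie.span_base by blast
    next
      case False
      then obtain \<mu> where \<mu>: "\<mu> \<in> \<Delta>" "E \<mu> \<in> Q" "a = E \<mu>" using a by blast
      obtain \<phi> where \<phi>: "\<phi> \<in> \<Delta>" "E (- \<phi>) \<notin> Q" "b = E \<phi>" using b by (auto simp: \<Delta>N_def)
      have "\<mu> + \<phi> \<noteq> 0" using \<mu>(2) \<phi>(2) by (metis add_eq_0_iff2)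
      then show ?thesis
        unfolding \<mu>(3) \<phi>(3)
      proof (rule bracket_E_E_in[OF sub \<mu>(1) \<phi>(1)])
        assume s: "\<mu> + \<phi> \<in> \<Delta>" and n: "bracket (E \<mu>) (E \<phi>) \<noteq> 0"
        have "E (- (\<mu> + \<phi>)) \<notin> Q"
        proof
          assume q: "E (- (\<mu> + \<phi>)) \<in> Q"
          have 1: "bracket (E \<phi>) (E (- (\<mu> + \<phi>))) \<noteq> 0"
            by (rule bracket_cyclic[OF \<mu>(1) \<phi>(1) neg_in_\<Delta>[OF s] _ n]) simp
          have 2: "bracket (E (- (\<mu> + \<phi>))) (E \<mu>) \<noteq> 0"
            by (rule bracket_cyclic[OF \<phi>(1) neg_in_\<Delta>[OF s] \<mu>(1) _ 1]) simp
          have e: "- (\<mu> + \<phi>) + \<mu> = - \<phi>" by simp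
          have "E (- (\<mu> + \<phi>) + \<mu>) \<in> Q"
            by (rule E_sum_in_Q[OF neg_in_\<Delta>[OF s] \<mu>(1) _ 2 q \<mu>(2)]) (use neg_in_\<Delta>[OF \<phi>(1)] e in simp)
          then show False using \<phi>(2) e by simp
        qed
        then show "E (\<mu> + \<phi>) \<in> cspan (E ` \<Delta>N)"
          using s by (intro complex_lie.span_base) (simp add: \<Delta>N_def)
      qed
    qed
  qed
qed

text \<open>Roots in \<open>\<Delta>N\<close> are positive, so every bracket raises the height by at
  least 1.\<close>

lemma N_nilpotent: "lie_nilpotent (cspan (E ` \<Delta>N))"
proof -
  let ?N = "cspan (E ` \<Delta>N)"
  have sub: "csubspace (lower_central ?N n)" for n
    by (rule lower_central_subspace) (rule complex_lie.subspace_span)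
  have lc: "lower_central ?N n \<subseteq> cspan (E ` {\<phi>\<in>\<Delta>N. ht \<phi> > int n})" for n
  proof (induction n)
    case 0
    have "{\<phi>\<in>\<Delta>N. ht \<phi> > int 0} = \<Delta>N" using ht_pos \<Delta>N_pos \<Delta>N_\<Delta> by force
    then show ?case by simp
  next
    case (Suc n)
    let ?F = "cspan (E ` {\<phi>\<in>\<Delta>N. ht \<phi> > int (Suc n)})"
    show ?case
      unfolding lower_central.simps lie_prod_def
    proof (rule complex_lie.span_minimal[OF _ complex_lie.subspace_span], clarify)
      fix a b assume a: "a \<in> ?N" and b: "b \<in> lower_central ?N n"
      show "bracket a b \<in> ?F"
      proof (rule bracket_in_span2[OF a subsetD[OF Suc b] _ complex_lie.subspace_span])
        fix x y assume "x \<in> E ` \<Delta>N" and "y \<in> E ` {\<phi>\<in>\<Delta>N. ht \<phi> > int n}"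
        then obtain \<mu> \<phi> where \<mu>: "\<mu> \<in> \<Delta>N" "x = E \<mu>" and \<phi>: "\<phi> \<in> \<Delta>N" "ht \<phi> > int n" "y = E \<phi>"
          by blast
        have d: "\<mu> \<in> \<Delta>" "\<phi> \<in> \<Delta>" using \<mu> \<phi> \<Delta>N_\<Delta> by auto
        have hm: "ht \<mu> \<ge> 1" using ht_pos[OF d(1) \<Delta>N_pos[OF \<mu>(1)]] .
        have "\<mu> + \<phi> \<noteq> 0"
        proof
          assume "\<mu> + \<phi> = 0"
          then have "\<phi> = - \<mu>" by (simp add: add_eq_0_iff)
          then show False using ht_minus[OF d(1)] hm \<phi>(2) by simp
        qed
        then show "bracket x y \<in> ?F"
          unfolding \<mu>(2) \<phi>(3)
        proof (rule bracket_E_E_in[OF complex_lie.subspace_span d])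
          assume s: "\<mu> + \<phi> \<in> \<Delta>" and n: "bracket (E \<mu>) (E \<phi>) \<noteq> 0"
          have "E (\<mu> + \<phi>) \<in> cspan (E ` \<Delta>N)"
          proof (rule E_from_bracket[OF complex_lie.subspace_span d s n])
            show "bracket (E \<mu>) (E \<phi>) \<in> cspan (E ` \<Delta>N)"
              using bracket_Q_N[of "E \<mu>" "E \<phi>"] E_Q_iff[OF d(1)] \<mu>(1) \<phi>(1)
              by (simp add: complex_lie.span_base)
          qed
          then have "\<mu> + \<phi> \<in> \<Delta>N" using E_in_span_iff[OF \<Delta>N_\<Delta> s] by simp
          then show "E (\<mu> + \<phi>) \<in> ?F"
            using ht_add[OF d s] hm \<phi>(2) by (intro complex_lie.span_base) simp
        qed
      qed
    qed
  qed
  \<comment> \<open>A crude bound: the heights are positive, so none exceeds their sum.\<close>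
  define m where "m = nat (\<Sum>\<phi>\<in>\<Delta>N. ht \<phi>)"
  have empty: "{\<phi>\<in>\<Delta>N. ht \<phi> > int m} = {}"
  proof -
    have "ht \<phi> \<le> int m" if \<phi>: "\<phi> \<in> \<Delta>N" for \<phi>
    proof -
      have nn: "0 \<le> ht \<mu>" if "\<mu> \<in> \<Delta>N" for \<mu>
        using ht_pos[OF _ \<Delta>N_pos[OF that]] that \<Delta>N_\<Delta> by force
      have "ht \<phi> \<le> (\<Sum>\<phi>\<in>\<Delta>N. ht \<phi>)"
        by (rule member_le_sum[OF \<phi>]) (use nn finite_subset[OF \<Delta>N_\<Delta> finite_\<Delta>] in auto)
      then show ?thesis by (simp add: m_def)
    qed
    then show ?thesis by force
  qed
  have "lower_central ?N m \<subseteq> {0}"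
    using lc[of m] unfolding empty image_empty complex_lie.span_empty .
  then have "lower_central ?N m = {0}" using complex_lie.subspace_0[OF sub[of m]] by blast
  then show ?thesis unfolding lie_nilpotent_def by blast
qed

text \<open>If \<open>h\<close> in \<open>I \<inter> H\<close> had
  \<open>\<phi> h \<noteq> 0\<close> for a positive root \<open>\<phi>\<close>, then
  \<open>E \<phi>\<close> would lie in \<open>I\<close> and survive in every term of its lower
  central series. So \<open>I \<inter> H = {0}\<close>. This excludes \<open>E \<phi>\<close> in
  \<open>I\<close> with \<open>E (- \<phi>)\<close> in \<open>Q\<close>, whose bracket would be a
  nonzero element of \<open>I \<inter> H\<close>.\<close>

lemma nilpotent_ideal_in_N:
  assumes I: "lie_ideal I Q" "lie_nilpotent I"
  shows "I \<subseteq> cspan (E ` \<Delta>N)"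
proof -
  have sub: "csubspace I" and IQ: "I \<subseteq> Q" and br: "\<And>x y. x \<in> Q \<Longrightarrow> y \<in> I \<Longrightarrow> bracket x y \<in> I"
    using I(1) by (auto simp: lie_ideal_def)
  have st: "ad_stable H I" using br H_Q by (auto simp: ad_stable_def)
  obtain m where m: "lower_central I m = {0}" using I(2) by (auto simp: lie_nilpotent_def)
  have noeig: "\<phi> h = 0" if \<phi>: "\<phi> \<in> \<Delta>" "E \<phi> \<in> I" and h: "h \<in> I" "h \<in> H" for \<phi> h
  proof (rule ccontr)
    assume n: "\<phi> h \<noteq> 0"
    have "E \<phi> \<in> lower_central I n" for n
    proof (induction n)
      case 0
      show ?case using \<phi>(2) by simp
    next
      case (Suc n)
      have "bracket h (E \<phi>) \<in> lower_central I (Suc n)" by (rule lower_central_bracket[OF h(1) Suc])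
      from complex_lie.subspace_scale[OF lower_central_subspace[OF sub] this, of "1 / \<phi> h"] n
      show ?case by (simp add: bracket_H_E \<phi>(1) h(2) scaleC_scaleC scaleC_one)
    qed
    then show False using m E_nonzero[OF \<phi>(1)] by blast
  qed
  have IH: "h = 0" if h: "h \<in> I" "h \<in> H" for h
  proof (rule eq_zero_if_weights_zero[OF h(2)])
    have p: "\<phi> h = 0" if \<phi>: "\<phi> \<in> \<Delta>" "pos \<phi>" for \<phi>
    proof (rule ccontr)
      assume n: "\<phi> h \<noteq> 0"
      have "bracket (E \<phi>) h \<in> I" by (rule br[OF pos_Q[OF \<phi>] h(1)])
      moreover have "bracket (E \<phi>) h = - \<phi> h *\<^sub>C E \<phi>"
        using bracket_antisym[of "E \<phi>" h] by (simp add: bracket_H_E \<phi>(1) h(2))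
      ultimately have "- \<phi> h *\<^sub>C E \<phi> \<in> I" by simp
      from complex_lie.subspace_scale[OF sub this, of "- 1 / \<phi> h"] n
      have "E \<phi> \<in> I" by (simp add: scaleC_scaleC scaleC_one)
      then show False using noeig[OF \<phi>(1) _ h] n by simp
    qed
    fix b assume b: "b \<in> B"
    show "wt b h = 0"
    proof (cases "wt b = 0")
      case False
      then have d: "wt b \<in> \<Delta>" using b by (simp add: \<Delta>_def)
      from pos_or_neg[OF d] show ?thesis using p[OF d] p[OF neg_in_\<Delta>[OF d]] by auto
    qed simp
  qed
  have E: "\<phi> \<in> \<Delta>N" if \<phi>: "\<phi> \<in> \<Delta>" "E \<phi> \<in> I" for \<phi>
  proof (rule ccontr)
    assume "\<phi> \<notin> \<Delta>N"
    then have q: "E (- \<phi>) \<in> Q" using \<phi>(1) by (simp add: \<Delta>N_def)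
    have b: "bracket (E (- \<phi>)) (E \<phi>) = K (E (- \<phi>)) (E \<phi>) *\<^sub>C t (- \<phi>)"
      using bracket_opposite[OF neg_in_\<Delta>[OF \<phi>(1)]] by simp
    have "bracket (E (- \<phi>)) (E \<phi>) \<in> I" by (rule br[OF q \<phi>(2)])
    moreover have "bracket (E (- \<phi>)) (E \<phi>) \<in> H"
      using bracket_E_E_opposite[OF neg_in_\<Delta>[OF \<phi>(1)]] by simp
    ultimately have "bracket (E (- \<phi>)) (E \<phi>) = 0" by (rule IH)
    then show False
      using b t_nonzero[OF neg_in_\<Delta>[OF \<phi>(1)]] K_E_opposite[OF neg_in_\<Delta>[OF \<phi>(1)]] by simp
  qed
  show ?thesis
  proof
    fix x assume x: "x \<in> I"
    have "hpart x = 0" by (rule IH[OF stable_components(1)[OF sub st x] hpart_in_H])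
    then show "x \<in> cspan (E ` \<Delta>N)"
      by (rule in_span_EI) (rule E, assumption, rule stable_components(2)[OF sub st x])
  qed
qed

lemma N_eq: "N = cspan (E ` \<Delta>N)"
proof
  show "N \<subseteq> cspan (E ` \<Delta>N)"
    unfolding nilradical_def
    by (rule complex_lie.span_minimal[OF _ complex_lie.subspace_span]) (use nilpotent_ideal_in_N in blast)
  have "E ` \<Delta>N \<subseteq> Q" using E_Q_iff \<Delta>N_\<Delta> by blast
  then have "cspan (E ` \<Delta>N) \<subseteq> Q" by (rule complex_lie.span_minimal[OF _ subspace_Q])
  then have "lie_ideal (cspan (E ` \<Delta>N)) Q"
    unfolding lie_ideal_def using bracket_Q_N complex_lie.subspace_span by blast
  then show "cspan (E ` \<Delta>N) \<subseteq> N"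
    unfolding nilradical_def using N_nilpotent by (intro complex_lie.span_superset[THEN order_trans[rotated]]) blast
qed

section \<open>The Levi factor and its centre\<close>

lemma levi:
  shows subspace_M: "csubspace M" and bracket_M: "x \<in> M \<Longrightarrow> y \<in> M \<Longrightarrow> bracket x y \<in> M"
    and M_N: "M \<inter> N = {0}" and Q_sum: "Q = {x + y | x y. x \<in> M \<and> y \<in> N}"
  using M by (simp_all add: levi_factor_def lie_subalgebra_def)

lemma M_Q: "M \<subseteq> Q"
proof
  fix x assume "x \<in> M"
  then have "\<exists>x' y. x = x' + y \<and> x' \<in> M \<and> y \<in> N"
    using N_eq complex_lie.span_zero by (intro exI[of _ x] exI[of _ 0]) auto
  then have "x \<in> {x + y | x y. x \<in> M \<and> y \<in> N}" by blast
  then show "x \<in> Q" by (rule Q_sum[THEN equalityD2, THEN subsetD])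
qed

lemma stable_M: "ad_stable H M"
  using H_M bracket_M by (auto simp: ad_stable_def)

text \<open>\<open>M\<close> is a complement of \<open>N\<close> in \<open>Q\<close> containing
  \<open>H\<close>. Being stable under \<open>H\<close>, it contains the root vectors occurring in
  its elements, and a root vector of \<open>Q\<close> outside \<open>N\<close> must occur in its own
  component along \<open>M\<close>.\<close>

lemma E_M_iff:
  assumes \<phi>: "\<phi> \<in> \<Delta>"
  shows "E \<phi> \<in> M \<longleftrightarrow> \<phi> \<in> \<Delta>M"
proof
  assume m: "E \<phi> \<in> M"
  have "\<phi> \<notin> \<Delta>N"
  proof
    assume "\<phi> \<in> \<Delta>N"
    then have "E \<phi> \<in> N" by (simp add: N_eq complex_lie.span_base)
    then show False using m M_N E_nonzero[OF \<phi>] by blast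
  qed
  then show "\<phi> \<in> \<Delta>M" using M_Q m E_Q_iff[OF \<phi>] by blast
next
  assume m: "\<phi> \<in> \<Delta>M"
  then have "E \<phi> \<in> Q" by (simp add: \<Delta>M_def)
  then have "E \<phi> \<in> {x + y | x y. x \<in> M \<and> y \<in> N}" by (rule Q_sum[THEN equalityD1, THEN subsetD])
  then obtain x y where xy: "E \<phi> = x + y" "x \<in> M" "y \<in> N" by blast
  have "\<phi> \<notin> \<Delta>N" using m by (simp add: \<Delta>M_def \<Delta>N_def)
  then have "coord (E \<phi>) y = 0" using coord_E_span[OF \<Delta>N_\<Delta> _ \<phi>] xy(3) by (simp add: N_eq)
  moreover have "coord (E \<phi>) (E \<phi>) = coord (E \<phi>) x + coord (E \<phi>) y" unfolding xy(1) by (rule coord_add)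
  ultimately have "coord (E \<phi>) x \<noteq> 0" by (simp add: coord_E_E \<phi>)
  then show "E \<phi> \<in> M" by (rule stable_components(2)[OF subspace_M stable_M xy(2) \<phi>])
qed

lemma M_eq: "M = cspan (H \<union> E ` \<Delta>M)"
proof -
  have "{\<phi>\<in>\<Delta>. E \<phi> \<in> M} = \<Delta>M" using E_M_iff \<Delta>M_\<Delta> by blast
  then show ?thesis using subspace_eq_span[OF subspace_M stable_M] H_M by (simp add: Int_absorb1)
qed

text \<open>What commutes with \<open>M\<close> commutes with \<open>H\<close>, hence normalizes
  \<open>H\<close> and lies in it; on the root vectors of \<open>M\<close> it then acts by the
  scalars \<open>\<gamma> x\<close>.\<close>

lemma T_eq: "T = {x\<in>H. \<forall>\<gamma>\<in>\<Delta>M. \<gamma> x = 0}"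
proof (intro equalityI subsetI)
  fix x assume "x \<in> T"
  then have x: "\<And>y. y \<in> M \<Longrightarrow> bracket x y = 0" unfolding T lie_center_def by blast
  then have "x \<in> lie_normalizer H"
    unfolding lie_normalizer_def using H_M complex_lie.subspace_0[OF subspace_H] by auto
  then have xH: "x \<in> H" using self_normalizing by simp
  have "\<gamma> x = 0" if \<gamma>: "\<gamma> \<in> \<Delta>M" for \<gamma>
  proof -
    have g: "\<gamma> \<in> \<Delta>" using \<gamma> \<Delta>M_\<Delta> by blast
    have "\<gamma> x *\<^sub>C E \<gamma> = 0" using x[of "E \<gamma>"] E_M_iff[OF g] \<gamma> by (simp add: bracket_H_E g xH)
    then show ?thesis using E_nonzero[OF g] by simp
  qed
  with xH show "x \<in> {x\<in>H. \<forall>\<gamma>\<in>\<Delta>M. \<gamma> x = 0}" by blast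
next
  fix x assume "x \<in> {x\<in>H. \<forall>\<gamma>\<in>\<Delta>M. \<gamma> x = 0}"
  then have xH: "x \<in> H" and g: "\<And>\<gamma>. \<gamma> \<in> \<Delta>M \<Longrightarrow> \<gamma> x = 0" by auto
  have "bracket x y \<in> {0}" if y: "y \<in> M" for y
  proof (rule bracket_in_span[of y "H \<union> E ` \<Delta>M"])
    show "y \<in> cspan (H \<union> E ` \<Delta>M)" using y M_eq by simp
    fix b assume b: "b \<in> H \<union> E ` \<Delta>M"
    show "bracket x b \<in> {0}"
    proof (cases "b \<in> H")
      case True
      then show ?thesis by (simp add: H_abelian xH)
    next
      case False
      then obtain \<gamma> where \<gamma>: "\<gamma> \<in> \<Delta>M" "b = E \<gamma>" using b by blast
      then show ?thesis using g[OF \<gamma>(1)] \<Delta>M_\<Delta> by (auto simp: bracket_H_E xH subset_iff)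
    qed
  qed simp
  then show "x \<in> T" unfolding T lie_center_def using xH H_M by auto
qed

lemma T_H: "T \<subseteq> H"
  using T_eq by blast

lemma subspace_T: "csubspace T"
proof -
  have "\<gamma> \<in> dual_space H" if "\<gamma> \<in> \<Delta>M" for \<gamma> using that \<Delta>M_\<Delta> \<Delta>_dual by blast
  then show ?thesis
    unfolding T_eq complex_lie.subspace_def
    using subspace_H by (auto simp: complex_lie.subspace_def dual_zero dual_add dual_scale)
qed

section \<open>The grading by the simple roots outside the Levi factor\<close>

abbreviation So :: "('a \<Rightarrow> complex) set" where
  "So \<equiv> simple_roots_outside H S M"

lemma So_eq: "So = {\<alpha>\<in>S. \<alpha> \<notin> \<Delta>M}"
proof -
  have "root_space H \<alpha> \<inter> M = {0} \<longleftrightarrow> \<alpha> \<notin> \<Delta>M" if \<alpha>: "\<alpha> \<in> S" for \<alpha>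
  proof -
    have d: "\<alpha> \<in> \<Delta>" using \<alpha> S_\<Delta> by blast
    show ?thesis
    proof
      assume 0: "root_space H \<alpha> \<inter> M = {0}"
      have "E \<alpha> \<in> root_space H \<alpha>" using d by (simp add: root_space_def bracket_H_E)
      then show "\<alpha> \<notin> \<Delta>M" using 0 E_nonzero[OF d] E_M_iff[OF d] by blast
    next
      assume n: "\<alpha> \<notin> \<Delta>M"
      show "root_space H \<alpha> \<inter> M = {0}"
      proof (intro equalityI subsetI)
        fix x assume x: "x \<in> root_space H \<alpha> \<inter> M"
        then obtain c where c: "x = c *\<^sub>C E \<alpha>" by (auto simp: root_space_eq[OF d] complex_lie.span_singleton)
        have "c = 0"
        proof (rule ccontr)
          assume "c \<noteq> 0"
          then have "coord (E \<alpha>) x \<noteq> 0" by (simp add: c coord_scale coord_E_E d)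
          then have "E \<alpha> \<in> M" using stable_components(2)[OF subspace_M stable_M _ d] x by blast
          then show False using n E_M_iff[OF d] by blast
        qed
        then show "x \<in> {0}" by (simp add: c)
      next
        fix x :: 'a assume "x \<in> {0}"
        then show "x \<in> root_space H \<alpha> \<inter> M"
          using complex_lie.subspace_0[OF subspace_M] by (simp add: root_space_def)
      qed
    qed
  qed
  then show ?thesis unfolding simple_roots_outside_def by (intro Collect_cong conj_cong refl)
qed

lemma So_S: "So \<subseteq> S" and So_\<Delta>: "So \<subseteq> \<Delta>" and finite_So: "finite So"
  using So_eq S_\<Delta> finite_S by auto

text \<open>Along a step from \<open>\<mu>\<close> to \<open>\<alpha> + \<mu>\<close>, cyclicity
  shows that \<open>E (- (\<alpha> + \<mu>))\<close> is in \<open>Q\<close> exactly when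
  \<open>E (- \<alpha>)\<close> and \<open>E (- \<mu>)\<close> are. On the other side the
  coefficients at \<open>So\<close> are nonnegative and cannot cancel.\<close>

lemma \<Delta>M_support:
  assumes "\<phi> \<in> \<Delta>" "pos \<phi>"
  shows "\<phi> \<in> \<Delta>M \<longleftrightarrow> (\<forall>\<alpha>\<in>So. cf \<phi> \<alpha> = 0)"
  using assms
proof (rule pos_root_induct)
  fix \<alpha> assume "\<alpha> \<in> S"
  then show "\<alpha> \<in> \<Delta>M \<longleftrightarrow> (\<forall>\<beta>\<in>So. cf \<alpha> \<beta> = 0)" by (auto simp: So_eq cf_simple)
next
  fix \<mu> \<alpha> assume \<mu>: "\<mu> \<in> \<Delta>" "pos \<mu>" and \<alpha>: "\<alpha> \<in> S" and s: "\<alpha> + \<mu> \<in> \<Delta>" "pos (\<alpha> + \<mu>)"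
    and n: "bracket (E \<alpha>) (E \<mu>) \<noteq> 0" and n': "bracket (E (- \<alpha>)) (E (- \<mu>)) \<noteq> 0"
    and IH: "\<mu> \<in> \<Delta>M \<longleftrightarrow> (\<forall>\<beta>\<in>So. cf \<mu> \<beta> = 0)"
  have a: "\<alpha> \<in> \<Delta>" using \<alpha> S_\<Delta> by blast
  have q: "E \<alpha> \<in> Q" "E \<mu> \<in> Q" "E (\<alpha> + \<mu>) \<in> Q" using pos_Q a \<mu> s simple_pos[OF \<alpha>] by blast+
  have mem: "\<rho> \<in> \<Delta>M \<longleftrightarrow> E (- \<rho>) \<in> Q" if "\<rho> \<in> {\<alpha>, \<mu>, \<alpha> + \<mu>}" for \<rho>
    using that a \<mu> s q by (auto simp: \<Delta>M_def)
  have neg: "- \<alpha> + - \<mu> = - (\<alpha> + \<mu>)" by simp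
  have "E (- (\<alpha> + \<mu>)) \<in> Q \<longleftrightarrow> E (- \<alpha>) \<in> Q \<and> E (- \<mu>) \<in> Q"
  proof
    assume "E (- \<alpha>) \<in> Q \<and> E (- \<mu>) \<in> Q"
    then have "E (- \<alpha> + - \<mu>) \<in> Q"
      by (intro E_sum_in_Q n' neg_in_\<Delta> a \<mu>(1)) (simp_all only: neg neg_in_\<Delta> s simp_thms)
    then show "E (- (\<alpha> + \<mu>)) \<in> Q" by (simp only: neg)
  next
    assume e: "E (- (\<alpha> + \<mu>)) \<in> Q"
    have 1: "bracket (E \<mu>) (E (- (\<alpha> + \<mu>))) \<noteq> 0"
      by (rule bracket_cyclic[OF a \<mu>(1) neg_in_\<Delta>[OF s(1)] _ n]) simp
    have 2: "bracket (E (- (\<alpha> + \<mu>))) (E \<alpha>) \<noteq> 0"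
      by (rule bracket_cyclic[OF \<mu>(1) neg_in_\<Delta>[OF s(1)] a _ 1]) simp
    have e1: "\<mu> + - (\<alpha> + \<mu>) = - \<alpha>" and e2: "- (\<alpha> + \<mu>) + \<alpha> = - \<mu>" by simp_all
    have "E (\<mu> + - (\<alpha> + \<mu>)) \<in> Q"
      by (rule E_sum_in_Q[OF \<mu>(1) neg_in_\<Delta>[OF s(1)] _ 1 q(2) e]) (simp only: e1 neg_in_\<Delta>[OF a])
    moreover have "E (- (\<alpha> + \<mu>) + \<alpha>) \<in> Q"
      by (rule E_sum_in_Q[OF neg_in_\<Delta>[OF s(1)] a _ 2 e q(1)]) (simp only: e2 neg_in_\<Delta>[OF \<mu>(1)])
    ultimately show "E (- \<alpha>) \<in> Q \<and> E (- \<mu>) \<in> Q" by (simp only: e1 e2 simp_thms)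
  qed
  then have "\<alpha> + \<mu> \<in> \<Delta>M \<longleftrightarrow> \<alpha> \<in> \<Delta>M \<and> \<mu> \<in> \<Delta>M" by (simp add: mem)
  also have "\<dots> \<longleftrightarrow> (\<forall>\<beta>\<in>So. cf (\<alpha> + \<mu>) \<beta> = 0)"
  proof -
    have c: "cf (\<alpha> + \<mu>) \<beta> = (if \<alpha> = \<beta> then 1 else 0) + cf \<mu> \<beta>" "0 \<le> cf \<mu> \<beta>" if "\<beta> \<in> So" for \<beta>
      using that So_S \<mu> \<alpha> cf_add[OF a \<mu>(1) s(1)] by (auto simp: cf_simple pos_def)
    have "\<alpha> \<in> \<Delta>M \<longleftrightarrow> \<alpha> \<notin> So" using \<alpha> by (simp add: So_eq)
    moreover have "(\<forall>\<beta>\<in>So. cf (\<alpha> + \<mu>) \<beta> = 0) \<longleftrightarrow> \<alpha> \<notin> So \<and> (\<forall>\<beta>\<in>So. cf \<mu> \<beta> = 0)"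
    proof (intro iffI conjI ballI notI)
      fix \<beta> assume h: "\<forall>\<beta>\<in>So. cf (\<alpha> + \<mu>) \<beta> = 0" and "\<beta> \<in> So"
      then show "cf \<mu> \<beta> = 0" using c[of \<beta>] h[rule_format, of \<beta>] by (cases "\<alpha> = \<beta>") auto
    next
      assume h: "\<forall>\<beta>\<in>So. cf (\<alpha> + \<mu>) \<beta> = 0" and "\<alpha> \<in> So"
      then show False using c[of \<alpha>] h[rule_format, of \<alpha>] by auto
    next
      fix \<beta> assume h: "\<alpha> \<notin> So \<and> (\<forall>\<beta>\<in>So. cf \<mu> \<beta> = 0)" and "\<beta> \<in> So"
      then show "cf (\<alpha> + \<mu>) \<beta> = 0" using c[of \<beta>] by auto
    qed
    ultimately show ?thesis using IH by blast
  qed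
  finally show "\<alpha> + \<mu> \<in> \<Delta>M \<longleftrightarrow> (\<forall>\<beta>\<in>So. cf (\<alpha> + \<mu>) \<beta> = 0)" .
qed

text \<open>The order \<open>o\<close> at the level of roots of the whole algebra. It depends only
  on the restriction to \<open>T\<close>, and \<open>t_order_eq\<close> identifies it with
  \<open>t_order\<close>.\<close>

definition ord :: "('a \<Rightarrow> complex) \<Rightarrow> int" where
  "ord \<phi> = (\<Sum>\<alpha>\<in>So. cf \<phi> \<alpha>)"

lemma ord_add: "\<phi> \<in> \<Delta> \<Longrightarrow> \<mu> \<in> \<Delta> \<Longrightarrow> \<phi> + \<mu> \<in> \<Delta> \<Longrightarrow> ord (\<phi> + \<mu>) = ord \<phi> + ord \<mu>"
  unfolding ord_def sum.distrib[symmetric] by (rule sum.cong) (use So_S cf_add in auto)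

lemma ord_minus: "\<phi> \<in> \<Delta> \<Longrightarrow> ord (- \<phi>) = - ord \<phi>"
  unfolding ord_def sum_negf[symmetric] by (rule sum.cong) (use So_S cf_minus in auto)

lemma ord_simple: "\<alpha> \<in> So \<Longrightarrow> ord \<alpha> = 1"
proof -
  assume a: "\<alpha> \<in> So"
  have "ord \<alpha> = (\<Sum>\<beta>\<in>So. if \<alpha> = \<beta> then 1 else 0)"
    unfolding ord_def by (rule sum.cong) (simp_all add: cf_simple subsetD[OF So_S] a)
  then show ?thesis using a finite_So by simp
qed

lemma ord_pos_nonneg: "pos \<phi> \<Longrightarrow> 0 \<le> ord \<phi>"
  unfolding ord_def by (rule sum_nonneg) (use So_S in \<open>auto simp: pos_def\<close>)

lemma \<Delta>M_coeff: "\<phi> \<in> \<Delta>M \<Longrightarrow> \<alpha> \<in> So \<Longrightarrow> cf \<phi> \<alpha> = 0"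
proof -
  assume \<phi>: "\<phi> \<in> \<Delta>M" and \<alpha>: "\<alpha> \<in> So"
  have d: "\<phi> \<in> \<Delta>" using \<phi> \<Delta>M_\<Delta> by blast
  show ?thesis
  proof (cases "pos \<phi>")
    case True
    then show ?thesis using \<Delta>M_support[OF d] \<phi> \<alpha> by blast
  next
    case False
    then have "pos (- \<phi>)" using pos_or_neg[OF d] by blast
    then have "cf (- \<phi>) \<alpha> = 0" using \<Delta>M_support[OF neg_in_\<Delta>[OF d]] \<Delta>M_minus[OF \<phi>] \<alpha> by blast
    then show ?thesis using cf_minus[OF d] \<alpha> So_S by auto
  qed
qed

lemma ord_\<Delta>M: "\<phi> \<in> \<Delta>M \<Longrightarrow> ord \<phi> = 0"
  by (simp add: ord_def \<Delta>M_coeff)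

text \<open>A positive root outside \<open>\<Delta>M\<close> has a positive coefficient at
  \<open>So\<close>, and the negative of a positive root has order at most 0.\<close>

lemma \<Delta>N_iff:
  assumes \<phi>: "\<phi> \<in> \<Delta>"
  shows "\<phi> \<in> \<Delta>N \<longleftrightarrow> ord \<phi> \<ge> 1"
proof
  assume n: "\<phi> \<in> \<Delta>N"
  have p: "pos \<phi>" by (rule \<Delta>N_pos[OF n])
  have "\<phi> \<notin> \<Delta>M" using n by (simp add: \<Delta>M_def \<Delta>N_def)
  then obtain \<alpha> where \<alpha>: "\<alpha> \<in> So" "cf \<phi> \<alpha> \<noteq> 0" using \<Delta>M_support[OF \<phi> p] by blast
  have nn: "0 \<le> cf \<phi> \<beta>" if "\<beta> \<in> So" for \<beta> using that p So_S by (auto simp: pos_def)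
  have "0 < ord \<phi>"
    unfolding ord_def by (rule sum_pos2[OF finite_So \<alpha>(1)]) (use nn nn[OF \<alpha>(1)] \<alpha>(2) in auto)
  then show "ord \<phi> \<ge> 1" by simp
next
  assume o: "ord \<phi> \<ge> 1"
  have "\<not> pos (- \<phi>)" using ord_pos_nonneg[of "- \<phi>"] ord_minus[OF \<phi>] o by auto
  then have "pos \<phi>" using pos_or_neg[OF \<phi>] by blast
  then have "E \<phi> \<in> Q" by (rule pos_Q[OF \<phi>])
  moreover have "\<phi> \<notin> \<Delta>M" using o ord_\<Delta>M by force
  ultimately show "\<phi> \<in> \<Delta>N" using E_Q_iff[OF \<phi>] by blast
qed

lemma \<Delta>M_iff:
  assumes \<phi>: "\<phi> \<in> \<Delta>"
  shows "\<phi> \<in> \<Delta>M \<longleftrightarrow> ord \<phi> = 0"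
proof
  assume o: "ord \<phi> = 0"
  have "\<phi> \<notin> \<Delta>N" "- \<phi> \<notin> \<Delta>N"
    using \<Delta>N_iff[OF \<phi>] \<Delta>N_iff[OF neg_in_\<Delta>[OF \<phi>]] ord_minus[OF \<phi>] o by auto
  then show "\<phi> \<in> \<Delta>M" using \<Delta>_cases[OF \<phi>] by blast
qed (rule ord_\<Delta>M)

section \<open>Restriction to the centre of the Levi factor\<close>

text \<open>Roots of \<open>M\<close> vanish at these coweights. Hence coefficients at
  \<open>So\<close> can be read off on \<open>T\<close>, which makes \<open>n_j\<close> independent
  of the chosen root.\<close>

lemma \<omega>_T: "\<alpha> \<in> So \<Longrightarrow> \<omega> \<alpha> \<in> T"
proof -
  assume a: "\<alpha> \<in> So"
  have aS: "\<alpha> \<in> S" using a So_S by blast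
  have "\<gamma> (\<omega> \<alpha>) = 0" if g: "\<gamma> \<in> \<Delta>M" for \<gamma>
  proof -
    have "\<gamma> \<in> \<Delta>" using g \<Delta>M_\<Delta> by blast
    from root_\<omega>[OF this aS] show ?thesis using \<Delta>M_coeff[OF g a] by simp
  qed
  then show ?thesis using \<omega>_in_H[OF aS] by (simp add: T_eq)
qed

lemma root_on_T:
  assumes "\<phi> \<in> \<Delta>" "x \<in> T"
  shows "\<phi> x = (\<Sum>\<alpha>\<in>So. of_int (cf \<phi> \<alpha>) * \<alpha> x)"
proof -
  have "(\<Sum>\<alpha>\<in>S. of_int (cf \<phi> \<alpha>) * \<alpha> x) = (\<Sum>\<alpha>\<in>So. of_int (cf \<phi> \<alpha>) * \<alpha> x)"
    by (rule sum.mono_neutral_right[OF finite_S So_S]) (use assms(2) in \<open>auto simp: So_eq T_eq\<close>)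
  then show ?thesis using root_eq_sum[OF assms(1)] by simp
qed

abbreviation rT :: "('a \<Rightarrow> complex) \<Rightarrow> 'a \<Rightarrow> complex" where
  "rT \<equiv> restrict_functional T"

lemma rT_apply: "x \<in> T \<Longrightarrow> rT \<phi> x = \<phi> x"
  by (simp add: restrict_functional_def)

lemma rT_eq_iff:
  assumes "\<phi> \<in> \<Delta>" "\<mu> \<in> \<Delta>"
  shows "rT \<phi> = rT \<mu> \<longleftrightarrow> (\<forall>\<alpha>\<in>So. cf \<phi> \<alpha> = cf \<mu> \<alpha>)"
proof
  assume e: "rT \<phi> = rT \<mu>"
  show "\<forall>\<alpha>\<in>So. cf \<phi> \<alpha> = cf \<mu> \<alpha>"
  proof
    fix \<alpha> assume a: "\<alpha> \<in> So"
    then have aS: "\<alpha> \<in> S" using So_S by blast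
    have "\<phi> (\<omega> \<alpha>) = \<mu> (\<omega> \<alpha>)" using fun_cong[OF e, of "\<omega> \<alpha>"] \<omega>_T[OF a] by (simp add: rT_apply)
    then show "cf \<phi> \<alpha> = cf \<mu> \<alpha>" using root_\<omega>[OF assms(1) aS] root_\<omega>[OF assms(2) aS] by simp
  qed
next
  assume "\<forall>\<alpha>\<in>So. cf \<phi> \<alpha> = cf \<mu> \<alpha>"
  then have "\<phi> x = \<mu> x" if "x \<in> T" for x using root_on_T[OF assms(1) that] root_on_T[OF assms(2) that] by simp
  then show "rT \<phi> = rT \<mu>" by (auto simp: restrict_functional_def)
qed

lemma ord_cong: "\<phi> \<in> \<Delta> \<Longrightarrow> \<mu> \<in> \<Delta> \<Longrightarrow> rT \<phi> = rT \<mu> \<Longrightarrow> ord \<phi> = ord \<mu>"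
  unfolding ord_def by (rule sum.cong) (simp_all add: rT_eq_iff)

lemma rT_nonzero:
  assumes "\<phi> \<in> \<Delta>" "ord \<phi> \<noteq> 0"
  obtains x where "x \<in> T" "\<phi> x \<noteq> 0"
proof -
  obtain \<alpha> where a: "\<alpha> \<in> So" "cf \<phi> \<alpha> \<noteq> 0"
    using assms(2) unfolding ord_def by (meson sum.neutral)
  then have "\<phi> (\<omega> \<alpha>) \<noteq> 0" using root_\<omega>[OF assms(1)] So_S by auto
  with \<omega>_T[OF a(1)] show thesis by (rule that)
qed

lemma rT_add: "rT (\<phi> + \<mu>) = rT \<phi> + rT \<mu>"
  by (auto simp: restrict_functional_def)

lemma rT_\<Delta>M: "\<gamma> \<in> \<Delta>M \<Longrightarrow> rT \<gamma> = 0"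
  by (auto simp: restrict_functional_def T_eq)

section \<open>Irreducibility of the fibers and raising the order\<close>

definition fiber :: "('a \<Rightarrow> complex) \<Rightarrow> ('a \<Rightarrow> complex) set" where
  "fiber \<phi> = {\<mu>\<in>\<Delta>. rT \<mu> = rT \<phi>}"

lemma fiber_\<Delta>: "fiber \<phi> \<subseteq> \<Delta>"
  by (auto simp: fiber_def)

text \<open>
  Kostant's argument: if the fiber split into a part \<open>A\<close> spanning a submodule and its complement
  \<open>C\<close>, the sums of the vectors \<open>t \<mu>\<close> over \<open>A\<close> and over \<open>C\<close> would have positive inner product,
  because the former lies in \<open>T\<close>, where all roots of the fiber agree. So two roots from \<open>A\<close> and
  \<open>C\<close> have positive inner product and differ by a root of \<open>M\<close>.
\<close>

lemma fiber_irreducible: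
  assumes \<phi>: "\<phi> \<in> \<Delta>" "ord \<phi> \<noteq> 0" and A: "A \<subseteq> fiber \<phi>" "A \<noteq> {}"
    and closed: "\<And>\<mu> \<gamma>. \<mu> \<in> A \<Longrightarrow> \<gamma> \<in> \<Delta>M \<Longrightarrow> bracket (E \<gamma>) (E \<mu>) \<in> cspan (E ` A)"
  shows "A = fiber \<phi>"
proof (rule ccontr)
  assume "A \<noteq> fiber \<phi>"
  define C where "C = fiber \<phi> - A"
  have C: "C \<noteq> {}" "C \<subseteq> fiber \<phi>" using A \<open>A \<noteq> fiber \<phi>\<close> by (auto simp: C_def)
  have A\<Delta>: "A \<subseteq> \<Delta>" and C\<Delta>: "C \<subseteq> \<Delta>" using A C fiber_\<Delta> by blast+
  have fin: "finite A" "finite C" using A\<Delta> C\<Delta> finite_\<Delta> finite_subset by blast+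
  define x where "x = (\<Sum>\<mu>\<in>A. t \<mu>)"
  define y where "y = (\<Sum>\<mu>\<in>C. t \<mu>)"
  have xH: "x \<in> H" unfolding x_def by (rule sum_t_norm(1)[OF A\<Delta>])
  have Kx: "K x z = (\<Sum>\<mu>\<in>A. \<mu> z)" if "z \<in> H" for z
    unfolding x_def K_sum_left by (rule sum.cong) (use A\<Delta> K_t that in auto)
  have Ky: "K y z = (\<Sum>\<mu>\<in>C. \<mu> z)" if "z \<in> H" for z
    unfolding y_def K_sum_left by (rule sum.cong) (use C\<Delta> K_t that in auto)
  have xT: "x \<in> T"
    unfolding T_eq
  proof (intro CollectI conjI ballI xH)
    fix \<gamma> assume g: "\<gamma> \<in> \<Delta>M"
    then have gd: "\<gamma> \<in> \<Delta>" using \<Delta>M_\<Delta> by blast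
    have "\<gamma> x = K (t \<gamma>) x" by (simp add: K_t gd xH)
    also have "\<dots> = K x (t \<gamma>)" by (rule K_sym)
    also have "\<dots> = (\<Sum>\<mu>\<in>A. \<mu> (t \<gamma>))" by (rule Kx[OF t_in_H[OF gd]])
    also have "\<dots> = 0"
      by (rule sum_roots_orthogonal[OF A\<Delta> gd]) (simp_all add: closed g \<Delta>M_minus)
    finally show "\<gamma> x = 0" .
  qed
  have onT: "\<mu> z = \<phi> z" if "\<mu> \<in> fiber \<phi>" "z \<in> T" for \<mu> z
    using that rT_apply[OF that(2)] by (metis (mono_tags, lifting) fiber_def mem_Collect_eq)
  have KxT: "K x z = of_nat (card A) * \<phi> z" if "z \<in> T" for z
  proof -
    have "K x z = (\<Sum>\<mu>\<in>A. \<phi> z)" unfolding Kx[OF subsetD[OF T_H that]]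
      by (rule sum.cong) (use onT that A in auto)
    then show ?thesis by simp
  qed
  have Kyx: "K y x = of_nat (card C) * \<phi> x"
  proof -
    have "K y x = (\<Sum>\<mu>\<in>C. \<phi> x)" unfolding Ky[OF xH]
      by (rule sum.cong) (use onT xT C in auto)
    then show ?thesis by simp
  qed
  \<comment> \<open>On \<open>T\<close>, \<open>K x\<close> is a nonzero multiple of
    \<open>\<phi>\<close>, which does not vanish there because its order is not 0.\<close>
  have "x \<noteq> 0"
  proof
    assume "x = 0"
    obtain z where z: "z \<in> T" "\<phi> z \<noteq> 0" using rT_nonzero[OF \<phi>] .
    have "card A \<noteq> 0" using fin A by simp
    then show False using KxT[OF z(1)] z(2) \<open>x = 0\<close> by (simp add: K_zero_left)
  qed
  then have "0 < Re (K x x)" using sum_t_norm(3)[OF A\<Delta>] by (simp add: x_def)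
  then have "0 < Re (\<phi> x)" using KxT[OF xT] by (simp add: zero_less_mult_iff)
  moreover have "card C > 0" using C(1) fin by (simp add: card_gt_0_iff)
  ultimately have "0 < Re (K y x)" by (simp add: Kyx)
  moreover have "K y x = (\<Sum>\<mu>\<in>C. \<Sum>\<rho>\<in>A. \<mu> (t \<rho>))"
    unfolding Ky[OF xH]
  proof (rule sum.cong)
    fix \<mu> assume "\<mu> \<in> C"
    then have "\<mu> \<in> dual_space H" using C\<Delta> \<Delta>_dual by blast
    then show "\<mu> x = (\<Sum>\<rho>\<in>A. \<mu> (t \<rho>))"
      unfolding x_def by (rule dual_sum) (use A\<Delta> t_in_H in blast)
  qed simp
  ultimately have "0 < (\<Sum>\<mu>\<in>C. \<Sum>\<rho>\<in>A. ip \<mu> \<rho>)" by (simp add: ip_def)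
  then have "\<not> (\<forall>\<mu>\<in>C. \<forall>\<rho>\<in>A. ip \<mu> \<rho> \<le> 0)"
    using sum_nonpos[of C "\<lambda>\<mu>. \<Sum>\<rho>\<in>A. ip \<mu> \<rho>"] sum_nonpos[of A "ip _"] by (meson leD)
  then obtain \<mu> \<rho> where \<mu>: "\<mu> \<in> C" and \<rho>: "\<rho> \<in> A" and "ip \<mu> \<rho> > 0" by force
  have d: "\<mu> \<in> \<Delta>" "\<rho> \<in> \<Delta>" using \<mu> \<rho> A\<Delta> C\<Delta> by blast+
  have "ip \<rho> \<mu> > 0" using \<open>ip \<mu> \<rho> > 0\<close> ip_sym[OF d] by simp
  then have n: "bracket (E (- \<mu>)) (E \<rho>) \<noteq> 0" by (rule lowering_nonzero[OF d(2,1)])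
  have ne: "\<rho> \<noteq> \<mu>" using \<mu> \<rho> by (auto simp: C_def)
  \<comment> \<open>This difference has order 0, so it is a root of \<open>M\<close>. By cyclicity
    \<open>E (- ?\<gamma>)\<close> carries \<open>E \<rho>\<close> to a nonzero multiple of
    \<open>E \<mu>\<close>, against the closedness of \<open>A\<close>.\<close>
  let ?\<gamma> = "- \<mu> + \<rho>"
  have g\<Delta>: "?\<gamma> \<in> \<Delta>"
    by (rule bracket_nonzero_root[OF neg_in_\<Delta>[OF d(1)] d(2) n]) (use ne in simp)
  have "rT \<mu> = rT \<rho>"
    using subsetD[OF C(2) \<mu>] subsetD[OF A(1) \<rho>] by (simp add: fiber_def)
  then have "ord ?\<gamma> = 0"
    using ord_add[OF neg_in_\<Delta>[OF d(1)] d(2) g\<Delta>] ord_minus[OF d(1)] ord_cong[OF d] by simp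
  then have gM: "- ?\<gamma> \<in> \<Delta>M" using \<Delta>M_iff[OF g\<Delta>] \<Delta>M_minus by blast
  have "bracket (E \<rho>) (E (- ?\<gamma>)) \<noteq> 0"
    by (rule bracket_cyclic[OF neg_in_\<Delta>[OF d(1)] d(2) neg_in_\<Delta>[OF g\<Delta>] _ n]) simp
  then have n2: "bracket (E (- ?\<gamma>)) (E \<rho>) \<noteq> 0" using bracket_antisym[of "E \<rho>" "E (- ?\<gamma>)"] by simp
  have e: "- ?\<gamma> + \<rho> = \<mu>" by simp
  have "E (- ?\<gamma> + \<rho>) \<in> cspan (E ` A)"
    by (rule E_from_bracket[OF complex_lie.subspace_span neg_in_\<Delta>[OF g\<Delta>] d(2) _ n2 closed[OF \<rho> gM]])
      (simp only: e d)
  then have "\<mu> \<in> A" using E_in_span_iff[OF A\<Delta> d(1)] by (simp only: e)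
  then show False using \<mu> by (simp add: C_def)
qed

text \<open>The form in which irreducibility is used: the roots of the fiber whose vectors lie in
  \<open>W\<close> form a closed set, so one vector brings all the others.\<close>

lemma submodule_contains_fiber:
  assumes W: "csubspace W" "ad_stable M W" and \<phi>: "\<phi> \<in> \<Delta>" "ord \<phi> \<noteq> 0" "E \<phi> \<in> W"
    and \<mu>: "\<mu> \<in> \<Delta>" "rT \<mu> = rT \<phi>"
  shows "E \<mu> \<in> W"
proof -
  let ?A = "{\<mu>\<in>fiber \<phi>. E \<mu> \<in> W}"
  have "?A = fiber \<phi>"
  proof (rule fiber_irreducible[OF \<phi>(1,2)])
    show "?A \<noteq> {}" using \<phi> by (auto simp: fiber_def)
    fix \<rho> \<gamma> assume r: "\<rho> \<in> ?A" and g: "\<gamma> \<in> \<Delta>M"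
    have d: "\<gamma> \<in> \<Delta>" "\<rho> \<in> \<Delta>" using r g fiber_\<Delta> \<Delta>M_\<Delta> by blast+
    have or: "ord \<rho> \<noteq> 0" using r \<phi>(2) ord_cong[OF d(2) \<phi>(1)] by (simp add: fiber_def)
    have "\<gamma> + \<rho> \<noteq> 0"
    proof
      assume "\<gamma> + \<rho> = 0"
      then have "\<rho> = - \<gamma>" by (simp add: add_eq_0_iff)
      then show False using or ord_minus[OF d(1)] ord_\<Delta>M[OF g] by simp
    qed
    then show "bracket (E \<gamma>) (E \<rho>) \<in> cspan (E ` ?A)"
    proof (rule bracket_E_E_in[OF complex_lie.subspace_span d])
      assume s: "\<gamma> + \<rho> \<in> \<Delta>" and n: "bracket (E \<gamma>) (E \<rho>) \<noteq> 0"
      have "E \<gamma> \<in> M" using E_M_iff[OF d(1)] g by blast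
      then have "bracket (E \<gamma>) (E \<rho>) \<in> W" using ad_stableD[OF W(2)] r by blast
      then have "E (\<gamma> + \<rho>) \<in> W" by (rule E_from_bracket[OF W(1) d s n])
      moreover have "rT (\<gamma> + \<rho>) = rT \<phi>" using r by (simp add: rT_add rT_\<Delta>M[OF g] fiber_def)
      ultimately show "E (\<gamma> + \<rho>) \<in> cspan (E ` ?A)"
        using s by (intro complex_lie.span_base) (simp add: fiber_def)
    qed
  qed auto
  then show ?thesis using \<mu> by (auto simp: fiber_def)
qed

lemma raise_exists:
  assumes \<phi>: "\<phi> \<in> \<Delta>" and o: "ord \<phi> < ord \<psi>"
  shows "\<exists>\<alpha>\<in>So. \<exists>\<mu>\<in>\<Delta>. rT \<mu> = rT \<phi> \<and> bracket (E \<mu>) (E \<alpha>) \<noteq> 0"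
proof (rule ccontr)
  assume no: "\<not> (\<exists>\<alpha>\<in>So. \<exists>\<mu>\<in>\<Delta>. rT \<mu> = rT \<phi> \<and> bracket (E \<mu>) (E \<alpha>) \<noteq> 0)"
  have F: "\<phi> \<in> fiber \<phi>" using \<phi> by (simp add: fiber_def)
  have finF: "finite (fiber \<phi>)" using finite_subset[OF fiber_\<Delta> finite_\<Delta>] .
  have "Max (ht ` fiber \<phi>) \<in> ht ` fiber \<phi>" by (rule Max_in) (use F finF in auto)
  then obtain \<mu> where \<mu>: "\<mu> \<in> fiber \<phi>" "Max (ht ` fiber \<phi>) = ht \<mu>" by blast
  have max: "ht \<rho> \<le> ht \<mu>" if "\<rho> \<in> fiber \<phi>" for \<rho>
    using Max_ge[of "ht ` fiber \<phi>" "ht \<rho>"] that finF \<mu>(2) by simp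
  have d: "\<mu> \<in> \<Delta>" and r: "rT \<mu> = rT \<phi>" using \<mu>(1) by (simp_all add: fiber_def)
  have "bracket (E \<alpha>) (E \<mu>) = 0" if \<alpha>: "\<alpha> \<in> S" for \<alpha>
  proof (cases "\<alpha> \<in> So")
    case True
    then have "bracket (E \<mu>) (E \<alpha>) = 0" using no d r by blast
    then show ?thesis using bracket_antisym[of "E \<alpha>" "E \<mu>"] by simp
  next
    case False
    then have g: "\<alpha> \<in> \<Delta>M" using \<alpha> by (simp add: So_eq)
    have a: "\<alpha> \<in> \<Delta>" using g \<Delta>M_\<Delta> by blast
    show ?thesis
    proof (rule ccontr)
      assume n: "bracket (E \<alpha>) (E \<mu>) \<noteq> 0"
      have "\<alpha> + \<mu> \<noteq> 0"
      proof
        assume "\<alpha> + \<mu> = 0"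
        then have e: "\<mu> = - \<alpha>" by (simp add: add_eq_0_iff)
        \<comment> \<open>This can only happen over the zero restriction; then
          \<open>\<alpha>\<close> lies in the same fiber as \<open>- \<alpha>\<close> and is
          higher.\<close>
        then have "\<alpha> \<in> fiber \<phi>"
          using rT_eq_iff[OF a d] r ord_\<Delta>M[OF g] \<Delta>M_coeff[OF g] \<Delta>M_coeff[OF \<Delta>M_minus[OF g]] a
          by (simp add: fiber_def)
        then show False using max ht_minus[OF a] ht_simple[OF \<alpha>] e by fastforce
      qed
      then have s: "\<alpha> + \<mu> \<in> \<Delta>" by (rule bracket_nonzero_root[OF a d n])
      have "\<alpha> + \<mu> \<in> fiber \<phi>" using s r by (simp add: fiber_def rT_add rT_\<Delta>M[OF g])
      then show False using max ht_add[OF a d s] ht_simple[OF \<alpha>] by fastforce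
    qed
  qed
  then have "\<psi> = \<mu>" by (rule highest_rootI[OF d])
  then show False using o ord_cong[OF d \<phi> r] by simp
qed

lemma sum_neq_0:
  assumes "\<phi> \<in> \<Delta>" "ord \<phi> + ord \<mu> \<noteq> 0"
  shows "\<phi> + \<mu> \<noteq> 0"
proof
  assume "\<phi> + \<mu> = 0"
  then have "\<mu> = - \<phi>" by (simp add: add_eq_0_iff)
  then show False using assms(2) ord_minus[OF assms(1)] by simp
qed

lemma raise:
  assumes \<phi>: "\<phi> \<in> \<Delta>" and o: "1 \<le> ord \<phi>" "ord \<phi> < ord \<psi>"
  obtains \<alpha> \<mu> where "\<alpha> \<in> So" "\<alpha> \<in> \<Delta>" "\<mu> \<in> \<Delta>" "rT \<mu> = rT \<phi>"
    "bracket (E \<mu>) (E \<alpha>) \<noteq> 0" "\<mu> + \<alpha> \<in> \<Delta>" "ord (\<mu> + \<alpha>) = ord \<phi> + 1"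
proof -
  from raise_exists[OF \<phi> o(2)] obtain \<alpha> \<mu> where \<alpha>: "\<alpha> \<in> So" and \<mu>: "\<mu> \<in> \<Delta>" "rT \<mu> = rT \<phi>"
    and n: "bracket (E \<mu>) (E \<alpha>) \<noteq> 0" by blast
  have a: "\<alpha> \<in> \<Delta>" using \<alpha> So_\<Delta> by blast
  have om: "ord \<mu> = ord \<phi>" by (rule ord_cong[OF \<mu>(1) \<phi> \<mu>(2)])
  have "\<mu> + \<alpha> \<noteq> 0" by (rule sum_neq_0[OF \<mu>(1)]) (use om o(1) ord_simple[OF \<alpha>] in simp)
  then have s: "\<mu> + \<alpha> \<in> \<Delta>" by (rule bracket_nonzero_root[OF \<mu>(1) a n])
  show thesis
    by (rule that[OF \<alpha> a \<mu> n s]) (simp add: ord_add[OF \<mu>(1) a s] om ord_simple[OF \<alpha>])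
qed

lemma ord_le_highest: "\<phi> \<in> \<Delta> \<Longrightarrow> ord \<phi> \<le> ord \<psi>"
  unfolding ord_def by (rule sum_mono) (use highest_root_max So_S in blast)

text \<open>No coefficient exceeds that of \<open>\<psi>\<close>, so equal sums over
  \<open>So\<close> force equal coefficients there.\<close>

lemma ord_eq_highest:
  assumes "\<phi> \<in> \<Delta>" "ord \<phi> = ord \<psi>"
  shows "rT \<phi> = rT \<psi>"
proof -
  have le: "cf \<phi> \<alpha> \<le> cf \<psi> \<alpha>" if "\<alpha> \<in> So" for \<alpha> using that highest_root_max[OF assms(1)] So_S by blast
  have "cf \<phi> \<alpha> = cf \<psi> \<alpha>" if "\<alpha> \<in> So" for \<alpha>
    using sum_mono_inv[of "cf \<phi>" So "cf \<psi>" \<alpha>] assms(2) le that finite_So by (simp add: ord_def)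
  then show ?thesis using rT_eq_iff[OF assms(1) highest_root] by blast
qed

text \<open>Properness of \<open>Q\<close> enters here: if \<open>\<Delta>N\<close> were empty,
  \<open>Q\<close> would contain \<open>H\<close> and all root vectors.\<close>

lemma ord_highest_pos: "ord \<psi> \<ge> 1"
proof -
  have "\<Delta>N \<noteq> {}"
  proof
    assume "\<Delta>N = {}"
    then have "\<And>\<phi>. \<phi> \<in> \<Delta> \<Longrightarrow> E \<phi> \<in> Q"
      using neg_in_\<Delta> by (force simp: \<Delta>N_def)
    then have "hpart x + (\<Sum>\<phi>\<in>\<Delta>. coord (E \<phi>) x *\<^sub>C E \<phi>) \<in> Q" for x
      using hpart_in_H H_Q
      by (intro complex_lie.subspace_add[OF subspace_Q] complex_lie.subspace_sum[OF subspace_Q]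
          complex_lie.subspace_scale[OF subspace_Q]) auto
    then have "Q = UNIV" unfolding root_decomposition[symmetric] by blast
    then show False using Q_proper by simp
  qed
  then obtain \<phi> where p: "\<phi> \<in> \<Delta>N" by blast
  have "\<phi> \<in> \<Delta>" using p \<Delta>N_\<Delta> by blast
  then show ?thesis using \<Delta>N_iff p ord_le_highest by fastforce
qed

end

section \<open>Central series and quotients\<close>

text \<open>Reduces centrality of cosets to a condition on elements: \<open>coset_bracket\<close> of
  two cosets is the coset of the bracket of representatives, which is \<open>I\<close> exactly when
  that bracket lies in \<open>I\<close>.\<close>

lemma lie_quotient_center_eq:
  assumes I: "lie_ideal I A"
  shows "lie_quotient_center A I = lie_quotient {x\<in>A. \<forall>y\<in>A. bracket x y \<in> I} I"
proof -
  let ?c = "\<lambda>x. {x + y | y. y \<in> I}"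
  have sub: "csubspace I" and IA: "I \<subseteq> A" and br: "\<And>x y. x \<in> A \<Longrightarrow> y \<in> I \<Longrightarrow> bracket x y \<in> I"
    using I by (auto simp: lie_ideal_def)
  have br': "bracket y x \<in> I" if "x \<in> A" "y \<in> I" for x y
    using complex_lie.subspace_neg[OF sub br[OF that]] bracket_antisym[of y x] by simp
  have self: "x \<in> ?c x" for x
    using complex_lie.subspace_0[OF sub] by (intro CollectI exI[of _ 0]) simp
  have mem: "bracket x y + w \<in> coset_bracket I (?c x) (?c y)" if "w \<in> I" for x y w
    unfolding coset_bracket_def
    by (rule CollectI, rule exI[of _ x], rule exI[of _ y], rule exI[of _ w])
      (intro conjI refl self that)
  have key: "coset_bracket I (?c x) (?c y) = I \<longleftrightarrow> bracket x y \<in> I" if x: "x \<in> A" and y: "y \<in> A" for x y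
  proof
    assume "coset_bracket I (?c x) (?c y) = I"
    then show "bracket x y \<in> I" using mem[OF complex_lie.subspace_0[OF sub], of x y] by simp
  next
    assume xy: "bracket x y \<in> I"
    have in_I: "bracket (x + u) (y + v) \<in> I" if "u \<in> I" "v \<in> I" for u v
    proof -
      have "bracket (x + u) (y + v) = (bracket x y + bracket x v) + (bracket u y + bracket u v)"
        by (simp add: bracket_add_left bracket_add_right algebra_simps)
      moreover have "bracket u v \<in> I" using br'[OF subsetD[OF IA that(2)] that(1)] .
      ultimately show ?thesis
        using xy br[OF x that(2)] br'[OF y that(1)] complex_lie.subspace_add[OF sub] by simp
    qed
    show "coset_bracket I (?c x) (?c y) = I"
    proof (intro equalityI subsetI)
      fix z assume "z \<in> coset_bracket I (?c x) (?c y)"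
      then obtain u v w where "z = bracket (x + u) (y + v) + w" "u \<in> I" "v \<in> I" "w \<in> I"
        unfolding coset_bracket_def by blast
      then show "z \<in> I" using in_I complex_lie.subspace_add[OF sub] by simp
    next
      fix z assume "z \<in> I"
      then have "z - bracket x y \<in> I" by (rule complex_lie.subspace_diff[OF sub _ xy])
      from mem[OF this, of x y] show "z \<in> coset_bracket I (?c x) (?c y)" by simp
    qed
  qed
  show ?thesis
  proof (intro equalityI subsetI)
    fix C assume C: "C \<in> lie_quotient_center A I"
    then obtain x where x: "x \<in> A" "C = ?c x" by (auto simp: lie_quotient_center_def lie_quotient_def)
    have "bracket x y \<in> I" if y: "y \<in> A" for y
    proof -
      have "?c y \<in> lie_quotient A I" using y unfolding lie_quotient_def by (rule imageI)
      then have "coset_bracket I C (?c y) = I" using C unfolding lie_quotient_center_def by blast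
      then show ?thesis using key[OF x(1) y] x(2) by simp
    qed
    then show "C \<in> lie_quotient {x\<in>A. \<forall>y\<in>A. bracket x y \<in> I} I"
      unfolding lie_quotient_def x(2) using x(1) by (intro imageI) simp
  next
    fix C assume "C \<in> lie_quotient {x\<in>A. \<forall>y\<in>A. bracket x y \<in> I} I"
    then obtain x where x: "x \<in> A" "\<And>y. y \<in> A \<Longrightarrow> bracket x y \<in> I" "C = ?c x"
      by (auto simp: lie_quotient_def)
    have "C \<in> lie_quotient A I" unfolding lie_quotient_def x(3) using x(1) by (rule imageI)
    moreover have "coset_bracket I C D = I" if "D \<in> lie_quotient A I" for D
    proof -
      obtain y where "y \<in> A" "D = ?c y" using \<open>D \<in> lie_quotient A I\<close> by (auto simp: lie_quotient_def)
      then show ?thesis using key[OF x(1)] x(2,3) by simp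
    qed
    ultimately show "C \<in> lie_quotient_center A I" unfolding lie_quotient_center_def by blast
  qed
qed

lemma lie_prod_stable:
  assumes A: "ad_stable M A" and C: "ad_stable M C"
  shows "ad_stable M (lie_prod A C)"
  unfolding lie_prod_def
proof (rule ad_stable_span)
  fix x b assume x: "x \<in> M" and "b \<in> {bracket a b | a b. a \<in> A \<and> b \<in> C}"
  then obtain a c where ac: "b = bracket a c" "a \<in> A" "c \<in> C" by blast
  have "bracket (bracket x a) c \<in> cspan {bracket a b | a b. a \<in> A \<and> b \<in> C}"
    using ad_stableD[OF A x ac(2)] ac(3) by (intro complex_lie.span_base) blast
  moreover have "bracket a (bracket x c) \<in> cspan {bracket a b | a b. a \<in> A \<and> b \<in> C}"
    using ad_stableD[OF C x ac(3)] ac(2) by (intro complex_lie.span_base) blast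
  ultimately show "bracket x b \<in> cspan {bracket a b | a b. a \<in> A \<and> b \<in> C}"
    unfolding ac(1) bracket_derivation[of x a c] by (rule complex_lie.span_add)
qed

lemma subspace_root_space: "csubspace (root_space A \<nu>)"
  by (auto simp: complex_lie.subspace_def root_space_def bracket_add_right bracket_scaleC_right
      scaleC_add_right scaleC_scaleC mult.commute)

context parabolic
begin

section \<open>Root spaces of the centre of the Levi factor\<close>

lemma root_space_T_stable: "ad_stable M (root_space T \<nu>)"
  unfolding ad_stable_def
proof (intro ballI)
  fix m z assume m: "m \<in> M" and z: "z \<in> root_space T \<nu>"
  have "bracket x (bracket m z) = \<nu> x *\<^sub>C bracket m z" if x: "x \<in> T" for x
  proof -
    have "bracket x m = 0" using x m unfolding T lie_center_def by blast
    moreover have "bracket x z = \<nu> x *\<^sub>C z" using z x by (simp add: root_space_def)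
    ultimately show ?thesis by (simp add: bracket_derivation[of x m z] bracket_scaleC_right)
  qed
  then show "bracket m z \<in> root_space T \<nu>" by (simp add: root_space_def)
qed

lemma stable_M_imp_H: "ad_stable M W \<Longrightarrow> ad_stable H W"
  using H_M by (auto simp: ad_stable_def)

text \<open>\<open>T\<close> commutes with \<open>H\<close>, so a point \<open>x0\<close> where
  \<open>\<nu>\<close> is nonzero leaves no room for a component in \<open>H\<close>.\<close>

lemma root_space_T_components:
  assumes z: "z \<in> root_space T \<nu>" and x0: "x0 \<in> T" "\<nu> x0 \<noteq> 0"
  shows "hpart z = 0"
    and "\<mu> \<in> \<Delta> \<Longrightarrow> coord (E \<mu>) z \<noteq> 0 \<Longrightarrow> x \<in> T \<Longrightarrow> \<mu> x = \<nu> x"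
proof -
  note st = stable_components[OF subspace_root_space stable_M_imp_H[OF root_space_T_stable] z]
  have "bracket x0 (hpart z) = \<nu> x0 *\<^sub>C hpart z" using st(1) x0(1) by (simp add: root_space_def)
  moreover have "bracket x0 (hpart z) = 0" by (rule H_abelian[OF subsetD[OF T_H x0(1)] hpart_in_H])
  ultimately show "hpart z = 0" using x0(2) by simp
  assume \<mu>: "\<mu> \<in> \<Delta>" "coord (E \<mu>) z \<noteq> 0" and x: "x \<in> T"
  have "bracket x (E \<mu>) = \<nu> x *\<^sub>C E \<mu>" using st(2)[OF \<mu>] x by (simp add: root_space_def)
  moreover have "bracket x (E \<mu>) = \<mu> x *\<^sub>C E \<mu>" by (rule bracket_H_E[OF \<mu>(1) subsetD[OF T_H x]])
  ultimately show "\<mu> x = \<nu> x" using E_nonzero[OF \<mu>(1)] by simp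
qed

lemma E_root_space_T: "\<mu> \<in> fiber \<phi> \<Longrightarrow> E \<mu> \<in> root_space T (rT \<phi>)"
proof -
  assume \<mu>: "\<mu> \<in> fiber \<phi>"
  have "bracket x (E \<mu>) = rT \<phi> x *\<^sub>C E \<mu>" if x: "x \<in> T" for x
  proof -
    have "rT \<phi> x = \<mu> x" using \<mu> rT_apply[OF x, of \<mu>] by (simp add: fiber_def)
    then show ?thesis using bracket_H_E[OF subsetD[OF fiber_\<Delta> \<mu>] subsetD[OF T_H x]] by simp
  qed
  then show ?thesis by (simp add: root_space_def)
qed

lemma root_space_T_eq:
  assumes \<phi>: "\<phi> \<in> \<Delta>" "ord \<phi> \<noteq> 0"
  shows "root_space T (rT \<phi>) = cspan (E ` fiber \<phi>)"
proof
  obtain x0 where x0: "x0 \<in> T" "\<phi> x0 \<noteq> 0" using rT_nonzero[OF \<phi>] .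
  have x0': "rT \<phi> x0 \<noteq> 0" using x0 by (simp add: rT_apply)
  show "root_space T (rT \<phi>) \<subseteq> cspan (E ` fiber \<phi>)"
  proof
    fix z assume z: "z \<in> root_space T (rT \<phi>)"
    show "z \<in> cspan (E ` fiber \<phi>)"
    proof (rule in_span_EI[OF root_space_T_components(1)[OF z x0(1) x0']])
      fix \<mu> assume \<mu>: "\<mu> \<in> \<Delta>" "coord (E \<mu>) z \<noteq> 0"
      have "rT \<mu> = rT \<phi>"
      proof
        fix x show "rT \<mu> x = rT \<phi> x"
          using root_space_T_components(2)[OF z x0(1) x0' \<mu>, of x]
          by (cases "x \<in> T") (simp_all add: restrict_functional_def)
      qed
      then show "\<mu> \<in> fiber \<phi>" using \<mu>(1) by (simp add: fiber_def)
    qed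
  qed
  show "cspan (E ` fiber \<phi>) \<subseteq> root_space T (rT \<phi>)"
    by (rule complex_lie.span_minimal[OF _ subspace_root_space]) (use E_root_space_T in blast)
qed

text \<open>Order 0 is excluded because the roots of \<open>M\<close>, and no other roots, restrict
  to zero.\<close>

lemma roots_T: "roots T = {rT \<phi> | \<phi>. \<phi> \<in> \<Delta> \<and> ord \<phi> \<noteq> 0}"
proof (intro equalityI subsetI)
  fix \<nu> assume "\<nu> \<in> roots T"
  then have \<nu>: "\<nu> \<in> dual_space T" "\<nu> \<noteq> 0" "root_space T \<nu> \<noteq> {0}" by (auto simp: roots_def)
  have out: "\<nu> x = 0" if "x \<notin> T" for x using \<nu>(1) that by (simp add: dual_space_def)
  obtain x0 where "\<nu> x0 \<noteq> 0" using \<nu>(2) by (auto simp: fun_eq_iff)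
  then have x0: "x0 \<in> T" "\<nu> x0 \<noteq> 0" using out by auto
  obtain z where z: "z \<in> root_space T \<nu>" "z \<noteq> 0"
    using \<nu>(3) complex_lie.subspace_0[OF subspace_root_space] by blast
  have "\<exists>\<mu>\<in>\<Delta>. coord (E \<mu>) z \<noteq> 0"
  proof (rule ccontr)
    assume "\<not> ?thesis"
    then have "z = 0" using root_decomposition[of z] root_space_T_components(1)[OF z(1) x0] by simp
    then show False using z(2) by simp
  qed
  then obtain \<mu> where \<mu>: "\<mu> \<in> \<Delta>" "coord (E \<mu>) z \<noteq> 0" ..
  have e: "rT \<mu> = \<nu>"
  proof
    fix x show "rT \<mu> x = \<nu> x"
      using root_space_T_components(2)[OF z(1) x0 \<mu>, of x] out[of x]
      by (cases "x \<in> T") (simp_all add: restrict_functional_def)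
  qed
  have "ord \<mu> \<noteq> 0" using \<Delta>M_iff[OF \<mu>(1)] rT_\<Delta>M[of \<mu>] e \<nu>(2) by blast
  with \<mu>(1) e show "\<nu> \<in> {rT \<phi> | \<phi>. \<phi> \<in> \<Delta> \<and> ord \<phi> \<noteq> 0}" by blast
next
  fix \<nu> assume "\<nu> \<in> {rT \<phi> | \<phi>. \<phi> \<in> \<Delta> \<and> ord \<phi> \<noteq> 0}"
  then obtain \<phi> where \<phi>: "\<nu> = rT \<phi>" "\<phi> \<in> \<Delta>" "ord \<phi> \<noteq> 0" by blast
  have d: "\<phi> \<in> dual_space H" by (rule \<Delta>_dual[OF \<phi>(2)])
  have "rT \<phi> \<in> dual_space T"
    unfolding dual_space_def restrict_functional_def
    using d T_H subspace_T by (auto simp: complex_lie.subspace_def dual_add dual_scale subset_iff)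
  moreover obtain x where "x \<in> T" "\<phi> x \<noteq> 0" using rT_nonzero[OF \<phi>(2,3)] .
  then have "rT \<phi> \<noteq> 0" using rT_apply[of x \<phi>] by (metis zero_fun_apply)
  moreover have "E \<phi> \<in> root_space T (rT \<phi>)" by (rule E_root_space_T) (simp add: fiber_def \<phi>(2))
  then have "root_space T (rT \<phi>) \<noteq> {0}" using E_nonzero[OF \<phi>(2)] by blast
  ultimately show "\<nu> \<in> roots T" unfolding \<phi>(1) roots_def by blast
qed

section \<open>The filtration by order and the upper central series\<close>

text \<open>Its terms from \<open>F (ord \<psi>)\<close> up to \<open>F 1 = N\<close> will be the
  upper central series. The index is an integer, so that differences are never truncated.\<close>

definition F :: "int \<Rightarrow> 'a set" where
  "F k = cspan (E ` {\<phi>\<in>\<Delta>. k \<le> ord \<phi>})"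

lemma subspace_F: "csubspace (F k)"
  unfolding F_def by (rule complex_lie.subspace_span)

lemma E_F_iff: "\<phi> \<in> \<Delta> \<Longrightarrow> E \<phi> \<in> F k \<longleftrightarrow> k \<le> ord \<phi>"
  unfolding F_def by (subst E_in_span_iff) auto

lemma F_mono: "k \<le> l \<Longrightarrow> F l \<subseteq> F k"
  unfolding F_def by (intro complex_lie.span_mono image_mono) auto

lemma N_F: "N = F 1"
proof -
  have "\<Delta>N = {\<phi>\<in>\<Delta>. 1 \<le> ord \<phi>}" using \<Delta>N_iff \<Delta>N_\<Delta> by blast
  then show ?thesis unfolding N_eq F_def by simp
qed

text \<open>\<open>1 \<le> k\<close> excludes opposite roots, whose bracket lies in \<open>H\<close>
  and not in \<open>F k\<close>.\<close>

lemma bracket_E_F: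
  assumes d: "\<phi> \<in> \<Delta>" "\<mu> \<in> \<Delta>" and k: "k \<le> ord \<phi> + ord \<mu>" "1 \<le> k"
  shows "bracket (E \<phi>) (E \<mu>) \<in> F k"
proof -
  have "\<phi> + \<mu> \<noteq> 0" by (rule sum_neq_0[OF d(1)]) (use k in simp)
  then show ?thesis
    by (rule bracket_E_E_in[OF subspace_F d]) (use k in \<open>simp add: E_F_iff ord_add d\<close>)
qed

lemma bracket_F:
  assumes "x \<in> F k" "y \<in> F l" "1 \<le> k + l"
  shows "bracket x y \<in> F (k + l)"
  using assms(1,2) unfolding F_def[of k] F_def[of l]
proof (rule bracket_in_span2[OF _ _ _ subspace_F])
  fix a b assume "a \<in> E ` {\<phi>\<in>\<Delta>. k \<le> ord \<phi>}" "b \<in> E ` {\<phi>\<in>\<Delta>. l \<le> ord \<phi>}"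
  then show "bracket a b \<in> F (k + l)" using bracket_E_F assms(3) by force
qed

lemma F_stable:
  assumes "1 \<le> k"
  shows "ad_stable M (F k)"
  unfolding ad_stable_def
proof (intro ballI)
  fix x y assume x: "x \<in> M" and y: "y \<in> F k"
  have x': "x \<in> cspan (H \<union> E ` \<Delta>M)" using x M_eq by simp
  show "bracket x y \<in> F k"
  proof (rule bracket_in_span2[OF x' y[unfolded F_def] _ subspace_F])
    fix a b assume a: "a \<in> H \<union> E ` \<Delta>M" and b: "b \<in> E ` {\<phi>\<in>\<Delta>. k \<le> ord \<phi>}"
    then obtain \<phi> where \<phi>: "b = E \<phi>" "\<phi> \<in> \<Delta>" "k \<le> ord \<phi>" by blast
    show "bracket a b \<in> F k"
    proof (cases "a \<in> H")
      case True
      then show ?thesis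
        using \<phi> E_F_iff[OF \<phi>(2)] complex_lie.subspace_scale[OF subspace_F] by (simp add: bracket_H_E)
    next
      case False
      then obtain \<gamma> where \<gamma>: "a = E \<gamma>" "\<gamma> \<in> \<Delta>M" using a by blast
      then show ?thesis
        unfolding \<phi>(1) \<gamma>(1)
        using bracket_E_F[OF subsetD[OF \<Delta>M_\<Delta> \<gamma>(2)] \<phi>(2)] \<phi>(3) ord_\<Delta>M[OF \<gamma>(2)] assms by simp
    qed
  qed
qed

text \<open>The condition defines an M-submodule of \<open>N\<close>. If it contained a root vector
  of order below \<open>k\<close>, it would contain the whole fiber, and raising by a simple root in
  \<open>So\<close> would give a vector of order at most \<open>k\<close>, outside
  \<open>F (k + 1)\<close>.\<close>

lemma centralizer_F:
  assumes k: "1 \<le> k" "k \<le> ord \<psi>"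
  shows "{x\<in>F 1. \<forall>y\<in>F 1. bracket x y \<in> F (k + 1)} = F k" (is "?U = _")
proof (intro equalityI subsetI)
  fix x assume x: "x \<in> F k"
  then show "x \<in> ?U" using F_mono[OF k(1)] bracket_F[OF x, of _ 1] k(1) by auto
next
  fix x assume x: "x \<in> ?U"
  have sub: "csubspace ?U"
    using subspace_F[of 1] subspace_F[of "k + 1"]
    by (auto simp: complex_lie.subspace_def bracket_add_left bracket_scaleC_left)
  have st: "ad_stable M ?U"
    unfolding ad_stable_def
  proof (intro ballI)
    fix m u assume m: "m \<in> M" and u: "u \<in> ?U"
    have "bracket (bracket m u) y \<in> F (k + 1)" if y: "y \<in> F 1" for y
    proof -
      have "bracket m (bracket u y) \<in> F (k + 1)"
        using ad_stableD[OF F_stable m, of "k + 1"] u y k(1) by simp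
      moreover have "bracket u (bracket m y) \<in> F (k + 1)"
        using ad_stableD[OF F_stable m y] u by simp
      ultimately show ?thesis
        unfolding bracket_bracket_left by (rule complex_lie.subspace_diff[OF subspace_F])
    qed
    moreover have "bracket m u \<in> F 1" using ad_stableD[OF F_stable m, of 1 u] u by simp
    ultimately show "bracket m u \<in> ?U" by simp
  qed
  note comp = stable_components[OF sub stable_M_imp_H[OF st] x]
  have "hpart x = 0"
    by (rule hpart_span_E[of "{\<phi>\<in>\<Delta>. 1 \<le> ord \<phi>}"]) (use x in \<open>auto simp: F_def\<close>)
  then show "x \<in> F k"
    unfolding F_def
  proof (rule in_span_EI)
    fix \<phi> assume \<phi>: "\<phi> \<in> \<Delta>" "coord (E \<phi>) x \<noteq> 0"
    have EU: "E \<phi> \<in> ?U" by (rule comp(2)[OF \<phi>])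
    then have o1: "1 \<le> ord \<phi>" using E_F_iff[OF \<phi>(1)] by simp
    have "k \<le> ord \<phi>"
    proof (rule ccontr)
      assume lt: "\<not> k \<le> ord \<phi>"
      then have "ord \<phi> < ord \<psi>" using k(2) by simp
      from raise[OF \<phi>(1) o1 this] obtain \<alpha> \<mu> where \<alpha>: "\<alpha> \<in> So" "\<alpha> \<in> \<Delta>"
        and \<mu>: "\<mu> \<in> \<Delta>" "rT \<mu> = rT \<phi>" and n: "bracket (E \<mu>) (E \<alpha>) \<noteq> 0"
        and s: "\<mu> + \<alpha> \<in> \<Delta>" "ord (\<mu> + \<alpha>) = ord \<phi> + 1" .
      have "E \<mu> \<in> ?U"
        by (rule submodule_contains_fiber[OF sub st \<phi>(1) _ EU \<mu>]) (use o1 in simp)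
      moreover have "E \<alpha> \<in> F 1" using E_F_iff[OF \<alpha>(2)] ord_simple[OF \<alpha>(1)] by simp
      ultimately have br: "bracket (E \<mu>) (E \<alpha>) \<in> F (k + 1)" by simp
      have "E (\<mu> + \<alpha>) \<in> F (k + 1)" by (rule E_from_bracket[OF subspace_F \<mu>(1) \<alpha>(2) s(1) n br])
      then show False using E_F_iff[OF s(1)] s(2) lt by simp
    qed
    then show "\<phi> \<in> {\<phi>\<in>\<Delta>. k \<le> ord \<phi>}" using \<phi>(1) by simp
  qed
qed

lemma F_top: "F (ord \<psi> + 1) = {0}"
proof -
  have "{\<phi>\<in>\<Delta>. ord \<psi> + 1 \<le> ord \<phi>} = {}" using ord_le_highest by force
  then show ?thesis unfolding F_def by (simp only: image_empty complex_lie.span_empty)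
qed

text \<open>The case of \<open>centralizer_F\<close> in which the next term of the filtration is
  zero.\<close>

lemma center_N: "lie_center N = F (ord \<psi>)"
  using centralizer_F[OF ord_highest_pos order_refl] unfolding lie_center_def N_F F_top by simp

lemma root_space_highest: "root_space T (rT \<psi>) = F (ord \<psi>)"
proof -
  have "fiber \<psi> = {\<phi>\<in>\<Delta>. ord \<psi> \<le> ord \<phi>}"
  proof (intro equalityI subsetI)
    fix \<phi> assume "\<phi> \<in> fiber \<psi>"
    then show "\<phi> \<in> {\<phi>\<in>\<Delta>. ord \<psi> \<le> ord \<phi>}" using ord_cong[OF _ highest_root] by (simp add: fiber_def)
  next
    fix \<phi> assume "\<phi> \<in> {\<phi>\<in>\<Delta>. ord \<psi> \<le> ord \<phi>}"
    then show "\<phi> \<in> fiber \<psi>"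
      using ord_eq_highest ord_le_highest[of \<phi>] by (simp add: fiber_def)
  qed
  then show ?thesis
    using root_space_T_eq[OF highest_root] ord_highest_pos unfolding F_def by simp
qed

text \<open>Repeated raising from a simple root in \<open>So\<close> skips no order; this makes the
  terms of the series distinct.\<close>

lemma root_of_order:
  assumes "1 \<le> k" "k \<le> ord \<psi>"
  obtains \<phi> where "\<phi> \<in> \<Delta>" "ord \<phi> = k"
proof -
  have "k \<le> ord \<psi> \<longrightarrow> (\<exists>\<phi>\<in>\<Delta>. ord \<phi> = k)"
    using assms(1)
  proof (induction k rule: int_ge_induct)
    case base
    have "So \<noteq> {}" using ord_highest_pos unfolding ord_def by force
    then show ?case using ord_simple So_\<Delta> by blast
  next
    case (step k)
    show ?case
    proof
      assume le: "k + 1 \<le> ord \<psi>"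
      then obtain \<phi> where \<phi>: "\<phi> \<in> \<Delta>" "ord \<phi> = k" using step by auto
      have "1 \<le> ord \<phi>" "ord \<phi> < ord \<psi>" using \<phi>(2) le step.hyps by simp_all
      from raise[OF \<phi>(1) this] obtain \<alpha> \<mu> where "\<mu> + \<alpha> \<in> \<Delta>" "ord (\<mu> + \<alpha>) = ord \<phi> + 1" .
      then show "\<exists>\<phi>\<in>\<Delta>. ord \<phi> = k + 1" using \<phi>(2) by (intro bexI[of _ "\<mu> + \<alpha>"]) simp_all
    qed
  qed
  then show thesis using assms(2) that by blast
qed

lemma F_ideal: "1 \<le> k \<Longrightarrow> lie_ideal (F k) N"
proof -
  assume k: "1 \<le> k"
  have "bracket x y \<in> F k" if "x \<in> F 1" "y \<in> F k" for x y
    using bracket_F[OF that] k F_mono[of k "1 + k"] by auto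
  then show ?thesis
    unfolding lie_ideal_def N_F using subspace_F F_mono[OF k] by blast
qed

lemma upper_central_series_F:
  assumes k: "int k = ord \<psi>" and Z: "\<And>i. 1 \<le> i \<Longrightarrow> i \<le> k \<Longrightarrow> Z i = F (int k - int i + 1)"
  shows "upper_central_series N k Z"
  unfolding upper_central_series_def
proof (intro conjI ballI)
  show k1: "1 \<le> k" using k ord_highest_pos by simp
  show "lie_ideal (Z i) N" if "i \<in> {1..k}" for i
    using that Z[of i] F_ideal by simp
  show "Z 1 = lie_center N" using Z[of 1] k1 k center_N by simp
  show "Z k = N" using Z[of k] k1 N_F by simp
  fix i assume i: "i \<in> {2..k}"
  \<comment> \<open>The series runs against the filtration: \<open>Z i\<close> is \<open>F l\<close>
    and \<open>Z (i - 1)\<close> is \<open>F (l + 1)\<close>; \<open>i \<ge> 2\<close> gives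
    \<open>l < ord \<psi>\<close>.\<close>
  define l where "l = int k - int i + 1"
  have l: "1 \<le> l" "l < ord \<psi>" "l + 1 = int k - int (i - 1) + 1" using i k by (auto simp: l_def)
  have Zi: "Z i = F l" "Z (i - 1) = F (l + 1)"
    using Z[of i] Z[of "i - 1"] i unfolding l(3) by (auto simp: l_def)
  obtain \<phi> where "\<phi> \<in> \<Delta>" "ord \<phi> = l" using root_of_order[of l] l by auto
  then have "E \<phi> \<in> F l" "E \<phi> \<notin> F (l + 1)" by (simp_all add: E_F_iff)
  then show "Z (i - 1) \<subset> Z i" unfolding Zi using F_mono[of l "l + 1"] by auto
  have "lie_quotient_center N (F (l + 1)) = lie_quotient {x\<in>N. \<forall>y\<in>N. bracket x y \<in> F (l + 1)} (F (l + 1))"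
    by (rule lie_quotient_center_eq[OF F_ideal]) (use l in simp)
  also have "{x\<in>N. \<forall>y\<in>N. bracket x y \<in> F (l + 1)} = F l"
    unfolding N_F by (rule centralizer_F) (use l in auto)
  finally show "lie_quotient (Z i) (Z (i - 1)) = lie_quotient_center N (Z (i - 1))"
    unfolding Zi by simp
qed

section \<open>Comparison with the graded parts and conclusion\<close>

text \<open>\<open>t_coeff\<close> takes an arbitrary root with the given restriction, and the
  coefficients at \<open>So\<close> do not depend on that choice.\<close>

lemma t_order_eq:
  assumes \<alpha>: "bij_betw \<alpha> {1..cdim T} So" and \<phi>: "\<phi> \<in> \<Delta>"
  shows "t_order H S T \<alpha> (rT \<phi>) = ord \<phi>"
proof -
  define \<mu> where "\<mu> = (SOME \<mu>. \<mu> \<in> roots H \<and> rT \<mu> = rT \<phi>)"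
  have "\<mu> \<in> roots H \<and> rT \<mu> = rT \<phi>"
    unfolding \<mu>_def by (rule someI[of _ \<phi>]) (simp add: \<Delta>_eq_roots \<phi>)
  then have \<mu>: "\<mu> \<in> \<Delta>" "rT \<mu> = rT \<phi>" by (simp_all add: \<Delta>_eq_roots)
  have "t_order H S T \<alpha> (rT \<phi>) = (\<Sum>j\<in>{1..cdim T}. cf \<mu> (\<alpha> j))"
    by (simp add: t_order_def t_coeff_def \<mu>_def)
  also have "\<dots> = ord \<mu>" unfolding ord_def by (rule sum.reindex_bij_betw[OF \<alpha>])
  finally show ?thesis using ord_cong[OF \<mu>(1) \<phi> \<mu>(2)] by simp
qed

text \<open>\<open>k = 0\<close> is different: roots of order 0 belong to \<open>M\<close> and
  restrict to zero, which is not a root of \<open>T\<close>.\<close>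

lemma graded_part_eq:
  assumes \<alpha>: "bij_betw \<alpha> {1..cdim T} So" and k: "1 \<le> k"
  shows "graded_part H S T \<alpha> k = cspan (E ` {\<phi>\<in>\<Delta>. ord \<phi> = int k})"
proof
  show "graded_part H S T \<alpha> k \<subseteq> cspan (E ` {\<phi>\<in>\<Delta>. ord \<phi> = int k})"
    unfolding graded_part_def
  proof (rule complex_lie.span_minimal[OF _ complex_lie.subspace_span], rule UN_least)
    fix \<nu> assume "\<nu> \<in> {\<nu>\<in>roots T. t_order H S T \<alpha> \<nu> = int k}"
    then obtain \<phi> where \<phi>: "\<nu> = rT \<phi>" "\<phi> \<in> \<Delta>" "ord \<phi> \<noteq> 0" "t_order H S T \<alpha> (rT \<phi>) = int k"
      unfolding roots_T by blast
    have "fiber \<phi> \<subseteq> {\<mu>\<in>\<Delta>. ord \<mu> = int k}"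
      using \<phi>(4) ord_cong[OF _ \<phi>(2)] by (auto simp: fiber_def t_order_eq[OF \<alpha> \<phi>(2)])
    then show "root_space T \<nu> \<subseteq> cspan (E ` {\<phi>\<in>\<Delta>. ord \<phi> = int k})"
      unfolding \<phi>(1) root_space_T_eq[OF \<phi>(2,3)] by (intro complex_lie.span_mono image_mono)
  qed
  show "cspan (E ` {\<phi>\<in>\<Delta>. ord \<phi> = int k}) \<subseteq> graded_part H S T \<alpha> k"
    unfolding graded_part_def
  proof (rule complex_lie.span_mono, clarify)
    fix \<phi> assume \<phi>: "\<phi> \<in> \<Delta>" "ord \<phi> = int k"
    have "rT \<phi> \<in> roots T" unfolding roots_T using \<phi> k by auto
    moreover have "E \<phi> \<in> root_space T (rT \<phi>)" by (rule E_root_space_T) (simp add: fiber_def \<phi>(1))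
    ultimately show "E \<phi> \<in> (\<Union>\<nu>\<in>{\<nu>\<in>roots T. t_order H S T \<alpha> \<nu> = int k}. root_space T \<nu>)"
      using t_order_eq[OF \<alpha> \<phi>(1)] \<phi>(2) by (intro UN_I[of "rT \<phi>"]) auto
  qed
qed

lemma sum_graded_parts:
  assumes \<alpha>: "bij_betw \<alpha> {1..cdim T} So" and k: "int k = ord \<psi>" and i: "1 \<le> i" "i \<le> k"
  shows "cspan (\<Union>j\<in>{1..i}. graded_part H S T \<alpha> (k - j + 1)) = F (int k - int i + 1)"
proof
  have g: "graded_part H S T \<alpha> (k - j + 1) = cspan (E ` {\<phi>\<in>\<Delta>. ord \<phi> = int k - int j + 1})"
    if "j \<in> {1..i}" for j
  proof -
    \<comment> \<open>No truncation occurs, since \<open>j \<le> i \<le> k\<close>.\<close>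
    have e: "int (k - j + 1) = int k - int j + 1" using that i by (simp add: of_nat_diff)
    show ?thesis using graded_part_eq[OF \<alpha>, of "k - j + 1"] unfolding e by simp
  qed
  show "cspan (\<Union>j\<in>{1..i}. graded_part H S T \<alpha> (k - j + 1)) \<subseteq> F (int k - int i + 1)"
  proof (rule complex_lie.span_minimal[OF UN_least subspace_F])
    fix j assume j: "j \<in> {1..i}"
    show "graded_part H S T \<alpha> (k - j + 1) \<subseteq> F (int k - int i + 1)"
      unfolding g[OF j] F_def by (intro complex_lie.span_mono image_mono) (use j in auto)
  qed
  show "F (int k - int i + 1) \<subseteq> cspan (\<Union>j\<in>{1..i}. graded_part H S T \<alpha> (k - j + 1))"
    unfolding F_def
  proof (rule complex_lie.span_minimal[OF _ complex_lie.subspace_span], clarify)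
    fix \<phi> assume \<phi>: "\<phi> \<in> \<Delta>" "int k - int i + 1 \<le> ord \<phi>"
    have "ord \<phi> \<le> int k" using ord_le_highest[OF \<phi>(1)] k by simp
    \<comment> \<open>The index for which \<open>k - j + 1\<close> is the order of
      \<open>\<phi>\<close>.\<close>
    define j where "j = nat (int k - ord \<phi> + 1)"
    have j: "j \<in> {1..i}" "int k - int j + 1 = ord \<phi>"
      using \<phi>(2) \<open>ord \<phi> \<le> int k\<close> i by (auto simp: j_def)
    have "E \<phi> \<in> graded_part H S T \<alpha> (k - j + 1)"
      unfolding g[OF j(1)] by (rule complex_lie.span_base) (use \<phi>(1) j(2) in simp)
    then show "E \<phi> \<in> cspan (\<Union>j\<in>{1..i}. graded_part H S T \<alpha> (k - j + 1))"
      using j(1) by (intro complex_lie.span_base) blast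
  qed
qed

text \<open>The product of the two root spaces is an M-submodule of the root space of the sum, and
  it contains one root vector by \<open>raise\<close>; irreducibility makes it everything.\<close>

lemma raise_t_root:
  assumes \<alpha>: "bij_betw \<alpha> {1..cdim T} So" and i: "1 \<le> i" "int i < ord \<psi>"
    and \<nu>: "\<nu> \<in> roots T" "root_space T \<nu> \<subseteq> graded_part H S T \<alpha> i"
  shows "\<exists>j\<in>{1..cdim T}. \<nu> + rT (\<alpha> j) \<in> roots T \<and>
    root_space T (\<nu> + rT (\<alpha> j)) \<subseteq> graded_part H S T \<alpha> (i + 1) \<and>
    lie_prod (root_space T \<nu>) (root_space T (rT (\<alpha> j))) = root_space T (\<nu> + rT (\<alpha> j)) \<and>
    lie_prod (root_space T \<nu>) (root_space T (rT (\<alpha> j))) \<noteq> {0}"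
proof -
  obtain \<phi> where \<phi>: "\<nu> = rT \<phi>" "\<phi> \<in> \<Delta>" "ord \<phi> \<noteq> 0" using \<nu>(1) unfolding roots_T by blast
  have "E \<phi> \<in> root_space T \<nu>" unfolding \<phi>(1) by (rule E_root_space_T) (simp add: fiber_def \<phi>(2))
  \<comment> \<open>The order of \<open>\<phi>\<close> is recovered from the inclusion, because the
    root vectors are independent.\<close>
  then have "E \<phi> \<in> cspan (E ` {\<phi>\<in>\<Delta>. ord \<phi> = int i})" using \<nu>(2) graded_part_eq[OF \<alpha> i(1)] by blast
  then have o: "ord \<phi> = int i" using E_in_span_iff[of "{\<phi>\<in>\<Delta>. ord \<phi> = int i}" \<phi>] \<phi>(2) by auto
  then have "1 \<le> ord \<phi>" "ord \<phi> < ord \<psi>" using i by simp_all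
  from raise[OF \<phi>(2) this] obtain \<beta> \<mu> where \<beta>: "\<beta> \<in> So" and b: "\<beta> \<in> \<Delta>"
    and \<mu>: "\<mu> \<in> \<Delta>" "rT \<mu> = rT \<phi>" and n: "bracket (E \<mu>) (E \<beta>) \<noteq> 0"
    and s: "\<mu> + \<beta> \<in> \<Delta>" and "ord (\<mu> + \<beta>) = ord \<phi> + 1" .
  then have os: "ord (\<mu> + \<beta>) = int (i + 1)" using o by simp
  have "\<beta> \<in> \<alpha> ` {1..cdim T}" by (simp only: bij_betw_imp_surj_on[OF \<alpha>] \<beta>)
  then obtain j where j: "j \<in> {1..cdim T}" "\<alpha> j = \<beta>" by (metis imageE)
  have sum: "\<nu> + rT (\<alpha> j) = rT (\<mu> + \<beta>)" by (simp add: \<phi>(1) j(2) \<mu>(2) rT_add)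
  have 1: "rT (\<mu> + \<beta>) \<in> roots T" unfolding roots_T using s os by auto
  have 2: "root_space T (rT (\<mu> + \<beta>)) \<subseteq> graded_part H S T \<alpha> (i + 1)"
    unfolding graded_part_def using 1 t_order_eq[OF \<alpha> s] os
    by (intro order_trans[OF _ complex_lie.span_superset] UN_upper) simp
  let ?L = "lie_prod (root_space T \<nu>) (root_space T (rT \<beta>))"
  have L: "csubspace ?L" unfolding lie_prod_def by (rule complex_lie.subspace_span)
  have LM: "ad_stable M ?L" by (rule lie_prod_stable[OF root_space_T_stable root_space_T_stable])
  have "E \<mu> \<in> root_space T \<nu>" unfolding \<phi>(1) by (rule E_root_space_T) (simp add: fiber_def \<mu>)
  moreover have "E \<beta> \<in> root_space T (rT \<beta>)" by (rule E_root_space_T) (simp add: fiber_def b)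
  ultimately have br: "bracket (E \<mu>) (E \<beta>) \<in> ?L"
    unfolding lie_prod_def by (intro complex_lie.span_base) blast
  then have EL: "E (\<mu> + \<beta>) \<in> ?L" by (rule E_from_bracket[OF L \<mu>(1) b s n])
  have o0: "ord (\<mu> + \<beta>) \<noteq> 0" using os by simp
  have 3: "?L = root_space T (rT (\<mu> + \<beta>))"
  proof
    show "?L \<subseteq> root_space T (rT (\<mu> + \<beta>))"
      unfolding lie_prod_def
    proof (rule complex_lie.span_minimal[OF _ subspace_root_space], clarify)
      fix u v assume u: "u \<in> root_space T \<nu>" and v: "v \<in> root_space T (rT \<beta>)"
      have "bracket x (bracket u v) = rT (\<mu> + \<beta>) x *\<^sub>C bracket u v" if x: "x \<in> T" for x
      proof -
        have "bracket x u = \<nu> x *\<^sub>C u" "bracket x v = rT \<beta> x *\<^sub>C v"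
          using u v x by (simp_all add: root_space_def)
        then show ?thesis
          using sum by (simp add: bracket_derivation[of x u v] bracket_scaleC_left bracket_scaleC_right
              rT_add \<phi>(1) \<mu>(2) flip: scaleC_add_left)
      qed
      then show "bracket u v \<in> root_space T (rT (\<mu> + \<beta>))" by (simp add: root_space_def)
    qed
    show "root_space T (rT (\<mu> + \<beta>)) \<subseteq> ?L"
      unfolding root_space_T_eq[OF s o0]
    proof (rule complex_lie.span_minimal[OF _ L], clarify)
      fix \<rho> assume "\<rho> \<in> fiber (\<mu> + \<beta>)"
      then show "E \<rho> \<in> ?L"
        by (intro submodule_contains_fiber[OF L LM s o0 EL]) (simp_all add: fiber_def)
    qed
  qed
  have 4: "?L \<noteq> {0}" using EL E_nonzero[OF s] by blast
  show ?thesis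
    by (rule bexI[OF _ j(1)], unfold sum, unfold j(2), intro conjI 1 2 3 4)
qed

end

theorem theorem2p11:
  fixes H Q M T N :: "'a::complex_lie_algebra set"
    and S :: "('a \<Rightarrow> complex) set"
    and \<alpha> \<beta> :: "nat \<Rightarrow> 'a \<Rightarrow> complex"
    and n :: "nat \<Rightarrow> 'a set"
    and \<nu>cent :: "'a \<Rightarrow> complex"
    and kcent :: nat
  assumes "finite_dimensional (UNIV :: 'a set)"
    and "lie_simple (UNIV :: 'a set)"
    and "cartan_subalgebra H"
    and "simple_root_system H S"
    and "standard_parabolic H S Q" and "Q \<noteq> UNIV"
    and "levi_factor Q M" and "H \<subseteq> M"
    and "N = nilradical Q"
    and "T = lie_center M"
    and "bij_betw \<alpha> {1..cdim T} (simple_roots_outside H S M)"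
    and "\<And>j. \<beta> j = restrict_functional T (\<alpha> j)"
    and "\<And>k. n k = graded_part H S T \<alpha> k"
    and "\<nu>cent = restrict_functional T (highest_root H S)"
    and "kcent = nat (t_order H S T \<alpha> \<nu>cent)"
  shows "(\<forall>i \<nu>. 1 \<le> i \<and> i < kcent \<and> \<nu> \<in> roots T \<and> root_space T \<nu> \<subseteq> n i \<longrightarrow>
            (\<exists>j\<in>{1..cdim T}.
               \<nu> + \<beta> j \<in> roots T \<and> root_space T (\<nu> + \<beta> j) \<subseteq> n (i + 1) \<and>
               lie_prod (root_space T \<nu>) (root_space T (\<beta> j)) = root_space T (\<nu> + \<beta> j) \<and>
               lie_prod (root_space T \<nu>) (root_space T (\<beta> j)) \<noteq> {0})) \<and>
         root_space T \<nu>cent = lie_center N \<and>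
         upper_central_series N kcent (\<lambda>i. cspan (\<Union>j\<in>{1..i}. n (kcent - j + 1)))"
proof -
  have H: "lie_subalgebra H" "lie_nilpotent H" "lie_normalizer H = H"
    using assms(3) by (simp_all add: cartan_subalgebra_def)
  interpret nilpotent_subalgebra H
    by unfold_locales (fact assms(1) H)+
  obtain B wt where B: "adapted B wt" "cspan B = UNIV"
    using adapted_basis_exists .
  interpret parabolic H B wt S Q M T
    by unfold_locales (fact assms H B)+
  note \<alpha> = assms(11)
  \<comment> \<open>\<open>ord \<psi> \<ge> 1\<close>, so the conversion by \<open>nat\<close> loses
    nothing.\<close>
  have k: "int kcent = ord \<psi>"
    using t_order_eq[OF \<alpha> highest_root] ord_highest_pos by (simp add: assms(14,15))
  have "upper_central_series N kcent (\<lambda>i. cspan (\<Union>j\<in>{1..i}. n (kcent - j + 1)))"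
    unfolding assms(9,13)
    by (rule upper_central_series_F[OF k sum_graded_parts[OF \<alpha> k]])
  moreover have "root_space T \<nu>cent = lie_center N"
    unfolding assms(9,14) by (simp only: root_space_highest center_N)
  ultimately show ?thesis
    using raise_t_root[OF \<alpha>] by (simp add: assms(12,13) flip: k)
qed

end
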